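(* Let $n \geq 2$, let $\Omega \subset \mathbb{R}^n$ be a bounded domain of class $\mathcal{C}^2$ with $0 \in \Omega$, and let $\alpha < 0$ be a constant. Let $u \in C^2(\overline{\Omega} \setminus \{0\})$ be a solution to $$\begin{cases} -\Delta u = 1 & \text{in } \Omega \setminus \{0\}, \\ u > 0 & \text{in } \Omega \setminus \{0\}, \\ u = 0 & \text{on } \partial\Omega, \\ \partial_\nu u = \alpha & \text{on } \partial\Omega, \end{cases}$$ where $\nu$ is the outward unit normal on $\partial\Omega$, and assume that $u$ has a non-removable singularity at $0$. Then $\Omega = B_R(0)$ for some $R > 0$, and $$u = u_R + u_F \quad \text{in } \overline{B_R(0)} \setminus \{0\},$$ where $u_R(x) = \dfrac{R^2 - |x|^2}{2n}$ is the unique radial solution to $$\begin{cases} -\Delta u_R = 1 & \text{in } \Omega, \\ u_R = 0 & \text{on } \partial\Omega, \end{cases}$$ and $u_F$ is the fundamental solution given by $$u_F(x) = u_F(|x|) := \begin{cases} \hat C \left( \dfrac{1}{|x|^{n-2}} - \dfrac{1}{R^{n-2}} \right) & \text{if } n \geq 3, \\[2mm] -\hat C (\ln |x| - \ln R) & \text{if } n = 2, \end{cases}$$ for some positive constant $\hat C$ depending on the boundary data.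
   Context: A domain is a connected open set, and $B_R(0)$ is the open ball of radius $R$ centered at the origin. The solution $u$ is said to have a non-removable singularity at $0$ if $u$ does not admit a smooth extension all over $\Omega$; namely, it is not possible to find $\tilde u \in H^1(\Omega)$ such that $u \equiv \tilde u$ in $\Omega$ (that is, $u = \tilde u$ a.e. in $\Omega$, $u$ being defined on $\Omega \setminus \{0\}$). *)

theory Defs
  imports "HOL-Analysis.Analysis"
begin

definition partial :: "'n::finite \<Rightarrow> (real^'n \<Rightarrow> real) \<Rightarrow> real^'n \<Rightarrow> real" where
  "partial i f x = frechet_derivative f (at x) (axis i 1)"

definition grad :: "(real^'n::finite \<Rightarrow> real) \<Rightarrow> real^'n \<Rightarrow> real^'n" where
  "grad f x = (\<chi> i. partial i f x)"

definition laplacian :: "(real^'n::finite \<Rightarrow> real) \<Rightarrow> real^'n \<Rightarrow> real" where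
  "laplacian f x = (\<Sum>i\<in>UNIV. partial i (partial i f) x)"

text \<open>The class \<open>C\<^sup>k(S)\<close>, meant for open sets \<open>S\<close>.\<close>

primrec Ck_on :: "nat \<Rightarrow> (real^'n::finite) set \<Rightarrow> (real^'n \<Rightarrow> real) \<Rightarrow> bool" where
  "Ck_on 0 S f \<longleftrightarrow> continuous_on S f"
| "Ck_on (Suc k) S f \<longleftrightarrow> (\<forall>x\<in>S. f differentiable (at x)) \<and> (\<forall>i. Ck_on k S (partial i f))"

definition extends_continuously ::
  "(real^'n::finite) set \<Rightarrow> (real^'n) set \<Rightarrow> (real^'n \<Rightarrow> real) \<Rightarrow> bool" where
  "extends_continuously S T f \<longleftrightarrow> (\<exists>g. continuous_on T g \<and> (\<forall>x\<in>S. g x = f x))"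

text \<open>The class \<open>C\<^sup>2(T)\<close> for a set \<open>T\<close> with \<open>S \<subseteq> T \<subseteq> closure S\<close>, \<open>S\<close> open: functions that are
  twice continuously differentiable in \<open>S\<close> and whose derivatives of order at most two extend
  continuously to \<open>T\<close>. The function itself is given on \<open>T\<close>, so it is required to be its own
  extension.\<close>

definition C2_upto :: "(real^'n::finite) set \<Rightarrow> (real^'n) set \<Rightarrow> (real^'n \<Rightarrow> real) \<Rightarrow> bool" where
  "C2_upto S T u \<longleftrightarrow> Ck_on 2 S u \<and> continuous_on T u \<and>
     (\<forall>i. extends_continuously S T (partial i u)) \<and>
     (\<forall>i j. extends_continuously S T (partial j (partial i u)))"

text \<open>For a unit vector \<open>e\<close>, the point \<open>x - (x \<bullet> e) e\<close> is the orthogonal projection of \<open>x\<close> to the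
  hyperplane orthogonal to \<open>e\<close>, which plays the role of \<open>\<real>\<^sup>n\<^sup>-\<^sup>1\<close>. Only the values of \<open>\<gamma>\<close> on
  this hyperplane matter.\<close>

definition graph_fun :: "real^'n::finite \<Rightarrow> (real^'n \<Rightarrow> real) \<Rightarrow> real^'n \<Rightarrow> real" where
  "graph_fun e \<gamma> x = x \<bullet> e - \<gamma> (x - (x \<bullet> e) *\<^sub>R e)"

definition C2_graph_near ::
  "(real^'n::finite) set \<Rightarrow> real^'n \<Rightarrow> real \<Rightarrow> real^'n \<Rightarrow> (real^'n \<Rightarrow> real) \<Rightarrow> bool" where
  "C2_graph_near \<Omega> p r e \<gamma> \<longleftrightarrow> r > 0 \<and> norm e = 1 \<and> Ck_on 2 UNIV \<gamma> \<and>
     \<Omega> \<inter> ball p r = {x \<in> ball p r. graph_fun e \<gamma> x < 0}"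

definition C2_bounded_domain :: "(real^'n::finite) set \<Rightarrow> bool" where
  "C2_bounded_domain \<Omega> \<longleftrightarrow> open \<Omega> \<and> connected \<Omega> \<and> \<Omega> \<noteq> {} \<and> bounded \<Omega> \<and>
     (\<forall>p\<in>frontier \<Omega>. \<exists>r e \<gamma>. C2_graph_near \<Omega> p r e \<gamma>)"

text \<open>Near \<open>p\<close> the set \<open>\<Omega>\<close> is \<open>{graph_fun e \<gamma> < 0}\<close>, so the gradient of this defining function
  is normal to the boundary and points out of \<open>\<Omega>\<close>.\<close>

definition outward_unit_normal :: "(real^'n::finite) set \<Rightarrow> real^'n \<Rightarrow> real^'n \<Rightarrow> bool" where
  "outward_unit_normal \<Omega> p \<nu> \<longleftrightarrow>
     (\<exists>r e \<gamma>. C2_graph_near \<Omega> p r e \<gamma> \<and> \<nu> = sgn (grad (graph_fun e \<gamma>) p))"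

lemma outward_unit_normal_exists:
  assumes "C2_bounded_domain \<Omega>" "p \<in> frontier \<Omega>"
  shows "\<exists>\<nu>. outward_unit_normal \<Omega> p \<nu>"
  using assms unfolding C2_bounded_domain_def outward_unit_normal_def by blast

lemma grad_inner:
  assumes "f differentiable (at x)"
  shows "grad f x \<bullet> h = frechet_derivative f (at x) h"
proof -
  have lin: "linear (frechet_derivative f (at x))"
    using assms by (rule linear_frechet_derivative)
  have "frechet_derivative f (at x) h
      = frechet_derivative f (at x) (\<Sum>i\<in>UNIV. h $ i *\<^sub>R axis i 1)"
    using basis_expansion[of h] by (simp add: scalar_mult_eq_scaleR)
  also have "\<dots> = (\<Sum>i\<in>UNIV. h $ i *\<^sub>R frechet_derivative f (at x) (axis i 1))"
    using lin by (simp add: linear_sum linear_cmul)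
  finally show ?thesis
    by (simp add: grad_def partial_def inner_vec_def mult.commute)
qed

lemma norm_outward_unit_normal:
  assumes "outward_unit_normal \<Omega> p \<nu>"
  shows "norm \<nu> = 1"
proof -
  obtain r e \<gamma> where c: "C2_graph_near \<Omega> p r e \<gamma>" and \<nu>: "\<nu> = sgn (grad (graph_fun e \<gamma>) p)"
    using assms unfolding outward_unit_normal_def by blast
  have e: "e \<bullet> e = 1" using c by (simp add: C2_graph_near_def norm_eq_1)
  define q where "q = p - (p \<bullet> e) *\<^sub>R e"
  have "\<gamma> differentiable (at q)"
    using c by (simp add: C2_graph_near_def numeral_2_eq_2)
  then obtain D where D: "(\<gamma> has_derivative D) (at q)"
    by (auto simp: differentiable_def)
  have P: "((\<lambda>x. x - (x \<bullet> e) *\<^sub>R e) has_derivative (\<lambda>h. h - (h \<bullet> e) *\<^sub>R e)) (at p)"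
    by (auto intro!: derivative_eq_intros)
  have "((\<lambda>x. \<gamma> (x - (x \<bullet> e) *\<^sub>R e)) has_derivative (\<lambda>h. D (h - (h \<bullet> e) *\<^sub>R e))) (at p)"
    using diff_chain_at[OF P, of \<gamma> D] D by (simp add: o_def q_def)
  then have G: "(graph_fun e \<gamma> has_derivative (\<lambda>h. h \<bullet> e - D (h - (h \<bullet> e) *\<^sub>R e))) (at p)"
    unfolding graph_fun_def by (auto intro!: derivative_eq_intros)
  have "D 0 = 0" using D by (meson has_derivative_linear linear_0)
  then have "grad (graph_fun e \<gamma>) p \<bullet> e = 1"
    using grad_inner[of "graph_fun e \<gamma>" p e] frechet_derivative_at[OF G, symmetric] G e
    by (auto simp: differentiable_def)
  then have "grad (graph_fun e \<gamma>) p \<noteq> 0" by auto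
  then show ?thesis by (simp add: \<nu> norm_sgn)
qed

text \<open>The derivative in direction \<open>\<nu>\<close> at the boundary point \<open>x\<close> of \<open>\<Omega>\<close>, taken with the boundary
  value of the gradient.\<close>

definition has_normal_derivative ::
  "(real^'n::finite) set \<Rightarrow> (real^'n \<Rightarrow> real) \<Rightarrow> real^'n \<Rightarrow> real^'n \<Rightarrow> real \<Rightarrow> bool" where
  "has_normal_derivative \<Omega> u \<nu> x a \<longleftrightarrow> ((\<lambda>y. grad u y \<bullet> \<nu>) \<longlongrightarrow> a) (at x within \<Omega>)"

definition test_function :: "(real^'n::finite) set \<Rightarrow> (real^'n \<Rightarrow> real) \<Rightarrow> bool" where
  "test_function \<Omega> \<phi> \<longleftrightarrow> (\<forall>k. Ck_on k UNIV \<phi>) \<and>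
     compact (closure {x. \<phi> x \<noteq> 0}) \<and> closure {x. \<phi> x \<noteq> 0} \<subseteq> \<Omega>"

definition L2_on :: "(real^'n::finite) set \<Rightarrow> (real^'n \<Rightarrow> real) \<Rightarrow> bool" where
  "L2_on \<Omega> f \<longleftrightarrow> set_borel_measurable lebesgue \<Omega> f \<and> set_integrable lebesgue \<Omega> (\<lambda>x. (f x)\<^sup>2)"

definition H1_on :: "(real^'n::finite) set \<Rightarrow> (real^'n \<Rightarrow> real) \<Rightarrow> bool" where
  "H1_on \<Omega> f \<longleftrightarrow> L2_on \<Omega> f \<and>
     (\<forall>i. \<exists>g. L2_on \<Omega> g \<and>
        (\<forall>\<phi>. test_function \<Omega> \<phi> \<longrightarrow>
           (LINT x:\<Omega>|lebesgue. f x * partial i \<phi> x) = - (LINT x:\<Omega>|lebesgue. g x * \<phi> x)))"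

text \<open>Here \<open>u\<close> is a function on \<open>\<Omega> - {0}\<close>; its value at \<open>0\<close> is irrelevant since single points are
  null sets.\<close>

definition nonremovable_singularity_at_0 ::
  "(real^'n::finite) set \<Rightarrow> (real^'n \<Rightarrow> real) \<Rightarrow> bool" where
  "nonremovable_singularity_at_0 \<Omega> u \<longleftrightarrow>
     \<not> (\<exists>v. H1_on \<Omega> v \<and> (AE x\<in>\<Omega> in lebesgue. u x = v x))"

definition torsion_solution :: "(real^'n::finite) set \<Rightarrow> (real^'n \<Rightarrow> real) \<Rightarrow> bool" where
  "torsion_solution \<Omega> v \<longleftrightarrow> Ck_on 2 \<Omega> v \<and> continuous_on (closure \<Omega>) v \<and>
     (\<forall>x\<in>\<Omega>. - laplacian v x = 1) \<and> (\<forall>x\<in>frontier \<Omega>. v x = 0)"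

definition radial_on :: "(real^'n::finite) set \<Rightarrow> (real^'n \<Rightarrow> real) \<Rightarrow> bool" where
  "radial_on S v \<longleftrightarrow> (\<forall>x\<in>S. \<forall>y\<in>S. norm x = norm y \<longrightarrow> v x = v y)"

definition unique_radial_torsion_solution ::
  "(real^'n::finite) set \<Rightarrow> (real^'n \<Rightarrow> real) \<Rightarrow> bool" where
  "unique_radial_torsion_solution \<Omega> v \<longleftrightarrow>
     torsion_solution \<Omega> v \<and> radial_on (closure \<Omega>) v \<and>
     (\<forall>w. torsion_solution \<Omega> w \<and> radial_on (closure \<Omega>) w \<longrightarrow> (\<forall>x\<in>closure \<Omega>. w x = v x))"

definition u_R :: "real \<Rightarrow> real^'n::finite \<Rightarrow> real" where
  "u_R R x = (R\<^sup>2 - (norm x)\<^sup>2) / (2 * real CARD('n))"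

definition u_F :: "real \<Rightarrow> real \<Rightarrow> real^'n::finite \<Rightarrow> real" where
  "u_F C R x =
     (if CARD('n) \<ge> 3 then C * (1 / norm x ^ (CARD('n) - 2) - 1 / R ^ (CARD('n) - 2))
      else - C * (ln (norm x) - ln R))"

end

(* Moving planes adapted to the singularity. For a unit vector e and l > 0 let R be the reflection in
   the hyperplane x . e = l. As long as R maps the cap {x in Omega. x . e > l} into Omega, the function
   w = u o R - u is harmonic in the cap away from the point R 0, where it is bounded below because
   u > 0, and it is nonnegative on the boundary; so w >= 0 by the minimum principle, without any
   continuation in l. If w vanished somewhere, u would be symmetric in R and so regular at 0. Hence
   w > 0, and the two ways in which the reflected cap can stop to fit into Omega are excluded: internal
   tangency by Hopf's lemma, orthogonality by Serrin's corner lemma, since the overdetermined condition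
   forces the mixed second derivative of u to vanish at the corner. So all caps with l > 0 can be
   reflected; letting l -> 0, Omega and u are invariant under rotations. On annuli, u - u_R is then a
   multiple of the fundamental solution by the maximum principle; the factor is nonnegative since
   u > 0, nonzero since the singularity is not removable, and it is determined by alpha and R. *)

theory Submission
  imports Defs
begin

section \<open>Laplacian at a point and the weak minimum principle\<close>

text \<open>Boundary behaviour enters the comparison as a lower limit only: where the reflected
  point may itself reach the boundary or the pole, nothing but positivity of \<open>u\<close> is
  known there. Two obstacles shape the proof. A cap may be disconnected, so a zero of the difference
  does not by itself give symmetry; the symmetric points are followed across the plane through all
  of \<Omega> without 0 and 2 l e, a connected set since n >= 2. And the boundary is used only
  through tangent balls on both sides and a local monotonicity, without a parametrization. The
  derivative along the boundary is therefore taken at exit points of short normal segments: the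
  gradient has length - \<alpha> at p and at the exit point, and the first order expansion of its
  square leaves 2 \<alpha> times the mixed second derivative. At the corner the first order terms
  and the pure second order terms of u agree for the two mirror directions, so this mixed derivative
  is the only term that could make the difference quadratic.\<close>

definition has_hessian ::
  "('a::euclidean_space \<Rightarrow> real) \<Rightarrow> ('a \<Rightarrow> 'a) \<Rightarrow> ('a \<Rightarrow> 'a) \<Rightarrow> 'a \<Rightarrow> bool" where
  "has_hessian f g H x \<longleftrightarrow>
     (\<forall>\<^sub>F y in nhds x. (f has_derivative (\<lambda>h. g y \<bullet> h)) (at y)) \<and> (g has_derivative H) (at x)"

definition tr :: "('a::euclidean_space \<Rightarrow> 'a) \<Rightarrow> real" where
  "tr H = (\<Sum>b\<in>Basis. H b \<bullet> b)"

text \<open>As a relation at a single point it allows calculus rules for sums, radial functions and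
  reflections to be applied to functions that are singular or irregular elsewhere; continuity of the
  second derivative is not part of it.\<close>

definition has_laplacian :: "('a::euclidean_space \<Rightarrow> real) \<Rightarrow> 'a \<Rightarrow> real \<Rightarrow> bool" where
  "has_laplacian f x L \<longleftrightarrow> (\<exists>g H. has_hessian f g H x \<and> L = tr H)"

lemma has_hessian_derivative:
  assumes "has_hessian f g H x"
  shows "(f has_derivative (\<lambda>h. g x \<bullet> h)) (at x)"
  using assms unfolding has_hessian_def by (auto dest: eventually_nhds_x_imp_x)

lemma has_laplacianI:
  assumes "\<forall>\<^sub>F y in nhds x. (f has_derivative (\<lambda>h. g y \<bullet> h)) (at y)"
    and "(g has_derivative H) (at x)" and "tr H = L"
  shows "has_laplacian f x L"
  using assms unfolding has_laplacian_def has_hessian_def by blast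

lemma has_laplacian_isCont:
  assumes "has_laplacian f x L"
  shows "isCont f x"
  using assms has_hessian_derivative has_derivative_continuous
  unfolding has_laplacian_def by blast

lemma has_laplacian_const: "has_laplacian (\<lambda>x. c) x 0"
  by (rule has_laplacianI[where g = "\<lambda>_. 0" and H = "\<lambda>_. 0"]) (simp_all add: tr_def)

lemma has_laplacian_add:
  assumes "has_laplacian f x L" "has_laplacian g x M"
  shows "has_laplacian (\<lambda>x. f x + g x) x (L + M)"
proof -
  obtain f1 F where f: "has_hessian f f1 F x" "L = tr F"
    using assms unfolding has_laplacian_def by blast
  obtain g1 G where g: "has_hessian g g1 G x" "M = tr G"
    using assms unfolding has_laplacian_def by blast
  have "\<forall>\<^sub>F y in nhds x. ((\<lambda>x. f x + g x) has_derivative (\<lambda>h. (f1 y + g1 y) \<bullet> h)) (at y)"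
    using f(1)[unfolded has_hessian_def, THEN conjunct1] g(1)[unfolded has_hessian_def, THEN conjunct1]
    by eventually_elim (auto intro!: derivative_eq_intros simp: inner_add_left)
  moreover have "((\<lambda>y. f1 y + g1 y) has_derivative (\<lambda>h. F h + G h)) (at x)"
    using f g by (auto simp: has_hessian_def intro!: derivative_eq_intros)
  ultimately show ?thesis
    by (rule has_laplacianI) (simp add: f g tr_def inner_add_left sum.distrib)
qed

lemma has_laplacian_cmult:
  assumes "has_laplacian f x L"
  shows "has_laplacian (\<lambda>x. c * f x) x (c * L)"
proof -
  obtain f1 F where f: "has_hessian f f1 F x" "L = tr F"
    using assms unfolding has_laplacian_def by blast
  have "\<forall>\<^sub>F y in nhds x. ((\<lambda>x. c * f x) has_derivative (\<lambda>h. (c *\<^sub>R f1 y) \<bullet> h)) (at y)"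
    using f(1)[unfolded has_hessian_def, THEN conjunct1]
    by eventually_elim (auto intro!: derivative_eq_intros)
  moreover have "((\<lambda>y. c *\<^sub>R f1 y) has_derivative (\<lambda>h. c *\<^sub>R F h)) (at x)"
    using f by (auto simp: has_hessian_def intro!: derivative_eq_intros)
  ultimately show ?thesis
    by (rule has_laplacianI) (simp add: f tr_def sum_distrib_left)
qed

lemma has_laplacian_diff:
  assumes "has_laplacian f x L" "has_laplacian g x M"
  shows "has_laplacian (\<lambda>x. f x - g x) x (L - M)"
  using has_laplacian_add[OF assms(1) has_laplacian_cmult[OF assms(2), of "-1"]] by simp

lemma sum_Basis_inner_scaleR:
  fixes y :: "'a::euclidean_space"
  assumes "linear H"
  shows "(\<Sum>b\<in>Basis. (b \<bullet> y) *\<^sub>R H b) = H y"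
proof -
  have "H y = H (\<Sum>b\<in>Basis. (y \<bullet> b) *\<^sub>R b)" by (simp add: euclidean_representation)
  also have "\<dots> = (\<Sum>b\<in>Basis. (y \<bullet> b) *\<^sub>R H b)"
    using assms by (simp add: linear_sum linear_cmul)
  finally show ?thesis by (simp add: inner_commute)
qed

section \<open>Laplacians of radial functions\<close>

lemma tr_rank_one: "tr (\<lambda>h. (a \<bullet> h) *\<^sub>R b) = a \<bullet> b"
  unfolding tr_def by (simp add: euclidean_inner[of a b] inner_commute mult.commute)

lemma tr_add: "tr (\<lambda>h. F h + G h) = tr F + tr G"
  by (simp add: tr_def inner_add_left sum.distrib)

lemma tr_scale: "tr (\<lambda>h. c *\<^sub>R F h) = c * tr F"
  by (simp add: tr_def sum_distrib_left)

lemma tr_id: "tr (\<lambda>h::'a::euclidean_space. h) = real DIM('a)"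
  by (simp add: tr_def)

text \<open>In terms of the squared distance s the gradient is 2 \<phi>'(s) (y - c), so the Hessian
  is 4 \<phi>''(s) times the rank one map of x - c plus 2 \<phi>'(s) times the identity.\<close>

lemma has_laplacian_radial:
  fixes x c :: "'a::euclidean_space" and \<phi> \<phi>' :: "real \<Rightarrow> real"
  assumes 1: "\<forall>\<^sub>F t in nhds ((x - c) \<bullet> (x - c)). (\<phi> has_real_derivative \<phi>' t) (at t)"
    and 2: "(\<phi>' has_real_derivative d) (at ((x - c) \<bullet> (x - c)))"
  shows "has_laplacian (\<lambda>y. \<phi> ((y - c) \<bullet> (y - c))) x
     (4 * d * ((x - c) \<bullet> (x - c)) + 2 * real DIM('a) * \<phi>' ((x - c) \<bullet> (x - c)))"
proof -
  let ?s = "\<lambda>y. (y - c) \<bullet> (y - c)"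
  have s: "(?s has_derivative (\<lambda>h. 2 * ((y - c) \<bullet> h))) (at y)" for y
    by (auto intro!: derivative_eq_intros simp: inner_commute)
  have "filterlim ?s (nhds (?s x)) (nhds x)"
    by (intro tendsto_intros filterlim_ident)
  then have "\<forall>\<^sub>F y in nhds x. (\<phi> has_real_derivative \<phi>' (?s y)) (at (?s y))"
    using 1 by (auto simp: filterlim_iff)
  then have "\<forall>\<^sub>F y in nhds x. ((\<lambda>y. \<phi> (?s y)) has_derivative
      (\<lambda>h. ((2 * \<phi>' (?s y)) *\<^sub>R (y - c)) \<bullet> h)) (at y)"
  proof eventually_elim
    case (elim y)
    show ?case
      using has_derivative_compose[OF s elim[unfolded has_field_derivative_def]]
      by (simp add: mult_ac)
  qed
  moreover have "((\<lambda>y. (2 * \<phi>' (?s y)) *\<^sub>R (y - c)) has_derivative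
     (\<lambda>h. (4 * d) *\<^sub>R (((x - c) \<bullet> h) *\<^sub>R (x - c)) + (2 * \<phi>' (?s x)) *\<^sub>R h)) (at x)"
    using has_derivative_compose[OF s 2[unfolded has_field_derivative_def]]
    by (auto intro!: derivative_eq_intros simp: mult_ac)
  ultimately show ?thesis
    by (rule has_laplacianI) (simp add: tr_add tr_scale tr_rank_one tr_id del: scaleR_scaleR)
qed

text \<open>The linear factor is harmonic; pairing its gradient e with the radial gradient adds 4
  \<phi>' (x - c) . e, which turns 2 n into 2 n + 4. The corner barrier has this shape, since it
  must vanish on a plane through its centre.\<close>

lemma has_laplacian_linear_radial:
  fixes x c e :: "'a::euclidean_space" and \<phi> \<phi>' :: "real \<Rightarrow> real"
  assumes 1: "\<forall>\<^sub>F t in nhds ((x - c) \<bullet> (x - c)). (\<phi> has_real_derivative \<phi>' t) (at t)"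
    and 2: "(\<phi>' has_real_derivative d) (at ((x - c) \<bullet> (x - c)))"
  shows "has_laplacian (\<lambda>y. ((y - c) \<bullet> e) * \<phi> ((y - c) \<bullet> (y - c))) x
     (((x - c) \<bullet> e) * (4 * d * ((x - c) \<bullet> (x - c)) + (2 * real DIM('a) + 4) * \<phi>' ((x - c) \<bullet> (x - c))))"
proof -
  let ?s = "\<lambda>y. (y - c) \<bullet> (y - c)"
  have s: "(?s has_derivative (\<lambda>h. 2 * ((y - c) \<bullet> h))) (at y)" for y
    by (auto intro!: derivative_eq_intros simp: inner_commute)
  have "filterlim ?s (nhds (?s x)) (nhds x)"
    by (intro tendsto_intros filterlim_ident)
  then have ev: "\<forall>\<^sub>F y in nhds x. (\<phi> has_real_derivative \<phi>' (?s y)) (at (?s y))"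
    using 1 by (auto simp: filterlim_iff)
  then have "\<forall>\<^sub>F y in nhds x. ((\<lambda>y. ((y - c) \<bullet> e) * \<phi> (?s y)) has_derivative
      (\<lambda>h. (\<phi> (?s y) *\<^sub>R e + (2 * ((y - c) \<bullet> e) * \<phi>' (?s y)) *\<^sub>R (y - c)) \<bullet> h)) (at y)"
  proof eventually_elim
    case (elim y)
    note d = has_derivative_compose[OF s elim[unfolded has_field_derivative_def]]
    show ?case
      by (rule derivative_eq_intros d refl)+
         (simp add: inner_add_left inner_commute[of _ e] mult_ac fun_eq_iff)
  qed
  moreover have "((\<lambda>y. \<phi> (?s y) *\<^sub>R e + (2 * ((y - c) \<bullet> e) * \<phi>' (?s y)) *\<^sub>R (y - c)) has_derivative
     (\<lambda>h. (2 * \<phi>' (?s x)) *\<^sub>R (((x - c) \<bullet> h) *\<^sub>R e) + ((2 * \<phi>' (?s x)) *\<^sub>R ((e \<bullet> h) *\<^sub>R (x - c))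
        + ((4 * d * ((x - c) \<bullet> e)) *\<^sub>R (((x - c) \<bullet> h) *\<^sub>R (x - c))
        + (2 * ((x - c) \<bullet> e) * \<phi>' (?s x)) *\<^sub>R h)))) (at x)"
  proof -
    have e1: "(\<phi> has_derivative (*) (\<phi>' (?s x))) (at (?s x))"
      using ev[THEN eventually_nhds_x_imp_x] by (simp add: has_field_derivative_def)
    note d1 = has_derivative_compose[OF s e1]
    note d2 = has_derivative_compose[OF s 2[unfolded has_field_derivative_def]]
    show ?thesis
      by (rule derivative_eq_intros d1 d2 refl)+
         (simp add: inner_commute[of _ e] scaleR_add_left scaleR_add_right distrib_left distrib_right mult_ac add_ac fun_eq_iff)
  qed
  ultimately show ?thesis
    by (rule has_laplacianI)
       (simp only: tr_add tr_scale tr_rank_one tr_id,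
        simp add: inner_commute[of e] distrib_left distrib_right mult_ac)
qed

lemma has_laplacian_inner: "has_laplacian (\<lambda>y::'a::euclidean_space. y \<bullet> y) x (2 * real DIM('a))"
  using has_laplacian_radial[where c = 0 and \<phi> = "\<lambda>t. t" and \<phi>' = "\<lambda>_. 1" and d = 0 and x = x] by simp

lemma eventually_pos_nhds: "0 < s \<Longrightarrow> \<forall>\<^sub>F t in nhds s. 0 < (t::real)"
  using eventually_nhds by (metis greaterThan_iff open_greaterThan)

text \<open>The coefficient 2 a (2 a - 2 + n) vanishes for a = 1 - n / 2, the fundamental solution
  for n >= 3, and is positive for a = - n, the barrier.\<close>

lemma has_laplacian_radial_powr:
  fixes x c :: "'a::euclidean_space"
  assumes "x \<noteq> c"
  shows "has_laplacian (\<lambda>y. ((y - c) \<bullet> (y - c)) powr a) x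
     (2 * a * (2 * a - 2 + real DIM('a)) * ((x - c) \<bullet> (x - c)) powr (a - 1))"
proof -
  let ?s = "(x - c) \<bullet> (x - c)"
  have s: "0 < ?s" using assms by simp
  have "has_laplacian (\<lambda>y. ((y - c) \<bullet> (y - c)) powr a) x
    (4 * (a * ((a - 1) * ?s powr (a - 1 - 1))) * ?s + 2 * real DIM('a) * (a * ?s powr (a - 1)))"
    using s eventually_pos_nhds[OF s]
    by (intro has_laplacian_radial[where \<phi>' = "\<lambda>t. a * t powr (a - 1)"])
       (auto elim!: eventually_mono intro!: derivative_eq_intros)
  moreover have "?s powr (a - 1) = ?s * ?s powr (a - 1 - 1)"
    using s powr_mult_base[of ?s "a - 1 - 1"] by simp
  ultimately show ?thesis
    by (simp add: left_diff_distrib right_diff_distrib distrib_left distrib_right mult_ac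
        del: inner_eq_zero_iff)
qed

lemma has_laplacian_linear_radial_powr:
  fixes x c e :: "'a::euclidean_space"
  assumes "x \<noteq> c"
  shows "has_laplacian (\<lambda>y. ((y - c) \<bullet> e) * ((y - c) \<bullet> (y - c)) powr a) x
     (((x - c) \<bullet> e) * (2 * a * (2 * a + real DIM('a)) * ((x - c) \<bullet> (x - c)) powr (a - 1)))"
proof -
  let ?s = "(x - c) \<bullet> (x - c)"
  have s: "0 < ?s" using assms by simp
  have "has_laplacian (\<lambda>y. ((y - c) \<bullet> e) * ((y - c) \<bullet> (y - c)) powr a) x
    (((x - c) \<bullet> e) * (4 * (a * ((a - 1) * ?s powr (a - 1 - 1))) * ?s + (2 * real DIM('a) + 4) * (a * ?s powr (a - 1))))"
    using s eventually_pos_nhds[OF s]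
    by (intro has_laplacian_linear_radial[where \<phi>' = "\<lambda>t. a * t powr (a - 1)"])
       (auto elim!: eventually_mono intro!: derivative_eq_intros)
  moreover have "?s powr (a - 1) = ?s * ?s powr (a - 1 - 1)"
    using s powr_mult_base[of ?s "a - 1 - 1"] by simp
  ultimately show ?thesis
    by (simp add: left_diff_distrib right_diff_distrib distrib_left distrib_right mult_ac
        del: inner_eq_zero_iff)
qed

lemma has_laplacian_radial_ln:
  fixes x c :: "'a::euclidean_space"
  assumes "x \<noteq> c"
  shows "has_laplacian (\<lambda>y. ln ((y - c) \<bullet> (y - c))) x
     ((2 * real DIM('a) - 4) / ((x - c) \<bullet> (x - c)))"
proof -
  let ?s = "(x - c) \<bullet> (x - c)"
  have s: "0 < ?s" using assms by simp
  have "has_laplacian (\<lambda>y. ln ((y - c) \<bullet> (y - c))) x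
    (4 * (- (1 / (?s * ?s))) * ?s + 2 * real DIM('a) * (1 / ?s))"
    using s eventually_pos_nhds[OF s]
    by (intro has_laplacian_radial[where \<phi>' = "\<lambda>t. 1 / t"])
       (auto elim!: eventually_mono intro!: derivative_eq_intros simp: divide_simps)
  then show ?thesis
    using s by (simp add: field_simps)
qed

text \<open>The second derivative test on each coordinate line: if \<open>H b \<bullet> b\<close>
  were negative, the slope along b, which is 0 at x, would be negative just to the right of it, and
  f would fall below \<open>f x\<close>.\<close>

lemma tr_nonneg_local_min:
  assumes h: "has_hessian f g H x" and m: "\<forall>\<^sub>F y in nhds x. f x \<le> f y"
  shows "g x = 0" "0 \<le> tr H"
proof -
  from m obtain d where d: "d > 0" "\<And>y. dist y x < d \<Longrightarrow> f x \<le> f y"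
    by (auto simp: eventually_nhds_metric)
  have "(\<lambda>h. g x \<bullet> h) = (\<lambda>h. 0)"
    using differential_zero_maxmin[of x "ball x d" f "\<lambda>h. g x \<bullet> h"] has_hessian_derivative[OF h] d
    by (auto simp: dist_commute)
  then show g0: "g x = 0" by (metis inner_eq_zero_iff)
  have "0 \<le> H b \<bullet> b" if b: "b \<in> Basis" for b
  proof (rule ccontr)
    assume neg: "\<not> 0 \<le> H b \<bullet> b"
    from h obtain d' where d': "d' > 0"
        "\<And>y. dist y x < d' \<Longrightarrow> (f has_derivative (\<lambda>h. g y \<bullet> h)) (at y)"
      by (auto simp: has_hessian_def eventually_nhds_metric)
    have line: "((\<lambda>t. x + t *\<^sub>R b) has_derivative (\<lambda>t. t *\<^sub>R b)) (at t)" for t :: real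
      by (auto intro!: derivative_eq_intros)
    have gH: "(g has_derivative H) (at (x + 0 *\<^sub>R b))"
      using h by (simp add: has_hessian_def)
    have H: "linear H" using h by (auto simp: has_hessian_def dest: has_derivative_linear)
    have "((\<lambda>t. g (x + t *\<^sub>R b) \<bullet> b) has_derivative (\<lambda>t. H (t *\<^sub>R b) \<bullet> b)) (at 0)"
      using has_derivative_compose[OF line gH] by (auto intro!: derivative_eq_intros)
    then have "((\<lambda>t. g (x + t *\<^sub>R b) \<bullet> b) has_real_derivative (H b \<bullet> b)) (at 0)"
      unfolding has_field_derivative_def by (rule has_derivative_eq_rhs)
        (simp add: fun_eq_iff H linear_cmul)
    from DERIV_neg_dec_right[OF this] neg obtain r where
      r: "r > 0" "\<And>s. 0 < s \<Longrightarrow> s < r \<Longrightarrow> g (x + s *\<^sub>R b) \<bullet> b < 0"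
      using g0 by auto
    define s where "s = min r (min d d') / 2"
    have s: "0 < s" "s < r" "s < d" "s < d'" using r(1) d(1) d'(1) by (auto simp: s_def min_def)
    have D: "((\<lambda>t. f (x + t *\<^sub>R b)) has_real_derivative (g (x + t *\<^sub>R b) \<bullet> b)) (at t)"
      if "0 \<le> t" "t \<le> s" for t
    proof -
      have "dist (x + t *\<^sub>R b) x < d'" using that s b by (simp add: dist_norm)
      then show ?thesis
        unfolding has_field_derivative_def
        by (intro has_derivative_eq_rhs[OF has_derivative_compose[OF line d'(2)]]) (simp_all add: fun_eq_iff)
    qed
    obtain z where z: "0 < z" "z < s" "f (x + s *\<^sub>R b) - f (x + 0 *\<^sub>R b) = (s - 0) * (g (x + z *\<^sub>R b) \<bullet> b)"
      using MVT2[OF s(1) D] by auto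
    have "g (x + z *\<^sub>R b) \<bullet> b < 0" using r(2)[of z] z s by simp
    then have "s * (g (x + z *\<^sub>R b) \<bullet> b) < 0" using s(1) by (simp add: mult_pos_neg)
    then have "f (x + s *\<^sub>R b) < f x" using z(3) by simp
    moreover have "f x \<le> f (x + s *\<^sub>R b)" using d(2) s b by (simp add: dist_norm)
    ultimately show False by simp
  qed
  then show "0 \<le> tr H" by (auto simp: tr_def intro: sum_nonneg)
qed

text \<open>The boundary condition is a lower limit at each frontier point, so f need not extend
  continuously. A small multiple of the squared norm makes f strictly superharmonic, and a negative
  value would then force an interior minimum with negative Hessian trace.\<close>

lemma weak_minimum_principle:
  fixes f :: "'a::euclidean_space \<Rightarrow> real"
  assumes S: "open S" "bounded S"
    and sup: "\<And>x. x \<in> S \<Longrightarrow> \<exists>L\<le>0. has_laplacian f x L"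
    and bdry: "\<And>p \<epsilon>. p \<in> frontier S \<Longrightarrow> \<epsilon> > 0 \<Longrightarrow> \<forall>\<^sub>F x in at p within S. - \<epsilon> < f x"
    and x: "x \<in> S"
  shows "0 \<le> f x"
proof (rule ccontr)
  assume neg: "\<not> 0 \<le> f x"
  obtain M where M: "\<And>y. y \<in> S \<Longrightarrow> norm y \<le> M" using S(2) by (auto simp: bounded_iff)
  have yy: "y \<bullet> y \<le> M\<^sup>2" if "y \<in> S" for y
    using M[OF that] by (metis norm_ge_zero power2_norm_eq_inner power_mono)
  \<comment> \<open>The perturbation is at most \<open>\<epsilon> * M\<^sup>2\<close>, which uses up
    no more than half of the negative value at x; the added 1 covers M = 0.\<close>
  define \<epsilon> where "\<epsilon> = - f x / (2 * (M\<^sup>2 + 1))"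
  have M1: "0 < M\<^sup>2 + 1" by (simp add: add_nonneg_pos)
  have \<epsilon>: "\<epsilon> > 0" using neg M1 by (simp add: \<epsilon>_def divide_neg_pos)
  have \<epsilon>M: "\<epsilon> * M\<^sup>2 \<le> - f x / 2"
  proof -
    have "\<epsilon> * M\<^sup>2 \<le> \<epsilon> * (M\<^sup>2 + 1)" using \<epsilon> by simp
    also have "\<dots> = - f x / 2" using M1 by (simp add: \<epsilon>_def field_simps)
    finally show ?thesis .
  qed
  define h where "h = (\<lambda>y. f y + (\<epsilon> * M\<^sup>2 + (- \<epsilon>) * (y \<bullet> y)))"
  have hge: "f y \<le> h y" if "y \<in> S" for y
    using mult_left_mono[OF yy[OF that], of \<epsilon>] \<epsilon> by (simp add: h_def)
  have hx: "h x < 0"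
  proof -
    have "h x \<le> f x + \<epsilon> * M\<^sup>2" using \<epsilon> by (simp add: h_def)
    then show ?thesis using \<epsilon>M neg by simp
  qed
  have lap: "\<exists>L<0. has_laplacian h y L" if y: "y \<in> S" for y
  proof -
    obtain L where L: "L \<le> 0" "has_laplacian f y L" using sup[OF y] by blast
    have "has_laplacian h y (L + (0 + (- \<epsilon>) * (2 * real DIM('a))))"
      unfolding h_def by (intro has_laplacian_add has_laplacian_const has_laplacian_cmult has_laplacian_inner L)
    moreover have "L + (0 + (- \<epsilon>) * (2 * real DIM('a))) < 0"
      using L(1) mult_pos_pos[OF \<epsilon>, of "2 * real DIM('a)"] by simp
    ultimately show ?thesis by blast
  qed
  then have cont: "isCont h y" if "y \<in> S" for y
    using that has_laplacian_isCont by blast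
  \<comment> \<open>A sublevel set at a negative level cannot accumulate at the frontier, so it is
    compact although S is open.\<close>
  define C where "C = {y \<in> S. h y \<le> h x}"
  have "closed C"
    unfolding closed_sequential_limits
  proof (intro allI impI, elim conjE)
    fix a p assume a: "\<forall>n. a n \<in> C" "a \<longlonglongrightarrow> p"
    have aS: "a n \<in> S" "h (a n) \<le> h x" for n using a(1) by (auto simp: C_def)
    have "p \<in> closure S" using aS(1) a(2) closure_sequential by blast
    have "p \<in> S"
    proof (rule ccontr)
      assume "p \<notin> S"
      then have fr: "p \<in> frontier S" using \<open>p \<in> closure S\<close> S(1) by (simp add: frontier_def interior_open)
      have "\<forall>\<^sub>F y in at p within S. h x < f y" using bdry[OF fr, of "- h x"] hx by simp
      moreover have "filterlim a (at p within S) sequentially"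
        using a(2) aS(1) \<open>p \<notin> S\<close> by (auto simp: filterlim_at intro!: always_eventually)
      ultimately have "\<forall>\<^sub>F n in sequentially. h x < f (a n)"
        by (auto simp: filterlim_iff)
      then obtain n where "h x < f (a n)" by (auto simp: eventually_sequentially)
      then show False using aS[of n] hge[of "a n"] by simp
    qed
    moreover have "h p \<le> h x"
    proof (rule LIMSEQ_le_const2)
      show "(\<lambda>n. h (a n)) \<longlonglongrightarrow> h p" using cont[OF \<open>p \<in> S\<close>] a(2) by (rule isCont_tendsto_compose)
    qed (use aS in auto)
    ultimately show "p \<in> C" by (simp add: C_def)
  qed
  moreover have "bounded C" using S(2) by (rule bounded_subset) (auto simp: C_def)
  ultimately have "compact C" by (simp add: compact_eq_bounded_closed)
  moreover have "x \<in> C" using x by (simp add: C_def)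
  moreover have "continuous_on C h" using cont by (auto simp: C_def intro: continuous_at_imp_continuous_on)
  ultimately obtain z where z: "z \<in> C" "\<And>y. y \<in> C \<Longrightarrow> h z \<le> h y"
    using continuous_attains_inf[of C h] by blast
  have zS: "z \<in> S" "h z \<le> h x" using z(1) by (auto simp: C_def)
  have "h z \<le> h y" if "y \<in> S" for y
    using z(2)[of y] that zS by (cases "h y \<le> h x") (auto simp: C_def)
  then have "\<forall>\<^sub>F y in nhds z. h z \<le> h y"
    using S(1) zS(1) by (auto simp: eventually_nhds)
  moreover obtain L where "L < 0" "has_laplacian h z L" using lap[OF zS(1)] by blast
  ultimately show False
    unfolding has_laplacian_def using tr_nonneg_local_min(2) by fastforce
qed

section \<open>Hopf lemma, strong minimum principle and corner lemma\<close>

text \<open>The exponent \<open>- n\<close> of \<open>|x - y|\<^sup>2\<close> makes the barrier subharmonic in every dimension, even after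
  multiplication by the linear factor needed at the corner.\<close>

definition barrier :: "real \<Rightarrow> 'a::euclidean_space \<Rightarrow> 'a \<Rightarrow> real" where
  "barrier r y x = ((x - y) \<bullet> (x - y)) powr (- real DIM('a)) - (r\<^sup>2) powr (- real DIM('a))"

lemma barrier_eq: "barrier r y x = ((norm (x - y))\<^sup>2) powr (- real DIM('a)) - (r\<^sup>2) powr (- real DIM('a))"
  for x y :: "'a::euclidean_space"
  by (simp add: barrier_def power2_norm_eq_inner)

lemma barrier_laplacian:
  fixes x y :: "'a::euclidean_space"
  assumes "x \<noteq> y"
  shows "\<exists>L\<ge>0. has_laplacian (barrier r y) x L"
proof -
  let ?a = "- real DIM('a)"
  have "has_laplacian (\<lambda>z. ((z - y) \<bullet> (z - y)) powr ?a - (r\<^sup>2) powr ?a) x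
     (2 * ?a * (2 * ?a - 2 + DIM('a)) * ((x - y) \<bullet> (x - y)) powr (?a - 1) - 0)"
    by (intro has_laplacian_diff has_laplacian_radial_powr has_laplacian_const assms)
  moreover have "0 \<le> 2 * ?a * (2 * ?a - 2 + DIM('a)) * ((x - y) \<bullet> (x - y)) powr (?a - 1) - 0"
    unfolding diff_zero by (intro mult_nonneg_nonneg mult_nonpos_nonpos) auto
  ultimately show ?thesis
    unfolding barrier_def by (intro exI conjI)
qed

text \<open>For a = - n the coefficient 2 a (2 a + n) is 2 n^2, so the product is subharmonic on the
  side where the linear factor is nonnegative; the constant in the barrier contributes only a
  harmonic linear term.\<close>

lemma barrier_laplacian_linear:
  fixes x y :: "'a::euclidean_space"
  assumes "x \<noteq> y" "0 \<le> (x - y) \<bullet> e"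
  shows "\<exists>L\<ge>0. has_laplacian (\<lambda>x. ((x - y) \<bullet> e) * barrier r y x) x L"
proof -
  let ?a = "- real DIM('a)"
  have 0: "has_laplacian (\<lambda>z. ((z - y) \<bullet> e) * 1) x (((x - y) \<bullet> e) * (4 * 0 * ((x - y) \<bullet> (x - y)) + (2 * real DIM('a) + 4) * 0))"
    by (rule has_laplacian_linear_radial[where \<phi> = "\<lambda>_. 1" and \<phi>' = "\<lambda>_. 0"]) auto
  have "has_laplacian (\<lambda>z. ((z - y) \<bullet> e) * ((z - y) \<bullet> (z - y)) powr ?a - (r\<^sup>2) powr ?a * ((z - y) \<bullet> e)) x
     (((x - y) \<bullet> e) * (2 * ?a * (2 * ?a + DIM('a)) * ((x - y) \<bullet> (x - y)) powr (?a - 1)) - (r\<^sup>2) powr ?a * 0)"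
    using 0 by (intro has_laplacian_diff has_laplacian_linear_radial_powr has_laplacian_cmult assms) simp
  moreover have "0 \<le> ((x - y) \<bullet> e) * (2 * ?a * (2 * ?a + DIM('a)) * ((x - y) \<bullet> (x - y)) powr (?a - 1))"
    using assms by (intro mult_nonneg_nonneg mult_nonpos_nonpos) auto
  moreover have "(\<lambda>z. ((z - y) \<bullet> e) * ((z - y) \<bullet> (z - y)) powr ?a - (r\<^sup>2) powr ?a * ((z - y) \<bullet> e))
     = (\<lambda>x. ((x - y) \<bullet> e) * barrier r y x)"
    by (simp add: barrier_def fun_eq_iff right_diff_distrib mult.commute)
  ultimately show ?thesis by (intro exI conjI) auto
qed

lemma barrier_zero: "norm (x - y) = r \<Longrightarrow> barrier r y x = 0"
  by (simp add: barrier_eq)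

lemma barrier_isCont: "x \<noteq> y \<Longrightarrow> isCont (barrier r y) x"
  using barrier_laplacian has_laplacian_isCont by blast

text \<open>The value of the barrier on the sphere of radius r / 2, which is its largest value on
  the shell between r / 2 and r; the type argument supplies the dimension.\<close>

definition barrier_max :: "'a::euclidean_space itself \<Rightarrow> real \<Rightarrow> real" where
  "barrier_max _ r = ((r / 2)\<^sup>2) powr (- real DIM('a)) - (r\<^sup>2) powr (- real DIM('a))"

lemma barrier_eq_max:
  "norm (x - y) = r / 2 \<Longrightarrow> barrier r y x = barrier_max TYPE('a) r" for x y :: "'a::euclidean_space"
  by (simp only: barrier_eq barrier_max_def)

lemma barrier_max_pos: "0 < r \<Longrightarrow> 0 < barrier_max TYPE('a::euclidean_space) r"
  unfolding barrier_max_def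
  by (simp, intro powr_less_mono2_neg) (auto simp: power2_eq_square intro!: mult_strict_mono)

lemma barrier_lower_bound:
  fixes y :: "'a::euclidean_space"
  assumes r: "0 < r"
  shows "\<exists>k>0. \<forall>x\<in>ball y r - {y}. k * (r - norm (x - y)) \<le> barrier r y x"
proof (intro exI conjI ballI)
  let ?n = "real DIM('a)"
  \<comment> \<open>Minus the derivative of t^(- 2 n) at t = r, the least steep slope on (0,
    r].\<close>
  define k where "k = 2 * ?n * r powr (- 2 * ?n - 1)"
  show "0 < k" using r by (simp add: k_def)
  fix x assume x: "x \<in> ball y r - {y}"
  define s where "s = norm (x - y)"
  have s: "0 < s" "s < r" using x by (auto simp: s_def dist_norm norm_minus_commute)
  have sq: "(t\<^sup>2) powr (- ?n) = t powr (- 2 * ?n)" if "0 < t" for t :: real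
    using that by (simp add: powr_powr flip: powr_numeral)
  have "\<exists>z>s. z < r \<and>
      r powr (- 2 * ?n) - s powr (- 2 * ?n) = (r - s) * ((- 2 * ?n) * z powr (- 2 * ?n - 1))"
    using s by (intro MVT2 has_real_derivative_powr) auto
  then obtain z where z: "s < z" "z < r"
      "r powr (- 2 * ?n) - s powr (- 2 * ?n) = (r - s) * ((- 2 * ?n) * z powr (- 2 * ?n - 1))"
    by blast
  have "r powr (- 2 * ?n - 1) \<le> z powr (- 2 * ?n - 1)"
    using z s by (intro powr_mono2') auto
  then have "k * (r - s) \<le> (r - s) * (2 * ?n * z powr (- 2 * ?n - 1))"
    using s by (simp add: k_def mult.commute mult_left_mono)
  also have "\<dots> = s powr (- 2 * ?n) - r powr (- 2 * ?n)" using z(3) by simp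
  also have "\<dots> = barrier r y x" using sq[of s] sq[of r] s r by (simp add: barrier_eq s_def)
  finally show "k * (r - norm (x - y)) \<le> barrier r y x" by (simp add: s_def)
qed

lemma barrier_lower_bound_uniform:
  assumes r: "0 < r"
  shows "\<exists>k>0. \<forall>y. \<forall>x\<in>ball y r - {y::'a::euclidean_space}. k * (r - norm (x - y)) \<le> barrier r y x"
proof -
  obtain k where k: "k > 0" "\<forall>x\<in>ball (0::'a) r - {0}. k * (r - norm (x - 0)) \<le> barrier r 0 x"
    using barrier_lower_bound[OF r] by blast
  have "k * (r - norm (x - y)) \<le> barrier r y x" if "x \<in> ball y r - {y}" for x y :: 'a
    using k(2)[rule_format, of "x - y"] that
    by (auto simp: barrier_def dist_norm norm_minus_commute)
  then show ?thesis using k(1) by blast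
qed

section \<open>Hopf lemma and strong minimum principle\<close>

lemma eventually_within_gt:
  assumes "isCont f p" "(c::real) < f p"
  shows "\<forall>\<^sub>F x in at p within S. c < f x"
proof -
  have "(f \<longlongrightarrow> f p) (at p within S)"
    using assms(1) by (auto simp: isCont_def intro: tendsto_within_subset)
  then show ?thesis using assms(2) by (rule order_tendstoD)
qed

text \<open>The order of quantifiers matters: k depends only on r and the dimension, so the corner
  lemma can use it for a whole family of balls. In the half ball the bound by \<delta> is enough; on
  the shell w is compared with the barrier scaled to equal \<delta> on the inner sphere.\<close>

lemma hopf_ball:
  assumes r: "0 < r"
  shows "\<exists>k>0. \<forall>w (y::'a::euclidean_space) \<delta>. 0 < \<delta> \<longrightarrow>
    (\<forall>x\<in>ball y r. \<exists>L\<le>0. has_laplacian w x L) \<longrightarrow> (\<forall>x\<in>ball y r. 0 \<le> w x) \<longrightarrow>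
    (\<forall>x\<in>cball y (r/2). \<delta> \<le> w x) \<longrightarrow> (\<forall>x\<in>ball y r. \<delta> * k * (r - norm (x - y)) \<le> w x)"
proof -
  obtain k0 where k0: "k0 > 0" "\<And>x y::'a. x \<in> ball y r - {y} \<Longrightarrow> k0 * (r - norm (x - y)) \<le> barrier r y x"
    using barrier_lower_bound_uniform[OF r, where 'a = 'a] by blast
  let ?B = "barrier_max TYPE('a) r"
  have B: "?B > 0" using r by (rule barrier_max_pos)
  \<comment> \<open>The first entry serves the half ball, where
    \<open>r - norm (x - y) \<le> r\<close>, the second one the shell.\<close>
  define k where "k = min (1 / r) (k0 / ?B)"
  have "\<delta> * k * (r - norm (x - y)) \<le> w x"
    if \<delta>: "0 < \<delta>" and sup: "\<forall>x\<in>ball y r. \<exists>L\<le>0. has_laplacian w x L"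
      and w0: "\<forall>x\<in>ball y r. 0 \<le> w x" and w1: "\<forall>x\<in>cball y (r/2). \<delta> \<le> w x" and x: "x \<in> ball y r"
    for w \<delta> and x y :: 'a
  proof (cases "x \<in> cball y (r/2)")
    case True
    have "k * (r - norm (x - y)) \<le> (1 / r) * r"
      using x r k0 B by (intro mult_mono) (auto simp: k_def dist_norm norm_minus_commute)
    then have "\<delta> * (k * (r - norm (x - y))) \<le> \<delta> * 1" using \<delta> r by (intro mult_left_mono) auto
    moreover have "\<delta> \<le> w x" using w1 True by blast
    ultimately show ?thesis by (simp add: mult.assoc)
  next
    case False
    define S where "S = ball y r - cball y (r/2)"
    define f where "f = (\<lambda>x. w x - (\<delta> / ?B) * barrier r y x)"
    have cw: "isCont w p" if "p \<in> ball y r" for p using that sup has_laplacian_isCont by blast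
    have cf: "isCont f p" if "p \<in> ball y r" "p \<noteq> y" for p
      unfolding f_def using that by (intro continuous_intros cw barrier_isCont)
    have "0 \<le> f x"
    proof (rule weak_minimum_principle[where S = S])
      show "open S" "bounded S" by (auto simp: S_def intro: bounded_subset[OF bounded_ball])
      show "x \<in> S" using x False by (simp add: S_def)
      show "\<exists>L\<le>0. has_laplacian f z L" if z: "z \<in> S" for z
      proof -
        have "z \<noteq> y" using z r by (auto simp: S_def)
        then obtain M where M: "M \<ge> 0" "has_laplacian (barrier r y) z M" using barrier_laplacian by blast
        obtain L where L: "L \<le> 0" "has_laplacian w z L" using sup z unfolding S_def by blast
        have "has_laplacian f z (L - (\<delta> / ?B) * M)"
          unfolding f_def by (intro has_laplacian_diff has_laplacian_cmult L M)
        moreover have "L - (\<delta> / ?B) * M \<le> 0"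
          using L M \<delta> B by (smt (verit) divide_nonneg_pos mult_nonneg_nonneg)
        ultimately show ?thesis by blast
      qed
      show "\<forall>\<^sub>F z in at p within S. - \<epsilon> < f z" if p: "p \<in> frontier S" and \<epsilon>: "\<epsilon> > 0" for p \<epsilon>
      proof -
        have "closure S \<subseteq> cball y r - ball y (r/2)"
        proof (rule closure_minimal)
          show "closed (cball y r - ball y (r/2))" by (intro closed_Diff) auto
        qed (auto simp: S_def)
        moreover have "open S" by (auto simp: S_def)
        then have "p \<in> closure S" "p \<notin> S" using p by (auto simp: frontier_def interior_open)
        ultimately have "norm (p - y) = r \<or> norm (p - y) = r / 2"
          by (auto simp: S_def dist_norm norm_minus_commute)
        then show ?thesis
        proof
          \<comment> \<open>On the outer sphere nothing is assumed about w; the lower limit comes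
            from w >= 0 inside and the vanishing of the barrier.\<close>
          assume n: "norm (p - y) = r"
          then have "p \<noteq> y" using r by auto
          then have "isCont (\<lambda>z. - (\<delta> / ?B) * barrier r y z) p" by (intro continuous_intros barrier_isCont)
          then have "\<forall>\<^sub>F z in at p within S. - \<epsilon> < - (\<delta> / ?B) * barrier r y z"
            by (rule eventually_within_gt) (use n \<epsilon> in \<open>simp add: barrier_zero\<close>)
          moreover have "\<forall>\<^sub>F z in at p within S. z \<in> S" by (simp add: eventually_at_filter)
          ultimately show ?thesis
            by eventually_elim (use w0 in \<open>force simp: f_def S_def\<close>)
        next
          assume n: "norm (p - y) = r / 2"
          then have "p \<noteq> y" "p \<in> ball y r" using r by (auto simp: dist_norm norm_minus_commute)
          moreover have "0 \<le> f p"
            using w1 n B by (auto simp: f_def barrier_eq_max dist_norm norm_minus_commute)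
          ultimately show ?thesis using cf \<epsilon> by (intro eventually_within_gt) auto
        qed
      qed
    qed
    then have "(\<delta> / ?B) * barrier r y x \<le> w x" by (simp add: f_def)
    moreover have "\<delta> * k * (r - norm (x - y)) \<le> (\<delta> / ?B) * barrier r y x"
    proof -
      have xy: "x \<noteq> y" "norm (x - y) < r" using x False r by (auto simp: dist_norm norm_minus_commute)
      have "k * (r - norm (x - y)) \<le> (k0 / ?B) * (r - norm (x - y))"
        using xy by (intro mult_right_mono) (auto simp: k_def)
      also have "\<dots> \<le> barrier r y x / ?B"
        using k0(2)[of x y] x xy B by (simp add: divide_right_mono)
      finally have "\<delta> * (k * (r - norm (x - y))) \<le> \<delta> * (barrier r y x / ?B)"
        using \<delta> by (intro mult_left_mono) auto
      then show ?thesis by (simp add: mult.assoc)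
    qed
    ultimately show ?thesis by simp
  qed
  moreover have "0 < k" using r k0 B by (simp add: k_def)
  ultimately show ?thesis by blast
qed

lemma positive_lower_bound:
  fixes w :: "'a::topological_space \<Rightarrow> real"
  assumes "compact K" "continuous_on K w" "\<And>x. x \<in> K \<Longrightarrow> 0 < w x"
  shows "\<exists>\<delta>>0. \<forall>x\<in>K. \<delta> \<le> w x"
proof (cases "K = {}")
  case False
  then obtain z where "z \<in> K" "\<forall>x\<in>K. w z \<le> w x"
    using continuous_attains_inf[OF assms(1) False assms(2)] by blast
  then show ?thesis using assms(3) by blast
qed (auto intro: exI[of _ 1])

text \<open>Linear growth away from the bounding sphere instead of a sign of the normal derivative,
  so that w need not be differentiable on the sphere.\<close>

lemma hopf_lemma:
  fixes w :: "'a::euclidean_space \<Rightarrow> real"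
  assumes r: "0 < r"
    and sup: "\<And>x. x \<in> ball y r \<Longrightarrow> \<exists>L\<le>0. has_laplacian w x L"
    and pos: "\<And>x. x \<in> ball y r \<Longrightarrow> 0 < w x"
  shows "\<exists>k>0. \<forall>x\<in>ball y r. k * (r - norm (x - y)) \<le> w x"
proof -
  have "continuous_on (cball y (r/2)) w"
    using sup has_laplacian_isCont r by (intro continuous_at_imp_continuous_on ballI) force
  then obtain \<delta> where \<delta>: "\<delta> > 0" "\<forall>x\<in>cball y (r/2). \<delta> \<le> w x"
    using positive_lower_bound[of "cball y (r/2)" w] pos r by fastforce
  obtain k where k: "k > 0" "\<And>w (y::'a) \<delta>. 0 < \<delta> \<Longrightarrow>
    (\<forall>x\<in>ball y r. \<exists>L\<le>0. has_laplacian w x L) \<Longrightarrow> (\<forall>x\<in>ball y r. 0 \<le> w x) \<Longrightarrow>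
    (\<forall>x\<in>cball y (r/2). \<delta> \<le> w x) \<Longrightarrow> (\<forall>x\<in>ball y r. \<delta> * k * (r - norm (x - y)) \<le> w x)"
    using hopf_ball[OF r, where 'a = 'a] by metis
  have "\<forall>x\<in>ball y r. \<delta> * k * (r - norm (x - y)) \<le> w x"
    using k(2)[OF \<delta>(1), of y w] sup pos \<delta>(2) by (simp add: less_imp_le)
  then show ?thesis using \<delta> k by (intro exI[of _ "\<delta> * k"]) simp
qed

text \<open>If the zero set were not open, a ball free of zeros would touch it at a point q of S.
  There w has a minimum, hence zero gradient, while \<open>hopf_lemma\<close> forces a positive
  slope towards the centre of the ball.\<close>

lemma strong_minimum_principle:
  fixes w :: "'a::euclidean_space \<Rightarrow> real"
  assumes S: "open S" "connected S"
    and sup: "\<And>x. x \<in> S \<Longrightarrow> \<exists>L\<le>0. has_laplacian w x L"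
    and nonneg: "\<And>x. x \<in> S \<Longrightarrow> 0 \<le> w x"
    and z: "z \<in> S" "w z = 0"
    and x: "x \<in> S"
  shows "w x = 0"
proof -
  define Z where "Z = {x \<in> S. w x = 0}"
  have cont: "isCont w p" if "p \<in> S" for p using that sup has_laplacian_isCont by blast
  have "continuous_on S w" using cont by (auto intro: continuous_at_imp_continuous_on)
  then have "closedin (top_of_set S) Z"
    unfolding Z_def by (rule continuous_closedin_preimage_constant)
  moreover have "open Z"
    unfolding open_contains_ball
  proof
    fix z assume "z \<in> Z"
    then have zS: "z \<in> S" "w z = 0" by (auto simp: Z_def)
    obtain \<rho> where \<rho>: "\<rho> > 0" "cball z \<rho> \<subseteq> S" using S(1) zS(1) open_contains_cball by blast
    have "ball z (\<rho>/2) \<subseteq> Z"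
    proof (rule ccontr)
      assume "\<not> ball z (\<rho>/2) \<subseteq> Z"
      then obtain y where y: "y \<in> ball z (\<rho>/2)" "y \<notin> Z" by blast
      \<comment> \<open>Since y is within \<rho> / 2 of the zero z, its nearest zero is at distance
        less than \<rho> / 2, and the touching ball around y stays in
        \<open>cball z \<rho>\<close>.\<close>
      define C where "C = Z \<inter> cball z \<rho>"
      have "C = cball z \<rho> \<inter> w -` {0}" using \<rho> by (auto simp: C_def Z_def)
      moreover have "closed (cball z \<rho> \<inter> w -` {0})"
        using cont \<rho>(2) by (intro continuous_closed_preimage continuous_at_imp_continuous_on) auto
      ultimately have "closed C" by simp
      have "z \<in> C" using \<open>z \<in> Z\<close> \<rho> by (simp add: C_def)
      then obtain q where q: "q \<in> C" "\<And>p. p \<in> C \<Longrightarrow> dist y q \<le> dist y p"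
        using distance_attains_inf[OF \<open>closed C\<close>, of y] by blast
      define d where "d = dist y q"
      have "d \<le> dist y z" using q(2) \<open>z \<in> C\<close> by (simp add: d_def)
      then have d\<rho>: "d < \<rho>/2" using y(1) by (simp add: dist_commute)
      have "d \<noteq> 0" using q(1) y(2) by (auto simp: d_def C_def)
      then have d: "d > 0" by (simp add: d_def)
      have bz: "ball y d \<subseteq> cball z \<rho>"
      proof
        fix p assume "p \<in> ball y d"
        then show "p \<in> cball z \<rho>"
          using y(1) d\<rho> dist_triangle[of z p y] by simp
      qed
      have pos: "0 < w p" if p: "p \<in> ball y d" for p
      proof -
        have "p \<notin> C" using q(2)[of p] p by (auto simp: d_def)
        then have "w p \<noteq> 0" "p \<in> S" using p bz \<rho>(2) by (auto simp: C_def Z_def)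
        then show ?thesis using nonneg by force
      qed
      have "\<exists>k>0. \<forall>x\<in>ball y d. k * (d - norm (x - y)) \<le> w x"
        using bz \<rho>(2) by (intro hopf_lemma d sup pos) auto
      then obtain k where k: "k > 0" "\<And>x. x \<in> ball y d \<Longrightarrow> k * (d - norm (x - y)) \<le> w x" by blast
      have qS: "q \<in> S" "w q = 0" using q(1) by (auto simp: C_def Z_def)
      obtain g H where gH: "has_hessian w g H q" using sup[OF qS(1)] unfolding has_laplacian_def by blast
      have "\<forall>\<^sub>F p in nhds q. w q \<le> w p"
        using S(1) qS nonneg by (auto simp: eventually_nhds)
      then have "g q = 0" using tr_nonneg_local_min(1)[OF gH] by blast
      then have D: "(w has_derivative (\<lambda>h. 0)) (at q)" using has_hessian_derivative[OF gH] by simp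
      have "((\<lambda>t. q + t *\<^sub>R (y - q)) has_derivative (\<lambda>t. t *\<^sub>R (y - q))) (at 0)"
        by (auto intro!: derivative_eq_intros)
      from has_derivative_compose[OF this, of w "\<lambda>h. 0"] D
      have "((\<lambda>t. w (q + t *\<^sub>R (y - q))) has_real_derivative 0) (at 0)"
        unfolding has_field_derivative_def by (simp cong: if_cong) (simp add: fun_eq_iff mult_zero_left[abs_def])
      then have "((\<lambda>t. (w (q + t *\<^sub>R (y - q)) - w q) / t) \<longlongrightarrow> 0) (at 0)"
        by (simp add: has_field_derivative_iff)
      then have "((\<lambda>t. (w (q + t *\<^sub>R (y - q)) - w q) / t) \<longlongrightarrow> 0) (at_right 0)"
        by (simp add: filterlim_at_split)
      moreover have "\<forall>\<^sub>F t in at_right 0. k * d \<le> (w (q + t *\<^sub>R (y - q)) - w q) / t"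
        unfolding eventually_at_right_field
      proof (intro exI[of _ 1] conjI allI impI)
        fix t :: real assume t: "0 < t" "t < 1"
        have "q + t *\<^sub>R (y - q) - y = (t - 1) *\<^sub>R (y - q)" by (simp add: algebra_simps)
        then have n: "norm (q + t *\<^sub>R (y - q) - y) = (1 - t) * d" using t by (simp add: d_def dist_norm)
        then have "q + t *\<^sub>R (y - q) \<in> ball y d" using t d by (simp add: dist_norm norm_minus_commute)
        moreover have "d - (1 - t) * d = d * t" by (simp add: algebra_simps)
        ultimately have "k * (d * t) \<le> w (q + t *\<^sub>R (y - q))"
          using k(2)[of "q + t *\<^sub>R (y - q)"] by (simp only: n)
        then show "k * d \<le> (w (q + t *\<^sub>R (y - q)) - w q) / t" using t qS by (simp add: field_simps)
      qed simp
      ultimately have "k * d \<le> 0" by (rule tendsto_lowerbound) simp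
      then show False using k(1) d by (simp add: mult_le_0_iff)
    qed
    then show "\<exists>e>0. ball z e \<subseteq> Z" using \<rho>(1) by (intro exI[of _ "\<rho>/2"]) simp
  qed
  then have "openin (top_of_set S) Z" by (auto simp: Z_def openin_open)
  ultimately have "Z = {} \<or> Z = S" using S(2) by (auto simp: connected_clopen)
  then show ?thesis using z x by (auto simp: Z_def)
qed

text \<open>Multiplying the barrier by the distance to the flat face gives a comparison function
  that vanishes on the face and on the sphere, hence a quadratic bound where they meet. The barrier
  is singular at c, so the comparison runs on the outer shell; the inner half ball only supplies the
  values on the inner sphere.\<close>

lemma corner_lemma:
  fixes c e :: "'a::euclidean_space"
  assumes R: "0 < R" and e: "norm e = 1"
    and sup: "\<And>x. x \<in> ball c R \<Longrightarrow> 0 < (x - c) \<bullet> e \<Longrightarrow> \<exists>L\<le>0. has_laplacian w x L"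
    and pos: "\<And>x. x \<in> ball c R \<Longrightarrow> 0 < (x - c) \<bullet> e \<Longrightarrow> 0 < w x"
  shows "\<exists>k>0. \<forall>x\<in>ball c R. norm (x - c) > R / 2 \<longrightarrow> 0 < (x - c) \<bullet> e \<longrightarrow>
     k * ((x - c) \<bullet> e) * (R - norm (x - c)) \<le> w x"
proof -
  have ee: "e \<bullet> e = 1" using e by (simp add: norm_eq_1)
  have cw: "isCont w x" if "x \<in> ball c R" "0 < (x - c) \<bullet> e" for x
    using sup[OF that] has_laplacian_isCont by blast
  \<comment> \<open>The margins fit the balls of radius R / 8 used below: their centres have height
    R / 8 and distance at most 5 R / 8 from c, so the concentric balls of half the radius lie in K
    and the full balls in the half ball.\<close>
  define K where "K = cball c (3 * R / 4) \<inter> {x. R / 16 \<le> (x - c) \<bullet> e}"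
  have "compact K" unfolding K_def
    by (intro compact_Int_closed compact_cball closed_Collect_le continuous_intros)
  moreover have Kin: "x \<in> ball c R \<and> 0 < (x - c) \<bullet> e" if "x \<in> K" for x
    using that R by (auto simp: K_def)
  moreover have "continuous_on K w" using Kin cw by (intro continuous_at_imp_continuous_on) blast
  ultimately obtain m where m: "m > 0" "\<And>x. x \<in> K \<Longrightarrow> m \<le> w x"
    using positive_lower_bound[of K w] pos by blast
  obtain k where k: "k > 0" "\<And>w (y::'a) \<delta>. 0 < \<delta> \<Longrightarrow>
    (\<forall>x\<in>ball y (R/8). \<exists>L\<le>0. has_laplacian w x L) \<Longrightarrow> (\<forall>x\<in>ball y (R/8). 0 \<le> w x) \<Longrightarrow>
    (\<forall>x\<in>cball y (R/8/2). \<delta> \<le> w x) \<Longrightarrow> (\<forall>x\<in>ball y (R/8). \<delta> * k * (R/8 - norm (x - y)) \<le> w x)"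
    using hopf_ball[of "R/8", where 'a = 'a] R by (metis zero_less_divide_iff zero_less_numeral)
  \<comment> \<open>The first entry serves heights of at least R / 8, the second one is the Hopf
    bound for smaller heights.\<close>
  define \<eta> where "\<eta> = min (m / R) (m * k)"
  have \<eta>: "\<eta> > 0" using m k R by (simp add: \<eta>_def)
  have inner: "\<eta> * ((x - c) \<bullet> e) \<le> w x" if x: "norm (x - c) \<le> R / 2" "0 < (x - c) \<bullet> e" for x
  proof (cases "R / 8 \<le> (x - c) \<bullet> e")
    case True
    have "x \<in> K" using True x R by (simp add: K_def dist_norm norm_minus_commute)
    have "(x - c) \<bullet> e \<le> R" using x norm_cauchy_schwarz[of "x - c" e] e R by simp
    then have "\<eta> * ((x - c) \<bullet> e) \<le> (m / R) * R"
      using x m R by (intro mult_mono) (auto simp: \<eta>_def)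
    then show ?thesis using m(2)[OF \<open>x \<in> K\<close>] R by simp
  next
    case False
    define t where "t = (x - c) \<bullet> e"
    \<comment> \<open>The ball of radius R / 8 around this point is tangent to the flat face, and
      the distance of x from its sphere is exactly the height t.\<close>
    define y where "y = x + (R/8 - t) *\<^sub>R e"
    have t: "0 < t" "t < R/8" using x False by (auto simp: t_def)
    have xy: "norm (x - y) = R/8 - t" using t e by (simp add: y_def)
    have yc: "(y - c) \<bullet> e = R/8"
    proof -
      have "(y - c) \<bullet> e = ((x - c) + (R/8 - t) *\<^sub>R e) \<bullet> e" by (simp add: y_def algebra_simps)
      also have "\<dots> = t + (R/8 - t)" by (simp only: inner_add_left inner_scaleR_left ee t_def mult_1_right)
      finally show ?thesis by simp
    qed
    have yn: "norm (y - c) \<le> R/2 + R/8"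
    proof -
      have "norm (y - c) \<le> norm (x - c) + norm (y - x)" using norm_triangle_ineq[of "x - c" "y - x"] by simp
      also have "norm (y - x) = R/8 - t" using xy by (simp add: norm_minus_commute)
      finally show ?thesis using x t by simp
    qed
    have ze: "(y - c) \<bullet> e - norm (z - y) \<le> (z - c) \<bullet> e" for z
    proof -
      have "(y - c) \<bullet> e - (z - c) \<bullet> e = (y - z) \<bullet> e" by (simp add: inner_diff_left)
      also have "\<dots> \<le> norm (z - y)" using norm_cauchy_schwarz[of "y - z" e] e by (simp add: norm_minus_commute)
      finally show ?thesis by simp
    qed
    have zn: "norm (z - c) \<le> norm (z - y) + norm (y - c)" for z
      using norm_triangle_ineq[of "z - y" "y - c"] by simp
    have b1: "z \<in> ball c R \<and> 0 < (z - c) \<bullet> e" if "z \<in> ball y (R/8)" for z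
      using that ze[of z] zn[of z] yc yn R by (auto simp: dist_norm norm_minus_commute)
    have b2: "z \<in> K" if "z \<in> cball y (R/8/2)" for z
      using that ze[of z] zn[of z] yc yn R by (auto simp: K_def dist_norm norm_minus_commute)
    have "\<forall>x\<in>ball y (R/8). m * k * (R/8 - norm (x - y)) \<le> w x"
      using b1 b2 m sup pos by (intro k(2)) (auto simp: less_imp_le)
    moreover have "x \<in> ball y (R/8)" using xy t by (simp add: dist_norm norm_minus_commute)
    ultimately have "m * k * (R/8 - norm (x - y)) \<le> w x" by blast
    then have "m * k * t \<le> w x" by (simp add: xy)
    moreover have "\<eta> * t \<le> m * k * t" using t by (intro mult_right_mono) (auto simp: \<eta>_def)
    ultimately show ?thesis by (simp add: t_def)
  qed
  obtain k1 where k1: "k1 > 0" "\<And>x. x \<in> ball c R - {c} \<Longrightarrow> k1 * (R - norm (x - c)) \<le> barrier R c x"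
    using barrier_lower_bound[OF R] by blast
  let ?B = "barrier_max TYPE('a) R"
  have B: "?B > 0" using R by (rule barrier_max_pos)
  define z where "z = (\<lambda>x. ((x - c) \<bullet> e) * barrier R c x)"
  define S where "S = (ball c R - cball c (R/2)) \<inter> {x. 0 < (x - c) \<bullet> e}"
  define f where "f = (\<lambda>x. w x - (\<eta> / ?B) * z x)"
  have cz: "isCont z p" if "p \<noteq> c" for p
    unfolding z_def using that by (intro continuous_intros barrier_isCont)
  have "0 \<le> f x" if x: "x \<in> S" for x
  proof (rule weak_minimum_principle[where S = S])
    have oS: "open S" unfolding S_def
      by (intro open_Int open_Diff open_Collect_less continuous_intros) auto
    then show "open S" .
    show "bounded S" by (rule bounded_subset[OF bounded_ball[of c R]]) (auto simp: S_def)
    show "x \<in> S" by (rule x)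
    show "\<exists>L\<le>0. has_laplacian f p L" if p: "p \<in> S" for p
    proof -
      have "p \<noteq> c" "0 \<le> (p - c) \<bullet> e" using p R by (auto simp: S_def)
      then obtain M where M: "M \<ge> 0" "has_laplacian z p M"
        using barrier_laplacian_linear unfolding z_def by blast
      obtain L where L: "L \<le> 0" "has_laplacian w p L" using sup p unfolding S_def by blast
      have "has_laplacian f p (L - (\<eta> / ?B) * M)"
        unfolding f_def by (intro has_laplacian_diff has_laplacian_cmult L M)
      moreover have "L - (\<eta> / ?B) * M \<le> 0"
        using L M \<eta> B by (smt (verit) divide_nonneg_pos mult_nonneg_nonneg)
      ultimately show ?thesis by blast
    qed
    show "\<forall>\<^sub>F y in at p within S. - \<epsilon> < f y" if p: "p \<in> frontier S" and \<epsilon>: "\<epsilon> > 0" for p \<epsilon>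
    proof -
      have "closure S \<subseteq> (cball c R - ball c (R/2)) \<inter> {x. 0 \<le> (x - c) \<bullet> e}"
      proof (rule closure_minimal)
        show "closed ((cball c R - ball c (R/2)) \<inter> {x. 0 \<le> (x - c) \<bullet> e})"
          by (intro closed_Int closed_Diff closed_Collect_le continuous_intros) auto
      qed (auto simp: S_def)
      moreover have "p \<in> closure S" "p \<notin> S" using p oS by (auto simp: frontier_def interior_open)
      ultimately have cases: "(norm (p - c) = R \<or> (p - c) \<bullet> e = 0) \<or> norm (p - c) = R / 2 \<and> 0 < (p - c) \<bullet> e"
        and "R / 2 \<le> norm (p - c)"
        by (auto simp: S_def dist_norm norm_minus_commute)
      then have pc: "p \<noteq> c" using R by auto
      from cases show ?thesis
      proof
        \<comment> \<open>The comparison function vanishes on both of these pieces, so positivity of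
          w suffices.\<close>
        assume n: "norm (p - c) = R \<or> (p - c) \<bullet> e = 0"
        then have "z p = 0" by (auto simp: z_def barrier_zero)
        moreover have "isCont (\<lambda>y. - (\<eta> / ?B) * z y) p" by (intro continuous_intros cz pc)
        ultimately have "\<forall>\<^sub>F y in at p within S. - \<epsilon> < - (\<eta> / ?B) * z y"
          by (intro eventually_within_gt) (use \<epsilon> in simp_all)
        moreover have "\<forall>\<^sub>F y in at p within S. y \<in> S" by (simp add: eventually_at_filter)
        ultimately show ?thesis
          by eventually_elim (use pos in \<open>force simp: f_def S_def\<close>)
      next
        assume n: "norm (p - c) = R / 2 \<and> 0 < (p - c) \<bullet> e"
        then have "p \<in> ball c R" using R by (auto simp: dist_norm norm_minus_commute)
        then have "isCont f p" unfolding f_def using n by (intro continuous_intros cw cz pc) auto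
        moreover have "0 \<le> f p"
          using inner[of p] n B by (simp add: f_def z_def barrier_eq_max)
        ultimately show ?thesis using \<epsilon> by (intro eventually_within_gt) auto
      qed
    qed
  qed
  then have f0: "(\<eta> / ?B) * z x \<le> w x" if "x \<in> S" for x using that by (simp add: f_def)
  have "(\<eta> / ?B * k1) * ((x - c) \<bullet> e) * (R - norm (x - c)) \<le> w x"
    if x: "x \<in> ball c R" "R / 2 < norm (x - c)" "0 < (x - c) \<bullet> e" for x
  proof -
    have "x \<in> S" "x \<noteq> c" using x R by (auto simp: S_def dist_norm norm_minus_commute)
    have "((x - c) \<bullet> e) * (k1 * (R - norm (x - c))) \<le> z x"
      unfolding z_def using k1(2)[of x] x \<open>x \<noteq> c\<close> by (intro mult_left_mono) auto
    then have "(\<eta> / ?B) * (((x - c) \<bullet> e) * (k1 * (R - norm (x - c)))) \<le> (\<eta> / ?B) * z x"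
      using \<eta> B by (intro mult_left_mono) auto
    then show ?thesis using f0[OF \<open>x \<in> S\<close>] by (simp add: mult_ac)
  qed
  moreover have "0 < \<eta> / ?B * k1" using \<eta> B k1 by simp
  ultimately show ?thesis by blast
qed

section \<open>Reflections and isolated singularities\<close>

text \<open>The mean value theorem in direction b, applied to the increment in direction a, followed
  by the expansion of g at x. The left side does not change when a and b are exchanged, so the
  Hessian is symmetric even without continuous second derivatives.\<close>

lemma hessian_second_difference:
  assumes h: "has_hessian f g H x" and \<epsilon>: "0 < \<epsilon>"
  shows "\<forall>\<^sub>F t in at_right 0. \<bar>(f (x + t *\<^sub>R a + t *\<^sub>R b) - f (x + t *\<^sub>R a) - f (x + t *\<^sub>R b) + f x) / t\<^sup>2 - H a \<bullet> b\<bar> \<le> \<epsilon>"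
proof -
  \<comment> \<open>Collects the errors of the two first order expansions of g after pairing with b;
    the added 1 keeps it positive for b = 0.\<close>
  define C where "C = norm b * (norm a + 2 * norm b) + 1"
  have C: "C > 0" by (simp add: C_def add_nonneg_pos)
  have "(g has_derivative H) (at x)" using h by (simp add: has_hessian_def)
  then obtain d1 where d1: "d1 > 0" "\<And>y. norm (y - x) < d1 \<Longrightarrow> norm (g y - g x - H (y - x)) \<le> (\<epsilon> / C) * norm (y - x)"
    unfolding has_derivative_at_alt using \<epsilon> C by (meson divide_pos_pos)
  obtain d2 where d2: "d2 > 0" "\<And>y. dist y x < d2 \<Longrightarrow> (f has_derivative (\<lambda>h. g y \<bullet> h)) (at y)"
    using h by (auto simp: has_hessian_def eventually_nhds_metric)
  have lin: "linear H" using h by (auto simp: has_hessian_def dest: has_derivative_linear)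
  define d where "d = min d1 d2 / (norm a + norm b + 1)"
  have ab: "norm a + norm b + 1 > 0" by (simp add: add_nonneg_pos)
  have d: "d > 0" using d1(1) d2(1) ab by (simp add: d_def)
  show ?thesis
    unfolding eventually_at_right_field
  proof (intro exI[of _ d] conjI allI impI d)
    fix t assume t: "0 < t" "t < d"
    have near: "norm (s *\<^sub>R a + r *\<^sub>R b) < min d1 d2" if "0 \<le> s" "s \<le> t" "0 \<le> r" "r \<le> t" for s r
    proof -
      have "norm (s *\<^sub>R a + r *\<^sub>R b) \<le> norm (s *\<^sub>R a) + norm (r *\<^sub>R b)" by (rule norm_triangle_ineq)
      also have "\<dots> \<le> t * norm a + t * norm b" using that by (auto intro!: add_mono mult_right_mono)
      also have "\<dots> \<le> t * (norm a + norm b + 1)" using t by (simp add: algebra_simps)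
      also have "\<dots> < d * (norm a + norm b + 1)" using t ab by simp
      also have "\<dots> = min d1 d2" using ab by (simp add: d_def)
      finally show ?thesis .
    qed
    have D: "((\<lambda>r. f (x + s *\<^sub>R a + r *\<^sub>R b)) has_real_derivative g (x + s *\<^sub>R a + r *\<^sub>R b) \<bullet> b) (at r)"
      if "0 \<le> s" "s \<le> t" "0 \<le> r" "r \<le> t" for s r
    proof -
      have "dist (x + s *\<^sub>R a + r *\<^sub>R b) x < d2" using near[OF that] by (simp add: dist_norm add.assoc)
      note D = d2(2)[OF this]
      have line: "((\<lambda>r. x + s *\<^sub>R a + r *\<^sub>R b) has_derivative (\<lambda>r. r *\<^sub>R b)) (at r)"
        by (auto intro!: derivative_eq_intros)
      show ?thesis
        unfolding has_field_derivative_def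
        by (rule has_derivative_eq_rhs[OF has_derivative_compose[OF line D]]) (simp add: fun_eq_iff)
    qed
    have "\<exists>z>0. z < t \<and> (f (x + t *\<^sub>R a + t *\<^sub>R b) - f (x + 0 *\<^sub>R a + t *\<^sub>R b)) - (f (x + t *\<^sub>R a + 0 *\<^sub>R b) - f (x + 0 *\<^sub>R a + 0 *\<^sub>R b))
      = (t - 0) * (g (x + t *\<^sub>R a + z *\<^sub>R b) \<bullet> b - g (x + 0 *\<^sub>R a + z *\<^sub>R b) \<bullet> b)"
      using t(1) by (intro MVT2 derivative_intros D) auto
    then obtain z where z: "0 < z" "z < t" and
      e: "f (x + t *\<^sub>R a + t *\<^sub>R b) - f (x + t *\<^sub>R a) - f (x + t *\<^sub>R b) + f x
        = t * ((g (x + t *\<^sub>R a + z *\<^sub>R b) - g (x + z *\<^sub>R b)) \<bullet> b)"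
      by (auto simp: inner_diff_left)
    define E1 where "E1 = g (x + t *\<^sub>R a + z *\<^sub>R b) - g x - H (t *\<^sub>R a + z *\<^sub>R b)"
    define E2 where "E2 = g (x + z *\<^sub>R b) - g x - H (z *\<^sub>R b)"
    have E1: "norm E1 \<le> (\<epsilon> / C) * norm (t *\<^sub>R a + z *\<^sub>R b)"
      using d1(2)[of "x + t *\<^sub>R a + z *\<^sub>R b"] near[of t z] z t by (simp add: E1_def add.assoc)
    have E2: "norm E2 \<le> (\<epsilon> / C) * norm (z *\<^sub>R b)"
      using d1(2)[of "x + z *\<^sub>R b"] near[of 0 z] z t by (simp add: E2_def)
    have "g (x + t *\<^sub>R a + z *\<^sub>R b) - g (x + z *\<^sub>R b) = t *\<^sub>R H a + (E1 - E2)"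
      by (simp add: E1_def E2_def linear_add[OF lin] linear_cmul[OF lin])
    then have "(f (x + t *\<^sub>R a + t *\<^sub>R b) - f (x + t *\<^sub>R a) - f (x + t *\<^sub>R b) + f x) / t\<^sup>2 - H a \<bullet> b
      = ((E1 - E2) \<bullet> b) / t"
      unfolding e using t
      by (simp only: inner_add_left inner_scaleR_left) (simp add: field_simps power2_eq_square)
    also have "\<bar>\<dots>\<bar> \<le> (norm (E1 - E2) * norm b) / t"
      using t Cauchy_Schwarz_ineq2[of "E1 - E2" b] by (simp add: divide_right_mono)
    also have "\<dots> \<le> (((\<epsilon> / C) * (t * (norm a + 2 * norm b))) * norm b) / t"
    proof (intro divide_right_mono mult_right_mono)
      have "norm (E1 - E2) \<le> norm E1 + norm E2" by (rule norm_triangle_ineq4)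
      also have "\<dots> \<le> (\<epsilon> / C) * norm (t *\<^sub>R a + z *\<^sub>R b) + (\<epsilon> / C) * norm (z *\<^sub>R b)"
        using E1 E2 by simp
      also have "\<dots> = (\<epsilon> / C) * (norm (t *\<^sub>R a + z *\<^sub>R b) + norm (z *\<^sub>R b))" by (simp add: distrib_left)
      also have "\<dots> \<le> (\<epsilon> / C) * ((t * norm a + t * norm b) + t * norm b)"
      proof (intro mult_left_mono add_mono)
        show "norm (t *\<^sub>R a + z *\<^sub>R b) \<le> t * norm a + t * norm b"
          using norm_triangle_ineq[of "t *\<^sub>R a" "z *\<^sub>R b"] z t mult_right_mono[of z t "norm b"] by simp
      qed (use z t \<epsilon> C in \<open>auto intro: mult_right_mono\<close>)
      finally show "norm (E1 - E2) \<le> (\<epsilon> / C) * (t * (norm a + 2 * norm b))" by (simp add: algebra_simps)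
    qed (use t in auto)
    also have "\<dots> = \<epsilon> * ((C - 1) / C)" using t by (simp add: C_def mult_ac)
    also have "\<dots> \<le> \<epsilon>" using \<epsilon> C by (simp add: field_simps)
    finally show "\<bar>(f (x + t *\<^sub>R a + t *\<^sub>R b) - f (x + t *\<^sub>R a) - f (x + t *\<^sub>R b) + f x) / t\<^sup>2 - H a \<bullet> b\<bar> \<le> \<epsilon>" .
  qed
qed

lemma hessian_symmetric:
  assumes h: "has_hessian f g H x"
  shows "H a \<bullet> b = H b \<bullet> a"
proof (rule ccontr)
  assume ne: "H a \<bullet> b \<noteq> H b \<bullet> a"
  define \<epsilon> where "\<epsilon> = \<bar>H a \<bullet> b - H b \<bullet> a\<bar> / 3"
  have \<epsilon>: "0 < \<epsilon>" using ne by (simp add: \<epsilon>_def)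
  have "\<forall>\<^sub>F t::real in at_right 0. \<bar>H a \<bullet> b - H b \<bullet> a\<bar> \<le> 2 * \<epsilon>"
    using hessian_second_difference[OF h \<epsilon>, of a b] hessian_second_difference[OF h \<epsilon>, of b a]
  proof eventually_elim
    case (elim t)
    have "f (x + t *\<^sub>R a + t *\<^sub>R b) - f (x + t *\<^sub>R a) - f (x + t *\<^sub>R b) + f x
      = f (x + t *\<^sub>R b + t *\<^sub>R a) - f (x + t *\<^sub>R b) - f (x + t *\<^sub>R a) + f x"
      by (simp add: add_ac)
    with elim show ?case by (simp only: abs_le_iff) linarith
  qed
  then show False using \<epsilon> by (simp add: \<epsilon>_def)
qed

section \<open>Reflections in hyperplanes\<close>

definition reflect :: "'a::euclidean_space \<Rightarrow> real \<Rightarrow> 'a \<Rightarrow> 'a" where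
  "reflect e l x = x - (2 * (x \<bullet> e - l)) *\<^sub>R e"

definition lreflect :: "'a::euclidean_space \<Rightarrow> 'a \<Rightarrow> 'a" where
  "lreflect e h = h - (2 * (h \<bullet> e)) *\<^sub>R e"

lemma reflect_add: "reflect e l (x + h) = reflect e l x + lreflect e h"
  by (simp add: reflect_def lreflect_def inner_add_left algebra_simps)

lemma linear_lreflect: "linear (lreflect e)"
  by (rule linearI) (simp_all add: lreflect_def inner_add_left algebra_simps)

lemma reflect_has_derivative: "(reflect e l has_derivative lreflect e) (at x)"
  unfolding reflect_def lreflect_def by (auto intro!: derivative_eq_intros)

lemma lreflect_inner: "lreflect e a \<bullet> b = a \<bullet> lreflect e b"
  by (simp add: lreflect_def inner_diff_left inner_diff_right inner_commute)

context
  fixes e :: "'a::euclidean_space"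
  assumes e: "norm e = 1"
begin

lemma inner_unit_self: "e \<bullet> e = 1" using e by (simp add: norm_eq_1)

lemma reflect_inner: "reflect e l x \<bullet> e = 2 * l - x \<bullet> e"
  by (simp add: reflect_def inner_diff_left inner_unit_self)

lemma reflect_reflect: "reflect e l (reflect e l x) = x"
  unfolding reflect_def[of e l "reflect e l x"] reflect_inner by (simp add: reflect_def algebra_simps)

lemma lreflect_lreflect: "lreflect e (lreflect e h) = h"
  by (simp add: lreflect_def inner_diff_left inner_unit_self algebra_simps)

lemma norm_lreflect: "norm (lreflect e h) = norm h"
  by (simp add: norm_eq_sqrt_inner lreflect_inner lreflect_lreflect)

lemma dist_reflect: "dist (reflect e l x) (reflect e l y) = dist x y"
proof -
  have "reflect e l x = reflect e l y + lreflect e (x - y)" using reflect_add[of e l y "x - y"] by simp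
  then show ?thesis by (simp add: dist_norm norm_lreflect)
qed

lemma reflect_image: "reflect e l ` S = {x. reflect e l x \<in> S}"
  by (auto simp: reflect_reflect intro!: image_eqI[of _ _ "reflect e l x" for x])

lemma reflect_fix: "x \<bullet> e = l \<Longrightarrow> reflect e l x = x"
  by (simp add: reflect_def)

text \<open>Expanding both reflected factors produces corrections of - 2, - 2 and + 4 times
  \<open>H e \<bullet> e\<close>, which cancel. This is why Laplacians survive a reflection.\<close>

lemma tr_lreflect_conj:
  assumes H: "linear H"
  shows "tr (\<lambda>h. lreflect e (H (lreflect e h))) = tr H"
proof -
  have "tr (\<lambda>h. lreflect e (H (lreflect e h))) = (\<Sum>b\<in>Basis. H (lreflect e b) \<bullet> lreflect e b)"
    unfolding tr_def by (simp add: lreflect_inner)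
  also have "\<dots> = (\<Sum>b\<in>Basis. H b \<bullet> b - 2 * (((b \<bullet> e) *\<^sub>R H b) \<bullet> e) - 2 * ((H e \<bullet> b) * (e \<bullet> b))
      + 4 * (H e \<bullet> e) * ((e \<bullet> b) * (e \<bullet> b)))"
  proof (intro sum.cong refl)
    fix b :: 'a
    have c: "e \<bullet> b = b \<bullet> e" by (rule inner_commute)
    show "H (lreflect e b) \<bullet> lreflect e b = H b \<bullet> b - 2 * (((b \<bullet> e) *\<^sub>R H b) \<bullet> e) - 2 * ((H e \<bullet> b) * (e \<bullet> b))
      + 4 * (H e \<bullet> e) * ((e \<bullet> b) * (e \<bullet> b))"
      unfolding c by (simp add: lreflect_def linear_diff[OF H] linear_cmul[OF H] algebra_simps)
  qed
  also have "\<dots> = tr H - 2 * ((\<Sum>b\<in>Basis. (b \<bullet> e) *\<^sub>R H b) \<bullet> e) - 2 * (H e \<bullet> e) + 4 * (H e \<bullet> e) * (e \<bullet> e)"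
    unfolding euclidean_inner[of "H e" e] euclidean_inner[of e e]
    by (simp only: tr_def sum.distrib sum_subtractf sum_distrib_left inner_sum_left)
  also have "\<dots> = tr H" by (simp add: sum_Basis_inner_scaleR[OF H] inner_unit_self)
  finally show ?thesis .
qed

lemma continuous_reflect: "isCont (reflect e l) x"
  using reflect_has_derivative has_derivative_continuous by blast

lemma has_laplacian_reflect:
  assumes "has_laplacian f (reflect e l x) L"
  shows "has_laplacian (\<lambda>y. f (reflect e l y)) x L"
proof -
  obtain g H where h: "\<forall>\<^sub>F y in nhds (reflect e l x). (f has_derivative (\<lambda>h. g y \<bullet> h)) (at y)"
      "(g has_derivative H) (at (reflect e l x))" "L = tr H"
    using assms unfolding has_laplacian_def has_hessian_def by blast
  have "filterlim (reflect e l) (nhds (reflect e l x)) (nhds x)"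
    using continuous_reflect by (simp add: continuous_at tendsto_nhds_iff isCont_def) 
  then have "\<forall>\<^sub>F y in nhds x. (f has_derivative (\<lambda>h. g (reflect e l y) \<bullet> h)) (at (reflect e l y))"
    using h(1) by (auto simp: filterlim_iff)
  then have "\<forall>\<^sub>F y in nhds x. ((\<lambda>y. f (reflect e l y)) has_derivative (\<lambda>h. lreflect e (g (reflect e l y)) \<bullet> h)) (at y)"
    by eventually_elim (simp add: lreflect_inner has_derivative_compose[OF reflect_has_derivative])
  moreover have "((\<lambda>y. lreflect e (g (reflect e l y))) has_derivative (\<lambda>h. lreflect e (H (lreflect e h)))) (at x)"
    using has_derivative_compose[OF reflect_has_derivative h(2)]
    by (rule bounded_linear.has_derivative[OF linear_conv_bounded_linear[THEN iffD1, OF linear_lreflect]])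
  ultimately show ?thesis
    by (rule has_laplacianI) (simp add: h(3) tr_lreflect_conj[OF has_derivative_linear[OF h(2)]])
qed

end

section \<open>Isolated singularities\<close>

lemma sq_norm_at_right_0: "filterlim (\<lambda>x. (x - q) \<bullet> (x - q)) (at_right 0) (at (q::'a::euclidean_space))"
  unfolding filterlim_at
proof
  show "\<forall>\<^sub>F x in at q. (x - q) \<bullet> (x - q) \<in> {0<..} \<and> (x - q) \<bullet> (x - q) \<noteq> 0"
    by (simp add: eventually_at_filter)
  have "((\<lambda>x. (x - q) \<bullet> (x - q)) \<longlongrightarrow> (q - q) \<bullet> (q - q)) (at q)"
    by (intro tendsto_intros)
  then show "((\<lambda>x. (x - q) \<bullet> (x - q)) \<longlongrightarrow> 0) (at q)" by simp
qed

text \<open>The fundamental solution with pole q. In dimension two the logarithm changes sign, so it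
  is shifted by \<open>ln (M\<^sup>2)\<close>, where M bounds the distance from q to points of
  S.\<close>

lemma singular_harmonic_exists:
  fixes q :: "'a::euclidean_space"
  assumes dim: "2 \<le> DIM('a)" and S: "bounded S"
  shows "\<exists>N. (\<forall>x. x \<noteq> q \<longrightarrow> has_laplacian N x 0) \<and> (\<forall>x\<in>S. x \<noteq> q \<longrightarrow> 0 \<le> N x) \<and> filterlim N at_top (at q)"
proof (cases "DIM('a) = 2")
  case True
  obtain M where M: "\<And>x. x \<in> S \<Longrightarrow> dist q x \<le> M" using S by (auto simp: bounded_any_center[of S q])
  define N where "N = (\<lambda>x. ln (M\<^sup>2) - ln ((x - q) \<bullet> (x - q)))"
  have "has_laplacian N x 0" if "x \<noteq> q" for x
    using has_laplacian_diff[OF has_laplacian_const has_laplacian_radial_ln[OF that], of "ln (M\<^sup>2)"] True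
    by (simp add: N_def)
  moreover have "0 \<le> N x" if "x \<in> S" "x \<noteq> q" for x
  proof -
    have "norm (x - q) \<le> M" using M[OF that(1)] by (simp add: dist_norm norm_minus_commute)
    then have "(norm (x - q))\<^sup>2 \<le> M\<^sup>2" by (intro power_mono) auto
    moreover have "0 < (x - q) \<bullet> (x - q)" using that by simp
    ultimately have "ln ((x - q) \<bullet> (x - q)) \<le> ln (M\<^sup>2)"
      unfolding power2_norm_eq_inner by (subst ln_le_cancel_iff) linarith+
    then show ?thesis by (simp add: N_def)
  qed
  moreover have "filterlim N at_top (at q)"
    unfolding N_def diff_conv_add_uminus
    using filterlim_compose[OF ln_at_0 sq_norm_at_right_0, of q]
    by (intro filterlim_tendsto_add_at_top[OF tendsto_const]) (simp add: filterlim_uminus_at_bot)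
  ultimately show ?thesis by blast
next
  case False
  let ?a = "1 - real DIM('a) / 2"
  have a: "?a < 0" using dim False by simp
  define N where "N = (\<lambda>x. ((x - q) \<bullet> (x - q)) powr ?a)"
  have "has_laplacian N x 0" if "x \<noteq> q" for x
    using has_laplacian_radial_powr[OF that, of ?a] by (simp add: N_def)
  moreover have "0 \<le> N x" for x by (simp add: N_def)
  moreover have "filterlim N at_top (at q)"
    unfolding N_def
  proof (rule filterlim_compose[OF _ sq_norm_at_right_0])
    show "filterlim (\<lambda>s. s powr ?a) at_top (at_right 0)"
    proof (rule filterlim_cong[THEN iffD1, OF refl refl])
      have "filterlim (\<lambda>s. - ?a * - ln s) at_top (at_right 0)"
        using a ln_at_0
        by (intro filterlim_tendsto_pos_mult_at_top[OF tendsto_const]) (auto simp: filterlim_uminus_at_bot)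
      then show "filterlim (\<lambda>s. exp (- ?a * - ln s)) at_top (at_right 0)"
        by (rule filterlim_compose[OF exp_at_top])
      show "\<forall>\<^sub>F s in at_right 0. exp (- ?a * - ln s) = s powr ?a"
        by (auto simp: eventually_at_filter powr_def left_diff_distrib intro!: always_eventually)
    qed
  qed
  ultimately show ?thesis by blast
qed

text \<open>A pole with a lower bound is invisible: f + \<eta> N tends to infinity at q, the weak
  principle applies off q, and \<eta> can be made small. The condition \<open>below\<close> is
  conditional because the mirror image of the origin may lie outside the cap.\<close>

lemma weak_minimum_principle_punctured:
  fixes f :: "'a::euclidean_space \<Rightarrow> real"
  assumes dim: "2 \<le> DIM('a)" and S: "open S" "bounded S"
    and sup: "\<And>x. x \<in> S \<Longrightarrow> x \<noteq> q \<Longrightarrow> \<exists>L\<le>0. has_laplacian f x L"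
    and bdry: "\<And>p \<epsilon>. p \<in> frontier S \<Longrightarrow> \<epsilon> > 0 \<Longrightarrow> \<forall>\<^sub>F x in at p within S. - \<epsilon> < f x"
    and below: "q \<in> S \<Longrightarrow> \<forall>\<^sub>F x in at q. m \<le> f x"
    and x: "x \<in> S" "x \<noteq> q"
  shows "0 \<le> f x"
proof -
  obtain N where N: "\<And>x. x \<noteq> q \<Longrightarrow> has_laplacian N x 0" "\<And>x. x \<in> S \<Longrightarrow> x \<noteq> q \<Longrightarrow> 0 \<le> N x"
      "filterlim N at_top (at q)"
    using singular_harmonic_exists[OF dim S(2), of q] by blast
  have *: "0 \<le> f x + \<eta> * N x" if \<eta>: "0 < \<eta>" for \<eta>
  proof (rule weak_minimum_principle[where S = "S - {q}"])
    show "open (S - {q})" "bounded (S - {q})" using S by (auto intro: bounded_subset)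
    show "x \<in> S - {q}" using x by simp
    show "\<exists>L\<le>0. has_laplacian (\<lambda>x. f x + \<eta> * N x) y L" if "y \<in> S - {q}" for y
      using sup[of y] that has_laplacian_add[OF _ has_laplacian_cmult[OF N(1)], of f y _ \<eta>] by fastforce
    show "\<forall>\<^sub>F y in at p within S - {q}. - \<epsilon> < f y + \<eta> * N y"
      if p: "p \<in> frontier (S - {q})" and \<epsilon>: "\<epsilon> > 0" for p \<epsilon>
    proof (cases "p = q \<and> q \<in> S")
      case True
      then have pq: "p = q" "q \<in> S" by auto
      have "\<forall>\<^sub>F y in at q. (1 - \<epsilon> - m) / \<eta> \<le> N y" using N(3) by (simp add: filterlim_at_top)
      then have "\<forall>\<^sub>F y in at q. - \<epsilon> < f y + \<eta> * N y"
        using below[OF pq(2)] by eventually_elim (use \<eta> in \<open>simp add: field_simps\<close>)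
      then show ?thesis unfolding pq(1) by (rule filter_leD[OF at_le, rotated]) simp
    next
      case False
      have "p \<in> closure S" using p closure_mono[of "S - {q}" S] by (auto simp: frontier_def)
      moreover have "p \<notin> S" using p False S(1) by (auto simp: frontier_def interior_open open_delete)
      ultimately have "p \<in> frontier S" using S(1) by (simp add: frontier_def interior_open)
      from bdry[OF this \<epsilon>] have "\<forall>\<^sub>F y in at p within S - {q}. - \<epsilon> < f y"
        by (rule filter_leD[OF at_le, rotated]) auto
      moreover have "\<forall>\<^sub>F y in at p within S - {q}. y \<in> S - {q}" by (simp add: eventually_at_filter)
      ultimately show ?thesis
      proof eventually_elim
        case (elim y)
        have "0 \<le> \<eta> * N y" using N(2)[of y] elim \<eta> by simp
        then show ?case using elim by simp
      qed
    qed
  qed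
  show ?thesis
  proof (rule ccontr)
    assume "\<not> 0 \<le> f x"
    then have neg: "f x < 0" by simp
    \<comment> \<open>Makes \<eta> N x smaller than half of - f x; the added 1 covers N x =
      0.\<close>
    define \<eta> where "\<eta> = - f x / (2 * (N x + 1))"
    have N0: "0 \<le> N x" using N(2) x by blast
    have "0 < \<eta>" using neg N0 by (auto simp: \<eta>_def intro!: divide_neg_pos)
    moreover have "\<eta> * (N x + 1) = - f x / 2" using N0 by (simp add: \<eta>_def field_simps)
    ultimately show False using *[of \<eta>] neg by (simp add: distrib_left)
  qed
qed

text \<open>At a boundary point u is approached from one side only, and its derivatives there are
  just limits. L'Hospital's rule turns such limits into an expansion; \<open>taylor_right_2\<close>
  applies it once more.\<close>

lemma taylor_right_1:
  fixes f :: "real \<Rightarrow> real"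
  assumes "(f \<longlongrightarrow> c) (at_right 0)"
    and "\<forall>\<^sub>F t in at_right 0. (f has_real_derivative f' t) (at t)"
    and "(f' \<longlongrightarrow> a) (at_right 0)"
  shows "((\<lambda>t. (f t - c) / t) \<longlongrightarrow> a) (at_right 0)"
proof (rule lhopital_right_0[where f' = f' and g' = "\<lambda>_. 1"])
  show "((\<lambda>t. f t - c) \<longlongrightarrow> 0) (at_right 0)" using assms(1) by (simp add: LIM_zero)
  show "\<forall>\<^sub>F t in at_right 0. ((\<lambda>t. f t - c) has_real_derivative f' t) (at t)"
    using assms(2) by eventually_elim (auto intro!: derivative_eq_intros)
  show "\<forall>\<^sub>F t in at_right 0. t \<noteq> (0::real)" by (simp add: eventually_at_filter)
qed (use assms(3) in auto)

lemma taylor_right_2: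
  fixes f :: "real \<Rightarrow> real"
  assumes "(f \<longlongrightarrow> c) (at_right 0)"
    and 1: "\<forall>\<^sub>F t in at_right 0. (f has_real_derivative f' t) (at t)"
    and "(f' \<longlongrightarrow> a) (at_right 0)"
    and 2: "\<forall>\<^sub>F t in at_right 0. (f' has_real_derivative f'' t) (at t)"
    and "(f'' \<longlongrightarrow> b) (at_right 0)"
  shows "((\<lambda>t. (f t - c - a * t) / t\<^sup>2) \<longlongrightarrow> b / 2) (at_right 0)"
proof (rule lhopital_right_0[where f' = "\<lambda>t. f' t - a" and g' = "\<lambda>t. 2 * t"])
  have "((\<lambda>t. f t - c - a * t) \<longlongrightarrow> c - c - a * 0) (at_right 0)"
    by (intro tendsto_intros assms(1))
  then show "((\<lambda>t. f t - c - a * t) \<longlongrightarrow> 0) (at_right 0)" by simp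
  have "((\<lambda>t::real. t\<^sup>2) \<longlongrightarrow> 0\<^sup>2) (at_right 0)" by (intro tendsto_intros)
  then show "((\<lambda>t::real. t\<^sup>2) \<longlongrightarrow> 0) (at_right 0)" by simp
  show "\<forall>\<^sub>F t in at_right 0. ((\<lambda>t. f t - c - a * t) has_real_derivative f' t - a) (at t)"
    using 1 by eventually_elim (auto intro!: derivative_eq_intros)
  show "\<forall>\<^sub>F t in at_right 0. ((\<lambda>t::real. t\<^sup>2) has_real_derivative 2 * t) (at t)"
    by (intro always_eventually allI) (auto intro!: derivative_eq_intros)
  have "((\<lambda>t. (f' t - a) / t / 2) \<longlongrightarrow> b / 2) (at_right 0)"
    by (intro tendsto_divide taylor_right_1[of f' a f'' b] assms tendsto_const) simp
  then show "((\<lambda>t. (f' t - a) / (2 * t)) \<longlongrightarrow> b / 2) (at_right 0)" by (simp add: mult.commute)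
qed (auto simp: eventually_at_filter)

section \<open>Boundary expansions\<close>

text \<open>Membership means |t d + r N| < r; in the expanded square the negative term 2 r t (d . N)
  outweighs t^2 |d|^2.\<close>

lemma mem_ball_touching:
  fixes N d p :: "'a::euclidean_space"
  assumes "norm N = 1" "0 < r" "0 < t" "t * (d \<bullet> d) < - (2 * r * (d \<bullet> N))"
  shows "p + t *\<^sub>R d \<in> ball (p - r *\<^sub>R N) r"
proof -
  have NN: "N \<bullet> N = 1" using assms(1) by (simp add: norm_eq_1)
  have "(norm (t *\<^sub>R d + r *\<^sub>R N))\<^sup>2 = t * (t * (d \<bullet> d) + 2 * r * (d \<bullet> N)) + r\<^sup>2"
    unfolding power2_norm_eq_inner
    by (simp add: inner_add_left inner_add_right NN inner_commute[of N d] power2_eq_square algebra_simps)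
  moreover have "t * (t * (d \<bullet> d) + 2 * r * (d \<bullet> N)) < 0"
    using assms by (intro mult_pos_neg) auto
  ultimately have "norm (t *\<^sub>R d + r *\<^sub>R N) < r"
    using assms(2) by (intro power2_less_imp_less[of _ r]) auto
  moreover have "dist (p - r *\<^sub>R N) (p + t *\<^sub>R d) = norm (t *\<^sub>R d + r *\<^sub>R N)"
    unfolding dist_norm norm_minus_commute[of "p - r *\<^sub>R N"] by (simp add: algebra_simps)
  ultimately show ?thesis by simp
qed

text \<open>\<open>g\<close> and \<open>G\<close> are the continuous extensions of gradient and Hessian to the boundary. Of the
  regularity of \<open>\<Omega>\<close> only touching balls on both sides and the transversality property are needed,
  and \<open>singular\<close> only excludes a \<open>C\<^sup>1\<close> extension to \<open>0\<close>.\<close>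

locale overdetermined =
  fixes \<Omega> :: "'a::euclidean_space set" and u :: "'a \<Rightarrow> real"
    and g :: "'a \<Rightarrow> 'a" and G :: "'a \<Rightarrow> 'a \<Rightarrow> 'a" and \<alpha> :: real and \<nu> :: "'a \<Rightarrow> 'a"
  assumes dim: "2 \<le> DIM('a)"
    and open_Omega: "open \<Omega>" and connected_Omega: "connected \<Omega>" and bounded_Omega: "bounded \<Omega>"
    and zero_in_Omega: "0 \<in> \<Omega>" and alpha_neg: "\<alpha> < 0"
    and u_cont: "continuous_on (closure \<Omega> - {0}) u"
    and g_cont: "continuous_on (closure \<Omega> - {0}) g"
    and G_cont: "\<And>h. continuous_on (closure \<Omega> - {0}) (\<lambda>x. G x h)"
    and G_linear: "\<And>x. linear (G x)"
    and u_deriv: "\<And>x. x \<in> \<Omega> - {0} \<Longrightarrow> (u has_derivative (\<lambda>h. g x \<bullet> h)) (at x)"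
    and g_deriv: "\<And>x. x \<in> \<Omega> - {0} \<Longrightarrow> (g has_derivative G x) (at x)"
    and tr_G: "\<And>x. x \<in> \<Omega> - {0} \<Longrightarrow> tr (G x) = - 1"
    and u_pos: "\<And>x. x \<in> \<Omega> - {0} \<Longrightarrow> 0 < u x"
    and u_zero: "\<And>x. x \<in> frontier \<Omega> \<Longrightarrow> u x = 0"
    and norm_nu: "\<And>p. p \<in> frontier \<Omega> \<Longrightarrow> norm (\<nu> p) = 1"
    and touching_balls: "\<And>p. p \<in> frontier \<Omega> \<Longrightarrow>
      \<exists>r>0. ball (p - r *\<^sub>R \<nu> p) r \<subseteq> \<Omega> \<and> ball (p + r *\<^sub>R \<nu> p) r \<inter> \<Omega> = {}"
    and transversal: "\<And>p e. p \<in> frontier \<Omega> \<Longrightarrow> 0 < \<nu> p \<bullet> e \<Longrightarrow>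
      \<exists>r>0. \<forall>x\<in>\<Omega> \<inter> ball p r. \<forall>s\<ge>0. x - s *\<^sub>R e \<in> ball p r \<longrightarrow> x - s *\<^sub>R e \<in> \<Omega>"
    and normal_deriv: "\<And>p. p \<in> frontier \<Omega> \<Longrightarrow> g p \<bullet> \<nu> p = \<alpha>"
    and singular: "\<And>v g'. (\<And>x. x \<in> \<Omega> \<Longrightarrow> (v has_derivative (\<lambda>h. g' x \<bullet> h)) (at x)) \<Longrightarrow>
      continuous_on \<Omega> g' \<Longrightarrow> (\<And>x. x \<in> \<Omega> - {0} \<Longrightarrow> v x = u x) \<Longrightarrow> False"
begin

section \<open>Rays at the boundary\<close>

lemma open_punctured: "open (\<Omega> - {0})"
  using open_Omega by (rule open_delete)

lemma u_has_hessian: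
  assumes "x \<in> \<Omega> - {0}"
  shows "has_hessian u g (G x) x"
  unfolding has_hessian_def
  using assms g_deriv u_deriv open_punctured by (auto simp: eventually_nhds intro!: exI[of _ "\<Omega> - {0}"])

lemma u_laplacian: "x \<in> \<Omega> - {0} \<Longrightarrow> has_laplacian u x (- 1)"
  using u_has_hessian tr_G unfolding has_laplacian_def by metis

lemma frontierD:
  assumes "p \<in> frontier \<Omega>"
  shows "p \<in> closure \<Omega>" "p \<notin> \<Omega>" "p \<noteq> 0" "p \<in> closure \<Omega> - {0}"
  using assms open_Omega zero_in_Omega by (auto simp: frontier_def interior_open)

lemma frontierI: "p \<in> closure \<Omega> \<Longrightarrow> p \<notin> \<Omega> \<Longrightarrow> p \<in> frontier \<Omega>"
  using open_Omega by (simp add: frontier_def interior_open)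

lemma nu_nu: "p \<in> frontier \<Omega> \<Longrightarrow> \<nu> p \<bullet> \<nu> p = 1"
  using norm_nu by (simp add: norm_eq_1)

lemma inward_ray:
  assumes p: "p \<in> frontier \<Omega>" and d: "d \<bullet> \<nu> p < 0"
  shows "\<forall>\<^sub>F t in at_right 0. p + t *\<^sub>R d \<in> \<Omega>"
proof -
  obtain r where r: "r > 0" "ball (p - r *\<^sub>R \<nu> p) r \<subseteq> \<Omega>" using touching_balls[OF p] by blast
  have "((\<lambda>t. t * (d \<bullet> d)) \<longlongrightarrow> 0 * (d \<bullet> d)) (at_right 0)" by (intro tendsto_intros)
  then have "\<forall>\<^sub>F t in at_right 0. t * (d \<bullet> d) < - (2 * r * (d \<bullet> \<nu> p))"
    by (rule order_tendstoD) (use r d in \<open>simp add: mult_pos_neg\<close>)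
  moreover have "\<forall>\<^sub>F t::real in at_right 0. 0 < t" by (simp add: eventually_at_filter)
  ultimately show ?thesis
  proof eventually_elim
    case (elim t)
    then show ?case using mem_ball_touching[OF norm_nu[OF p] r(1), of t d p] r(2) by auto
  qed
qed

lemma outward_ray:
  assumes p: "p \<in> frontier \<Omega>" and d: "0 < d \<bullet> \<nu> p"
  shows "\<forall>\<^sub>F t in at_right 0. p + t *\<^sub>R d \<notin> closure \<Omega>"
proof -
  obtain r where r: "r > 0" "ball (p + r *\<^sub>R \<nu> p) r \<inter> \<Omega> = {}" using touching_balls[OF p] by blast
  have c: "ball (p + r *\<^sub>R \<nu> p) r \<inter> closure \<Omega> = {}"
    using r(2) by (metis inf_commute open_Int_closure_eq_empty open_ball)
  have "((\<lambda>t. t * (d \<bullet> d)) \<longlongrightarrow> 0 * (d \<bullet> d)) (at_right 0)" by (intro tendsto_intros)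
  then have "\<forall>\<^sub>F t in at_right 0. t * (d \<bullet> d) < 2 * r * (d \<bullet> \<nu> p)"
    by (rule order_tendstoD) (use r d in simp)
  moreover have "\<forall>\<^sub>F t::real in at_right 0. 0 < t" by (simp add: eventually_at_filter)
  ultimately show ?thesis
  proof eventually_elim
    case (elim t)
    then have "p + t *\<^sub>R d \<in> ball (p + r *\<^sub>R \<nu> p) r"
      using mem_ball_touching[of "- \<nu> p" r t d p] norm_nu[OF p] r(1) by simp
    then show ?case using c by blast
  qed
qed

text \<open>Excludes slits and punctures: at a boundary point inside S the outward normal ray leaves
  the closure while still in S. Limits remain in the closure only, and this lemma brings them back
  into \<Omega>.\<close>

lemma open_subset_closure:
  assumes "open S" "S \<subseteq> closure \<Omega>"
  shows "S \<subseteq> \<Omega>"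
proof (rule ccontr)
  assume "\<not> S \<subseteq> \<Omega>"
  then obtain p where p: "p \<in> S" "p \<notin> \<Omega>" by blast
  then have fr: "p \<in> frontier \<Omega>" using assms frontierI by blast
  have "((\<lambda>t. p + t *\<^sub>R \<nu> p) \<longlongrightarrow> p + 0 *\<^sub>R \<nu> p) (at_right 0)" by (intro tendsto_intros)
  then have "\<forall>\<^sub>F t in at_right 0. p + t *\<^sub>R \<nu> p \<in> S"
    by (rule topological_tendstoD) (use assms p in auto)
  moreover have "\<forall>\<^sub>F t in at_right 0. p + t *\<^sub>R \<nu> p \<notin> closure \<Omega>"
    by (rule outward_ray[OF fr]) (simp add: nu_nu[OF fr])
  ultimately have "\<forall>\<^sub>F t::real in at_right 0. False" by eventually_elim (use assms in auto)
  then show False by simp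
qed

lemma inward_ray_punctured:
  assumes p: "p \<in> frontier \<Omega>" and d: "d \<bullet> \<nu> p < 0"
  shows "\<forall>\<^sub>F t in at_right 0. p + t *\<^sub>R d \<in> \<Omega> - {0}"
proof -
  have "((\<lambda>t. p + t *\<^sub>R d) \<longlongrightarrow> p + 0 *\<^sub>R d) (at_right 0)" by (intro tendsto_intros)
  then have "\<forall>\<^sub>F t in at_right 0. p + t *\<^sub>R d \<in> - {0}"
    by (rule topological_tendstoD) (use frontierD[OF p] in auto)
  then show ?thesis using inward_ray[OF assms] by eventually_elim auto
qed

lemma inward_ray_tendsto:
  assumes p: "p \<in> frontier \<Omega>" and d: "d \<bullet> \<nu> p < 0"
    and f: "continuous_on (closure \<Omega> - {0}) f"
  shows "((\<lambda>t. f (p + t *\<^sub>R d)) \<longlongrightarrow> f p) (at_right 0)"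
proof -
  have "(f \<longlongrightarrow> f p) (at p within closure \<Omega> - {0})"
    using f frontierD[OF p] by (auto simp: continuous_on)
  moreover have "filterlim (\<lambda>t. p + t *\<^sub>R d) (at p within closure \<Omega> - {0}) (at_right 0)"
    unfolding filterlim_at
  proof
    have "((\<lambda>t. p + t *\<^sub>R d) \<longlongrightarrow> p + 0 *\<^sub>R d) (at_right 0)" by (intro tendsto_intros)
    then show "((\<lambda>t. p + t *\<^sub>R d) \<longlongrightarrow> p) (at_right 0)" by simp
    show "\<forall>\<^sub>F t in at_right 0. p + t *\<^sub>R d \<in> closure \<Omega> - {0} \<and> p + t *\<^sub>R d \<noteq> p"
      using inward_ray_punctured[OF p d]
      by eventually_elim (use frontierD[OF p] closure_subset in auto)
  qed
  ultimately show ?thesis by (rule filterlim_compose)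
qed

section \<open>Expansions of the solution at the boundary\<close>

lemma line_deriv: "((\<lambda>t. p + t *\<^sub>R d) has_derivative (\<lambda>t. t *\<^sub>R d)) (at t)" for p d :: 'a and t :: real
  by (auto intro!: derivative_eq_intros)

lemma u_line_deriv:
  assumes "p + t *\<^sub>R d \<in> \<Omega> - {0}"
  shows "((\<lambda>t. u (p + t *\<^sub>R d)) has_real_derivative g (p + t *\<^sub>R d) \<bullet> d) (at t)"
  unfolding has_field_derivative_def
  by (rule has_derivative_eq_rhs[OF has_derivative_compose[OF line_deriv u_deriv[OF assms]]])
     (simp add: fun_eq_iff)

lemma g_line_deriv:
  assumes "p + t *\<^sub>R d \<in> \<Omega> - {0}"
  shows "((\<lambda>t. g (p + t *\<^sub>R d) \<bullet> b) has_real_derivative G (p + t *\<^sub>R d) d \<bullet> b) (at t)"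
  unfolding has_field_derivative_def
  by (rule has_derivative_eq_rhs[OF has_derivative_inner_left[OF has_derivative_compose[OF line_deriv g_deriv[OF assms]]]])
     (simp add: fun_eq_iff linear_cmul[OF G_linear])

lemma boundary_taylor_1:
  assumes p: "p \<in> frontier \<Omega>" and d: "d \<bullet> \<nu> p < 0"
  shows "((\<lambda>t. u (p + t *\<^sub>R d) / t) \<longlongrightarrow> g p \<bullet> d) (at_right 0)"
proof -
  have "((\<lambda>t. (u (p + t *\<^sub>R d) - u p) / t) \<longlongrightarrow> g p \<bullet> d) (at_right 0)"
  proof (rule taylor_right_1)
    show "\<forall>\<^sub>F t in at_right 0. ((\<lambda>t. u (p + t *\<^sub>R d)) has_real_derivative g (p + t *\<^sub>R d) \<bullet> d) (at t)"
      using inward_ray_punctured[OF p d] by eventually_elim (rule u_line_deriv)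
  qed (intro tendsto_intros inward_ray_tendsto p d u_cont g_cont)+
  then show ?thesis by (simp add: u_zero[OF p])
qed

lemma boundary_taylor_2:
  assumes p: "p \<in> frontier \<Omega>" and d: "d \<bullet> \<nu> p < 0"
  shows "((\<lambda>t. (u (p + t *\<^sub>R d) - (g p \<bullet> d) * t) / t\<^sup>2) \<longlongrightarrow> (G p d \<bullet> d) / 2) (at_right 0)"
proof -
  have "((\<lambda>t. (u (p + t *\<^sub>R d) - u p - (g p \<bullet> d) * t) / t\<^sup>2) \<longlongrightarrow> (G p d \<bullet> d) / 2) (at_right 0)"
  proof (rule taylor_right_2)
    show "\<forall>\<^sub>F t in at_right 0. ((\<lambda>t. u (p + t *\<^sub>R d)) has_real_derivative g (p + t *\<^sub>R d) \<bullet> d) (at t)"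
      using inward_ray_punctured[OF p d] by eventually_elim (rule u_line_deriv)
    show "\<forall>\<^sub>F t in at_right 0. ((\<lambda>t. g (p + t *\<^sub>R d) \<bullet> d) has_real_derivative G (p + t *\<^sub>R d) d \<bullet> d) (at t)"
      using inward_ray_punctured[OF p d] by eventually_elim (rule g_line_deriv)
  qed (intro tendsto_intros inward_ray_tendsto[where f = u] inward_ray_tendsto[where f = g]
        inward_ray_tendsto[where f = "\<lambda>x. G x d"] p d u_cont g_cont G_cont)+
  then show ?thesis by (simp add: u_zero[OF p])
qed

text \<open>Since u is positive inside and zero at p, its slope in every inward direction is
  nonnegative. Inward directions arbitrarily close to tangential ones leave no room for a tangential
  component of g p.\<close>

lemma g_boundary:
  assumes p: "p \<in> frontier \<Omega>"
  shows "g p = \<alpha> *\<^sub>R \<nu> p"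
proof -
  have nonneg: "0 \<le> g p \<bullet> d" if d: "d \<bullet> \<nu> p < 0" for d
  proof (rule tendsto_lowerbound[OF boundary_taylor_1[OF p d]])
    have "\<forall>\<^sub>F t::real in at_right 0. 0 < t" by (simp add: eventually_at_filter)
    then show "\<forall>\<^sub>F t in at_right 0. 0 \<le> u (p + t *\<^sub>R d) / t"
      using inward_ray_punctured[OF p d] by eventually_elim (intro divide_nonneg_pos less_imp_le[OF u_pos])
  qed simp
  define \<tau> where "\<tau> = g p - \<alpha> *\<^sub>R \<nu> p"
  have \<tau>\<nu>: "\<tau> \<bullet> \<nu> p = 0" by (simp add: \<tau>_def inner_diff_left nu_nu[OF p] normal_deriv[OF p])
  have g\<tau>: "g p \<bullet> \<tau> = \<tau> \<bullet> \<tau>" 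
    using \<tau>\<nu> by (simp add: \<tau>_def inner_diff_left inner_commute)
  \<comment> \<open>Tested with - \<tau> tilted inwards by an arbitrarily small amount s.\<close>
  have "\<tau> \<bullet> \<tau> \<le> s * - \<alpha>" if "0 < s" for s
    using nonneg[of "- \<tau> - s *\<^sub>R \<nu> p"] that
    by (simp add: inner_diff_left inner_diff_right \<tau>\<nu> g\<tau> nu_nu[OF p] normal_deriv[OF p])
  from this[of "\<tau> \<bullet> \<tau> / (2 * - \<alpha>)"] have "\<not> 0 < \<tau> \<bullet> \<tau>"
    using alpha_neg by (auto simp: divide_pos_neg field_simps)
  then have "\<tau> = 0" by simp
  then show ?thesis by (simp add: \<tau>_def)
qed

text \<open>At p the map G is only a continuous extension, so the symmetry of the interior Hessians
  is passed to the limit along the inner normal.\<close>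

lemma G_symmetric_boundary:
  assumes p: "p \<in> frontier \<Omega>"
  shows "G p a \<bullet> b = G p b \<bullet> a"
proof -
  have d: "(- \<nu> p) \<bullet> \<nu> p < 0" by (simp add: nu_nu[OF p])
  have 1: "((\<lambda>t. G (p + t *\<^sub>R (- \<nu> p)) a \<bullet> b) \<longlongrightarrow> G p a \<bullet> b) (at_right 0)" for a b
    by (intro tendsto_intros inward_ray_tendsto[where f = "\<lambda>x. G x a"] p d G_cont)
  have "\<forall>\<^sub>F t in at_right 0. G (p + t *\<^sub>R (- \<nu> p)) b \<bullet> a = G (p + t *\<^sub>R (- \<nu> p)) a \<bullet> b"
    using inward_ray_punctured[OF p d] by eventually_elim (rule hessian_symmetric[OF u_has_hessian])
  from Lim_transform_eventually[OF 1 this]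
  show ?thesis using tendsto_unique[OF _ 1] by (metis trivial_limit_at_right_real)
qed

text \<open>Continuity is available for each fixed direction; the finite basis makes it uniform in
  h.\<close>

lemma G_near:
  assumes p: "p \<in> closure \<Omega> - {0}" and \<epsilon>: "0 < \<epsilon>"
  shows "\<exists>\<delta>>0. \<forall>x\<in>closure \<Omega> - {0}. dist x p < \<delta> \<longrightarrow> (\<forall>h. norm (G x h - G p h) \<le> \<epsilon> * norm h)"
proof -
  define \<eta> where "\<eta> = \<epsilon> / real DIM('a)"
  have \<eta>: "0 < \<eta>" using \<epsilon> by (simp add: \<eta>_def)
  have "\<exists>\<delta>>0. \<forall>x\<in>closure \<Omega> - {0}. dist x p < \<delta> \<longrightarrow> dist (G x b) (G p b) < \<eta>" for b
    using G_cont[of b] p \<eta> unfolding continuous_on_iff by blast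
  then obtain \<delta> where \<delta>: "\<And>b. \<delta> b > 0" "\<And>b x. x \<in> closure \<Omega> - {0} \<Longrightarrow> dist x p < \<delta> b \<Longrightarrow> dist (G x b) (G p b) < \<eta>"
    by metis
  have "norm (G x h - G p h) \<le> \<epsilon> * norm h" if x: "x \<in> closure \<Omega> - {0}" "dist x p < Min (\<delta> ` Basis)" for x h
  proof -
    have "G x h - G p h = (\<Sum>b\<in>Basis. (h \<bullet> b) *\<^sub>R (G x b - G p b))"
      using sum_Basis_inner_scaleR[OF G_linear[of x], of h] sum_Basis_inner_scaleR[OF G_linear[of p], of h]
      by (simp add: scaleR_diff_right sum_subtractf inner_commute)
    also have "norm \<dots> \<le> (\<Sum>b\<in>(Basis::'a set). norm h * \<eta>)"
    proof (rule sum_norm_le)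
      fix b :: 'a assume b: "b \<in> Basis"
      have "dist x p < \<delta> b" using x(2) b by simp
      then have "norm (G x b - G p b) \<le> \<eta>" using \<delta>(2)[OF x(1)] by (simp add: dist_norm less_imp_le)
      then show "norm ((h \<bullet> b) *\<^sub>R (G x b - G p b)) \<le> norm h * \<eta>"
        using Basis_le_norm[OF b, of h] by (auto intro!: mult_mono)
    qed
    also have "\<dots> = \<epsilon> * norm h" by (simp add: \<eta>_def)
    finally show ?thesis .
  qed
  moreover have "0 < Min (\<delta> ` Basis)" using \<delta>(1) by (subst Min_gr_iff) auto
  ultimately show ?thesis by blast
qed

text \<open>The mean value inequality for g minus a linear map. Only the open segment has to lie in
  the domain, so an endpoint may be a boundary point.\<close>

lemma g_increment:
  assumes ab: "a \<in> closure \<Omega> - {0}" "b \<in> closure \<Omega> - {0}" 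
    and seg: "\<And>s. 0 < s \<Longrightarrow> s < 1 \<Longrightarrow> a + s *\<^sub>R (b - a) \<in> \<Omega> - {0}"
    and L: "\<And>s h. 0 < s \<Longrightarrow> s < 1 \<Longrightarrow> norm (G (a + s *\<^sub>R (b - a)) h - L h) \<le> \<epsilon> * norm h"
  shows "norm (g b - g a - L (b - a)) \<le> \<epsilon> * norm (b - a)"
proof -
  define \<phi> where "\<phi> = (\<lambda>s. g (a + s *\<^sub>R (b - a)) - s *\<^sub>R L (b - a))"
  have "\<exists>x\<in>{0<..<1}. norm (\<phi> 1 - \<phi> 0) \<le> norm ((1 - 0) *\<^sub>R (G (a + x *\<^sub>R (b - a)) (b - a) - L (b - a)))"
  proof (rule mvt_general)
    have "a + s *\<^sub>R (b - a) \<in> closure \<Omega> - {0}" if "s \<in> {0..1}" for s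
    proof (cases "s = 0 \<or> s = 1")
      case True
      then show ?thesis using ab by auto
    next
      case False
      then show ?thesis using seg[of s] that closure_subset[of \<Omega>] by auto
    qed
    then have "continuous_on {0..1} (\<lambda>s. g (a + s *\<^sub>R (b - a)))"
      by (intro continuous_on_compose2[OF g_cont] continuous_intros) auto
    then show "continuous_on {0..1} \<phi>" unfolding \<phi>_def by (intro continuous_intros)
    fix s :: real assume s: "0 < s" "s < 1"
    have d: "((\<lambda>s. g (a + s *\<^sub>R (b - a))) has_derivative (\<lambda>t. G (a + s *\<^sub>R (b - a)) (t *\<^sub>R (b - a)))) (at s)"
      using s by (intro has_derivative_compose[OF line_deriv g_deriv] seg) auto
    show "(\<phi> has_derivative (\<lambda>t. t *\<^sub>R (G (a + s *\<^sub>R (b - a)) (b - a) - L (b - a)))) (at s)"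
      unfolding \<phi>_def by (rule derivative_eq_intros d refl)+
        (simp only: linear_cmul[OF G_linear] scaleR_diff_right[symmetric] scaleR_scaleR mult_1_right mult_1_left scaleR_one)
  qed simp
  then obtain s where s: "0 < s" "s < 1" "norm (\<phi> 1 - \<phi> 0) \<le> norm (G (a + s *\<^sub>R (b - a)) (b - a) - L (b - a))"
    by auto
  have "\<phi> 1 - \<phi> 0 = g b - g a - L (b - a)" by (simp add: \<phi>_def)
  then show ?thesis using s(3) L[OF s(1,2), of "b - a"] by simp
qed

text \<open>With K = 1 / r for tangent balls of radius r, the point p + t (e - K t \<nu>) lies in
  the inner ball and p + t (e + K t \<nu>) in the outer one, so the normal segment of length 2 K t^2
  between them leaves \<Omega>. The broken path from p over the first point to the exit runs inside
  \<Omega>, as \<open>g_increment\<close> requires.\<close>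

lemma frontier_near_tangent:
  assumes p: "p \<in> frontier \<Omega>" and e: "norm e = 1" "e \<bullet> \<nu> p = 0"
  shows "\<exists>K>0. \<forall>t>0. K * t < 1 \<longrightarrow> (\<exists>s. 0 < s \<and> s \<le> 2 * K * t\<^sup>2 \<and>
     p + t *\<^sub>R (e - (K * t) *\<^sub>R \<nu> p) + s *\<^sub>R \<nu> p \<in> frontier \<Omega> \<and>
     (\<forall>r. 0 < r \<longrightarrow> r \<le> t \<longrightarrow> p + r *\<^sub>R (e - (K * t) *\<^sub>R \<nu> p) \<in> \<Omega>) \<and>
     (\<forall>r. 0 \<le> r \<longrightarrow> r < s \<longrightarrow> p + t *\<^sub>R (e - (K * t) *\<^sub>R \<nu> p) + r *\<^sub>R \<nu> p \<in> \<Omega>))"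
proof -
  obtain r where r: "r > 0" "ball (p - r *\<^sub>R \<nu> p) r \<subseteq> \<Omega>" "ball (p + r *\<^sub>R \<nu> p) r \<inter> \<Omega> = {}"
    using touching_balls[OF p] by blast
  define K where "K = 1 / r"
  have K: "K > 0" "r * K = 1" using r by (auto simp: K_def)
  have ee: "e \<bullet> e = 1" using e by (simp add: norm_eq_1)
  have ne: "\<nu> p \<bullet> e = 0" using e(2) by (simp add: inner_commute)
  show ?thesis
  proof (rule exI[of _ K], intro conjI allI impI)
    fix t :: real assume t: "0 < t" "K * t < 1"
    define d where "d = e - (K * t) *\<^sub>R \<nu> p"
    define q where "q = p + t *\<^sub>R d"
    have Kt: "(K * t) * (K * t) < 1" using t K mult_strict_mono[of "K * t" 1 "K * t" 1] by simp
    have dd: "d \<bullet> d = 1 + (K * t) * (K * t)" "d \<bullet> \<nu> p = - (K * t)"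
      by (simp_all add: d_def inner_diff_left inner_diff_right ee e(2) ne nu_nu[OF p])
    have inner: "p + s *\<^sub>R d \<in> \<Omega>" if "0 < s" "s \<le> t" for s
    proof -
      have "s * (d \<bullet> d) < t * 2" using that Kt unfolding dd by (intro mult_le_less_imp_less) (auto intro: add_nonneg_pos)
      also have "t * 2 = - (2 * r * (d \<bullet> \<nu> p))" unfolding dd using K(2) by (simp add: algebra_simps)
      finally show ?thesis using mem_ball_touching[OF norm_nu[OF p] r(1) that(1)] r(2) by blast
    qed
    have up: "q + (2 * K * t\<^sup>2) *\<^sub>R \<nu> p \<notin> \<Omega>"
    proof -
      define d' where "d' = e + (K * t) *\<^sub>R \<nu> p"
      have dd': "d' \<bullet> d' = 1 + (K * t) * (K * t)" "d' \<bullet> - \<nu> p = - (K * t)"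
        by (simp_all add: d'_def inner_add_left inner_add_right ee e(2) ne nu_nu[OF p])
      have "t * (d' \<bullet> d') < t * 2" using t(1) Kt unfolding dd' by simp
      also have "t * 2 = - (2 * r * (d' \<bullet> - \<nu> p))" unfolding dd' using K(2) by (simp add: algebra_simps)
      finally have "p + t *\<^sub>R d' \<in> ball (p - r *\<^sub>R - \<nu> p) r"
        by (intro mem_ball_touching) (use norm_nu[OF p] r t in auto)
      moreover have "p + t *\<^sub>R d' = q + (2 * K * t\<^sup>2) *\<^sub>R \<nu> p"
        by (simp add: q_def d_def d'_def algebra_simps power2_eq_square flip: scaleR_add_left)
      ultimately show ?thesis using r(3) by auto
    qed
    define A where "A = {s. 0 \<le> s \<and> s \<le> 2 * K * t\<^sup>2 \<and> q + s *\<^sub>R \<nu> p \<notin> \<Omega>}"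
    have "A = {0..2 * K * t\<^sup>2} \<inter> (\<lambda>s. q + s *\<^sub>R \<nu> p) -` (- \<Omega>)" by (auto simp: A_def)
    moreover have "closed ({0..2 * K * t\<^sup>2} \<inter> (\<lambda>s. q + s *\<^sub>R \<nu> p) -` (- \<Omega>))"
      using open_Omega by (intro continuous_closed_preimage continuous_intros) auto
    ultimately have "closed A" by simp
    moreover have "2 * K * t\<^sup>2 \<in> A" using up K t by (simp add: A_def)
    moreover have "bdd_below A" by (rule bdd_belowI[of _ 0]) (simp add: A_def)
    ultimately have s: "Inf A \<in> A" "\<And>r. r \<in> A \<Longrightarrow> Inf A \<le> r"
      using closed_contains_Inf by (blast intro: cInf_lower)+
    define s where "s = Inf A"
    have sA: "0 \<le> s" "s \<le> 2 * K * t\<^sup>2" "q + s *\<^sub>R \<nu> p \<notin> \<Omega>" using s(1) by (auto simp: A_def s_def)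
    have below: "q + r *\<^sub>R \<nu> p \<in> \<Omega>" if "0 \<le> r" "r < s" for r
      using s(2)[of r] that sA by (auto simp: A_def s_def)
    have "q \<in> \<Omega>" using inner[of t] t by (simp add: q_def)
    then have "s \<noteq> 0" using sA(3) by auto
    then have s0: "0 < s" using sA by simp
    have "q + s *\<^sub>R \<nu> p \<in> closure \<Omega>"
    proof (rule Lim_in_closed_set)
      show "((\<lambda>r. q + r *\<^sub>R \<nu> p) \<longlongrightarrow> q + s *\<^sub>R \<nu> p) (at_left s)" by (intro tendsto_intros)
      show "\<forall>\<^sub>F r in at_left s. q + r *\<^sub>R \<nu> p \<in> closure \<Omega>"
        using below s0 closure_subset[of \<Omega>] unfolding eventually_at_left_field
        by (intro exI[of _ 0]) auto
    qed simp_all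
    then have "q + s *\<^sub>R \<nu> p \<in> frontier \<Omega>" using sA(3) frontierI by blast
    then show "\<exists>s. 0 < s \<and> s \<le> 2 * K * t\<^sup>2 \<and>
     p + t *\<^sub>R (e - (K * t) *\<^sub>R \<nu> p) + s *\<^sub>R \<nu> p \<in> frontier \<Omega> \<and>
     (\<forall>r. 0 < r \<longrightarrow> r \<le> t \<longrightarrow> p + r *\<^sub>R (e - (K * t) *\<^sub>R \<nu> p) \<in> \<Omega>) \<and>
     (\<forall>r. 0 \<le> r \<longrightarrow> r < s \<longrightarrow> p + t *\<^sub>R (e - (K * t) *\<^sub>R \<nu> p) + r *\<^sub>R \<nu> p \<in> \<Omega>)"
      unfolding d_def[symmetric] q_def[symmetric] using s0 sA inner below by blast
  qed (rule K)
qed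

text \<open>The length of the gradient is constant along the boundary, so its tangential derivative vanishes.\<close>

lemma mixed_second_derivative:
  assumes p: "p \<in> frontier \<Omega>" and e: "norm e = 1" "e \<bullet> \<nu> p = 0"
  shows "G p e \<bullet> \<nu> p = 0"
proof -
  define N where "N = \<nu> p"
  have N: "norm N = 1" using norm_nu[OF p] by (simp add: N_def)
  have gp: "g p = \<alpha> *\<^sub>R N" using g_boundary[OF p] by (simp add: N_def)
  obtain K where K: "K > 0" "\<And>t. 0 < t \<Longrightarrow> K * t < 1 \<Longrightarrow> (\<exists>s. 0 < s \<and> s \<le> 2 * K * t\<^sup>2 \<and>
     p + t *\<^sub>R (e - (K * t) *\<^sub>R N) + s *\<^sub>R N \<in> frontier \<Omega> \<and>
     (\<forall>r. 0 < r \<longrightarrow> r \<le> t \<longrightarrow> p + r *\<^sub>R (e - (K * t) *\<^sub>R N) \<in> \<Omega>) \<and>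
     (\<forall>r. 0 \<le> r \<longrightarrow> r < s \<longrightarrow> p + t *\<^sub>R (e - (K * t) *\<^sub>R N) + r *\<^sub>R N \<in> \<Omega>))"
    using frontier_near_tangent[OF p e] unfolding N_def by blast
  define M where "M = norm (G p N)"
  define m where "m = norm (G p e)"
  have p0: "p \<in> closure \<Omega> - {0}" "p \<noteq> 0" using frontierD[OF p] by auto
  \<comment> \<open>For the increment \<Delta> of g from p to the exit point q', equal lengths give
    2 g p . \<Delta> = - |\<Delta>|^2, while \<Delta> is t G p e up to an error t (4 \<epsilon> + M
    K t). Dividing by t and letting t tend to 0 leaves the claim.\<close>
  have bound: "2 * \<bar>\<alpha>\<bar> * \<bar>G p e \<bullet> N\<bar> \<le> 8 * \<bar>\<alpha>\<bar> * \<epsilon>" if \<epsilon>: "0 < \<epsilon>" for \<epsilon>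
  proof -
    obtain \<delta> where \<delta>: "\<delta> > 0" "\<And>x h. x \<in> closure \<Omega> - {0} \<Longrightarrow> dist x p < \<delta> \<Longrightarrow> norm (G x h - G p h) \<le> \<epsilon> * norm h"
      using G_near[OF p0(1) \<epsilon>] by blast
    \<comment> \<open>Keeps K t below 1, and keeps the path, which stays within 2 t of p, inside the
      \<delta>-neighbourhood and away from 0.\<close>
    define T where "T = min (1 / K) (min \<delta> (norm p) / 2)"
    have T: "T > 0" using K(1) \<delta>(1) p0(2) by (simp add: T_def)
    have "2 * \<bar>\<alpha>\<bar> * \<bar>G p e \<bullet> N\<bar> \<le> 2 * \<bar>\<alpha>\<bar> * (4 * \<epsilon> + M * K * t) + t * (m + 4 * \<epsilon> + M * K * t)\<^sup>2"
      if t: "0 < t" "t < T" for t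
    proof -
      have Kt: "K * t < 1" using t K(1) by (simp add: T_def field_simps)
      have t2: "2 * t < \<delta>" "2 * t < norm p" using t by (auto simp: T_def)
      define d where "d = e - (K * t) *\<^sub>R N"
      obtain s where s: "0 < s" "s \<le> 2 * K * t\<^sup>2" "p + t *\<^sub>R d + s *\<^sub>R N \<in> frontier \<Omega>"
        "\<And>r. 0 < r \<Longrightarrow> r \<le> t \<Longrightarrow> p + r *\<^sub>R d \<in> \<Omega>"
        "\<And>r. 0 \<le> r \<Longrightarrow> r < s \<Longrightarrow> p + t *\<^sub>R d + r *\<^sub>R N \<in> \<Omega>"
        using K(2)[OF t(1) Kt] unfolding d_def[symmetric] by blast
      define q where "q = p + t *\<^sub>R d"
      define q' where "q' = q + s *\<^sub>R N"
      have Kt2: "K * t\<^sup>2 \<le> t" using mult_right_mono[of "K * t" 1 t] Kt t(1) by (simp add: power2_eq_square mult.assoc)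
      have nd: "norm d \<le> 2"
        using norm_triangle_ineq4[of e "(K * t) *\<^sub>R N"] e N K(1) t(1) Kt by (simp add: d_def)
      have c: "\<bar>r - K * t\<^sup>2\<bar> \<le> t" "\<bar>r - K * t\<^sup>2\<bar> \<le> K * t\<^sup>2" if "0 \<le> r" "r \<le> s" for r
        using that s(2) Kt2 K(1) t(1) by auto
      have qr: "q + r *\<^sub>R N - p = t *\<^sub>R e + (r - K * t\<^sup>2) *\<^sub>R N" for r
        by (simp add: q_def d_def algebra_simps power2_eq_square)
      have near1: "norm (p + r *\<^sub>R d - p) \<le> 2 * t" if "0 \<le> r" "r \<le> t" for r
        using that nd mult_mono[of r t "norm d" 2] by simp
      have near2: "norm (q + r *\<^sub>R N - p) \<le> 2 * t" if "0 \<le> r" "r \<le> s" for r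
      proof -
        have "norm (q + r *\<^sub>R N - p) \<le> norm (t *\<^sub>R e) + norm ((r - K * t\<^sup>2) *\<^sub>R N)"
          unfolding qr by (rule norm_triangle_ineq)
        also have "\<dots> \<le> t + t" using c[OF that] e N t by simp
        finally show ?thesis by simp
      qed
      have nz: "x \<noteq> 0 \<and> dist x p < \<delta>" if "norm (x - p) \<le> 2 * t" for x
        using that t2 by (auto simp: dist_norm)
      have E1: "norm (g q - g p - G p (q - p)) \<le> \<epsilon> * norm (q - p)"
      proof (rule g_increment)
        show "p \<in> closure \<Omega> - {0}" by (rule p0)
        have "q \<in> \<Omega>" "q \<noteq> 0" using s(4)[of t] nz[OF near1[of t]] t by (auto simp: q_def)
        then show "q \<in> closure \<Omega> - {0}" using closure_subset by auto
        fix r :: real assume r: "0 < r" "r < 1"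
        have eq: "p + r *\<^sub>R (q - p) = p + (r * t) *\<^sub>R d" by (simp add: q_def)
        have rt: "0 < r * t" "r * t \<le> t" using r t by (auto simp: mult_le_cancel_right1)
        show in1: "p + r *\<^sub>R (q - p) \<in> \<Omega> - {0}"
          unfolding eq using s(4)[OF rt] nz[OF near1[of "r * t"]] rt by auto
        show "norm (G (p + r *\<^sub>R (q - p)) h - G p h) \<le> \<epsilon> * norm h" for h
          using in1 closure_subset[of \<Omega>] nz[OF near1[of "r * t"]] rt unfolding eq by (intro \<delta>(2)) auto
      qed
      have E2: "norm (g q' - g q - G p (q' - q)) \<le> \<epsilon> * norm (q' - q)"
      proof (rule g_increment)
        have "q \<in> \<Omega>" "q \<noteq> 0" using s(4)[of t] nz[OF near1[of t]] t by (auto simp: q_def)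
        then show "q \<in> closure \<Omega> - {0}" using closure_subset by auto
        show "q' \<in> closure \<Omega> - {0}" using frontierD[OF s(3)] by (simp add: q'_def q_def)
        fix r :: real assume r: "0 < r" "r < 1"
        have eq: "q + r *\<^sub>R (q' - q) = q + (r * s) *\<^sub>R N" by (simp add: q'_def)
        have rt: "0 \<le> r * s" "r * s < s" using r s(1) by auto
        show in1: "q + r *\<^sub>R (q' - q) \<in> \<Omega> - {0}"
          unfolding eq using s(5)[OF rt] nz[OF near2[OF rt(1) less_imp_le[OF rt(2)]]] by (simp add: q_def)
        show "norm (G (q + r *\<^sub>R (q' - q)) h - G p h) \<le> \<epsilon> * norm h" for h
          using in1 closure_subset[of \<Omega>] nz[OF near2[OF rt(1) less_imp_le[OF rt(2)]]] unfolding eq by (intro \<delta>(2)) auto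
      qed
      define \<Delta> where "\<Delta> = g q' - g p"
      define E where "E = \<Delta> - t *\<^sub>R G p e"
      \<comment> \<open>The normal component of q' - p, of second order in t.\<close>
      define k where "k = s - K * t\<^sup>2"
      have q'p: "q' - p = t *\<^sub>R e + k *\<^sub>R N" using qr[of s] by (simp add: q'_def k_def)
      have k: "\<bar>k\<bar> \<le> K * t\<^sup>2" using c(2)[of s] s(1) by (simp add: k_def)
      have "E = (g q - g p - G p (q - p)) + (g q' - g q - G p (q' - q)) + k *\<^sub>R G p N"
      proof -
        have "G p (q - p) + G p (q' - q) = G p (q' - p)"
          by (simp add: linear_add[OF G_linear, symmetric])
        also have "\<dots> = t *\<^sub>R G p e + k *\<^sub>R G p N"
          unfolding q'p by (simp add: linear_add[OF G_linear] linear_cmul[OF G_linear])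
        finally show ?thesis by (simp add: E_def \<Delta>_def algebra_simps)
      qed
      then have "norm E \<le> norm ((g q - g p - G p (q - p)) + (g q' - g q - G p (q' - q))) + norm (k *\<^sub>R G p N)"
        by (simp only: norm_triangle_ineq)
      also have "\<dots> \<le> (norm (g q - g p - G p (q - p)) + norm (g q' - g q - G p (q' - q))) + norm (k *\<^sub>R G p N)"
        by (intro add_mono norm_triangle_ineq order_refl)
      also have "\<dots> \<le> (\<epsilon> * (2 * t) + \<epsilon> * (2 * t)) + (K * t\<^sup>2) * M"
      proof (intro add_mono)
        have "norm (q - p) \<le> 2 * t" using near1[of t] t by (simp add: q_def)
        then show "norm (g q - g p - G p (q - p)) \<le> \<epsilon> * (2 * t)"
          by (intro order_trans[OF E1] mult_left_mono) (use \<epsilon> in auto)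
        have "norm (q' - q) \<le> 2 * t" using s(1,2) Kt2 N by (simp add: q'_def)
        then show "norm (g q' - g q - G p (q' - q)) \<le> \<epsilon> * (2 * t)"
          by (intro order_trans[OF E2] mult_left_mono) (use \<epsilon> in auto)
        show "norm (k *\<^sub>R G p N) \<le> (K * t\<^sup>2) * M" using k by (simp add: M_def mult_right_mono)
      qed
      finally have E: "norm E \<le> t * (4 * \<epsilon> + M * K * t)" by (simp add: algebra_simps power2_eq_square)
      have \<Delta>E: "\<Delta> = t *\<^sub>R G p e + E" by (simp add: E_def)
      have \<Delta>: "norm \<Delta> \<le> t * (m + 4 * \<epsilon> + M * K * t)"
        using norm_triangle_ineq[of "t *\<^sub>R G p e" E] E t(1) unfolding \<Delta>E[symmetric] by (simp add: m_def algebra_simps)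
      have gq: "norm (g q') = norm (g p)"
        using g_boundary[OF s(3)] norm_nu[OF s(3)] by (simp add: gp N q'_def q_def)
      have "(norm (g q'))\<^sup>2 = (norm (g p))\<^sup>2 + 2 * (g p \<bullet> \<Delta>) + (norm \<Delta>)\<^sup>2"
        by (simp add: \<Delta>_def power2_norm_eq_inner inner_diff_left inner_diff_right inner_commute)
      then have "2 * (g p \<bullet> \<Delta>) = - (norm \<Delta>)\<^sup>2" using gq by simp
      moreover have "g p \<bullet> \<Delta> = \<alpha> * (t * (G p e \<bullet> N) + N \<bullet> E)"
        unfolding gp by (subst \<Delta>E) (simp add: inner_add_right inner_commute[of N "G p e"] distrib_left mult_ac)
      ultimately have "2 * \<alpha> * t * (G p e \<bullet> N) = - (norm \<Delta>)\<^sup>2 - 2 * (\<alpha> * (N \<bullet> E))"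
        by (simp add: distrib_left mult_ac)
      moreover have "\<bar>- (norm \<Delta>)\<^sup>2 - 2 * (\<alpha> * (N \<bullet> E))\<bar> \<le> \<bar>- (norm \<Delta>)\<^sup>2\<bar> + \<bar>2 * (\<alpha> * (N \<bullet> E))\<bar>"
        by (rule abs_triangle_ineq4)
      ultimately have "\<bar>2 * \<alpha> * t * (G p e \<bullet> N)\<bar> \<le> (norm \<Delta>)\<^sup>2 + 2 * (\<bar>\<alpha>\<bar> * \<bar>N \<bullet> E\<bar>)"
        by (simp add: abs_mult)
      also have "\<dots> \<le> (t * (m + 4 * \<epsilon> + M * K * t))\<^sup>2 + 2 * (\<bar>\<alpha>\<bar> * (t * (4 * \<epsilon> + M * K * t)))"
        using \<Delta> E Cauchy_Schwarz_ineq2[of N E] N by (intro add_mono power_mono mult_left_mono) auto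
      also have "\<dots> = t * (2 * \<bar>\<alpha>\<bar> * (4 * \<epsilon> + M * K * t) + t * (m + 4 * \<epsilon> + M * K * t)\<^sup>2)"
        by (simp add: algebra_simps power2_eq_square)
      finally have "t * (2 * \<bar>\<alpha>\<bar> * \<bar>G p e \<bullet> N\<bar>) \<le> t * (2 * \<bar>\<alpha>\<bar> * (4 * \<epsilon> + M * K * t) + t * (m + 4 * \<epsilon> + M * K * t)\<^sup>2)"
        using t(1) by (simp add: abs_mult mult_ac)
      then show ?thesis using t(1) by simp
    qed
    then have ev: "\<forall>\<^sub>F t in at_right 0. 2 * \<bar>\<alpha>\<bar> * \<bar>G p e \<bullet> N\<bar> \<le> 2 * \<bar>\<alpha>\<bar> * (4 * \<epsilon> + M * K * t) + t * (m + 4 * \<epsilon> + M * K * t)\<^sup>2"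
      unfolding eventually_at_right_field using T by (intro exI[of _ T]) auto
    have "((\<lambda>t. 2 * \<bar>\<alpha>\<bar> * (4 * \<epsilon> + M * K * t) + t * (m + 4 * \<epsilon> + M * K * t)\<^sup>2) \<longlongrightarrow>
      2 * \<bar>\<alpha>\<bar> * (4 * \<epsilon> + M * K * 0) + 0 * (m + 4 * \<epsilon> + M * K * 0)\<^sup>2) (at_right 0)"
      by (intro tendsto_intros)
    from tendsto_lowerbound[OF this ev] show ?thesis by simp
  qed
  have "\<not> 0 < \<bar>G p e \<bullet> N\<bar>"
  proof
    assume "0 < \<bar>G p e \<bullet> N\<bar>"
    from bound[of "\<bar>G p e \<bullet> N\<bar> / 8"] this alpha_neg show False by simp
  qed
  then show ?thesis by (simp add: N_def)
qed

end

section \<open>Comparison with the reflected solution\<close>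

context overdetermined
begin

definition cap_ok :: "'a \<Rightarrow> real \<Rightarrow> bool" where
  "cap_ok e l \<longleftrightarrow> (\<forall>x\<in>\<Omega>. l < x \<bullet> e \<longrightarrow> reflect e l x \<in> \<Omega>)"

context
  fixes e :: 'a and l :: real
  assumes e: "norm e = 1" and l: "0 < l" and cap: "cap_ok e l"
begin

lemma reflect_zero: "reflect e l 0 = (2 * l) *\<^sub>R e"
  by (simp add: reflect_def)

lemma reflect_eq_zero: "reflect e l x = 0 \<longleftrightarrow> x = (2 * l) *\<^sub>R e"
  using reflect_reflect[OF e] reflect_zero by metis

lemma reflect_cap: "x \<in> \<Omega> \<Longrightarrow> l < x \<bullet> e \<Longrightarrow> reflect e l x \<in> \<Omega>"
  using cap by (simp add: cap_ok_def)

lemma cap_nonzero: "l < x \<bullet> e \<Longrightarrow> x \<noteq> 0"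
  using l by auto

lemma reflected_laplacian:
  assumes "x \<in> \<Omega> - {0}" "reflect e l x \<in> \<Omega> - {0}"
  shows "has_laplacian (\<lambda>x. u (reflect e l x) - u x) x 0"
  using has_laplacian_diff[OF has_laplacian_reflect[OF e u_laplacian[OF assms(2)]] u_laplacian[OF assms(1)]]
  by simp

lemma open_cap: "open (\<Omega> \<inter> {x. l < x \<bullet> e})"
  by (intro open_Int open_Omega open_Collect_less continuous_intros)

lemma u_le_reflected:
  assumes x: "x \<in> \<Omega>" "l < x \<bullet> e" "x \<noteq> (2 * l) *\<^sub>R e"
  shows "u x \<le> u (reflect e l x)"
proof -
  define q where "q = (2 * l) *\<^sub>R e"
  define S where "S = \<Omega> \<inter> {x. l < x \<bullet> e}"
  have oS: "open S" unfolding S_def by (rule open_cap)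
  have SD: "y \<in> \<Omega> - {0}" "reflect e l y \<in> \<Omega>" if "y \<in> S" for y
    using that cap_nonzero reflect_cap by (auto simp: S_def)
  have Sq: "reflect e l y \<in> \<Omega> - {0}" if "y \<in> S" "y \<noteq> q" for y
    using that SD(2) reflect_eq_zero by (auto simp: q_def)
  have "0 \<le> u (reflect e l x) - u x"
  \<comment> \<open>Near q the reflected value is positive and u is below u q + 1, hence the choice
    of m.\<close>
  proof (rule weak_minimum_principle_punctured[OF dim, where S = S and q = q and m = "- u q - 1"])
    show "open S" by (rule oS)
    show "bounded S" using bounded_Omega by (auto simp: S_def intro: bounded_subset)
    show "x \<in> S" "x \<noteq> q" using x by (auto simp: S_def q_def)
    show "\<exists>L\<le>0. has_laplacian (\<lambda>x. u (reflect e l x) - u x) y L" if "y \<in> S" "y \<noteq> q" for y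
      using reflected_laplacian[OF SD(1) Sq] that by blast
    show "\<forall>\<^sub>F y in at q. - u q - 1 \<le> u (reflect e l y) - u y" if q: "q \<in> S"
    proof -
      have "isCont u q" using SD(1)[OF q] u_deriv has_derivative_continuous by blast
      then have "\<forall>\<^sub>F y in at q. u y < u q + 1" by (auto simp: isCont_def intro: order_tendstoD)
      moreover have "\<forall>\<^sub>F y in at q. y \<in> S" using q oS by (auto simp: eventually_at_topological)
      moreover have "\<forall>\<^sub>F y in at q. y \<noteq> q" by (simp add: eventually_at_filter)
      ultimately show ?thesis
      proof eventually_elim
        case (elim y)
        then show ?case using u_pos[OF Sq[of y]] by simp
      qed
    qed
    show "\<forall>\<^sub>F y in at p within S. - \<epsilon> < u (reflect e l y) - u y" if p: "p \<in> frontier S" and \<epsilon>: "0 < \<epsilon>" for p \<epsilon>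
    proof -
      have pS: "p \<in> closure S" "p \<notin> S" using p oS by (auto simp: frontier_def interior_open)
      have pc: "p \<in> closure \<Omega>" using pS(1) closure_mono[of S \<Omega>] by (auto simp: S_def)
      have "closure S \<subseteq> {x. l \<le> x \<bullet> e}"
        by (rule closure_minimal) (auto simp: S_def intro!: closed_Collect_le continuous_intros)
      then have pl: "l \<le> p \<bullet> e" using pS(1) by blast
      then have p0: "p \<noteq> 0" using l by auto
      have "(u \<longlongrightarrow> u p) (at p within closure \<Omega> - {0})"
        using u_cont pc p0 by (auto simp: continuous_on)
      then have up: "(u \<longlongrightarrow> u p) (at p within S)"
        by (rule tendsto_within_subset) (use SD(1) closure_subset[of \<Omega>] in auto)
      have inS: "\<forall>\<^sub>F y in at p within S. y \<in> S" by (simp add: eventually_at_filter)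
      show ?thesis
      proof (cases "p \<bullet> e = l")
        case True
        \<comment> \<open>On the plane both terms tend to u p; since l > 0, the plane avoids the
          singularity at 0.\<close>
        have rp: "reflect e l p = p" by (rule reflect_fix[OF e True])
        have pq: "p \<noteq> q" using reflect_eq_zero[of p] rp p0 by (auto simp: q_def)
        have "((\<lambda>y. u (reflect e l y)) \<longlongrightarrow> u p) (at p within S)"
        proof (rule filterlim_compose[where g = u and f = "reflect e l"])
          show "(u \<longlongrightarrow> u p) (at p within closure \<Omega> - {0})"
            using u_cont pc p0 by (auto simp: continuous_on)
          show "filterlim (reflect e l) (at p within closure \<Omega> - {0}) (at p within S)"
            unfolding filterlim_at
          proof
            have "(reflect e l \<longlongrightarrow> reflect e l p) (at p within S)"
              using continuous_reflect[OF e] by (auto simp: isCont_def intro: tendsto_within_subset)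
            then show "(reflect e l \<longlongrightarrow> p) (at p within S)" by (simp add: rp)
            have "\<forall>\<^sub>F y in at p within S. y \<noteq> q" using pq by (auto intro: eventually_neq_at_within)
            then show "\<forall>\<^sub>F y in at p within S. reflect e l y \<in> closure \<Omega> - {0} \<and> reflect e l y \<noteq> p"
              using inS
            proof eventually_elim
              case (elim y)
              have "reflect e l y \<bullet> e < l" using elim by (simp add: reflect_inner[OF e] S_def)
              then have "reflect e l y \<noteq> p" using True by auto
              then show ?case using Sq[of y] elim closure_subset[of \<Omega>] by auto
            qed
          qed
        qed
        then have "((\<lambda>y. u (reflect e l y) - u y) \<longlongrightarrow> u p - u p) (at p within S)"
          using up by (rule tendsto_diff)
        then show ?thesis by (rule order_tendstoD) (use \<epsilon> in simp)
      next
        case False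
        \<comment> \<open>Off the plane p is a boundary point and u tends to 0. Its mirror image may
          be another boundary point or the origin, so only the positivity of the reflected value is
          used.\<close>
        then have "p \<notin> \<Omega>" using pl pS(2) by (auto simp: S_def)
        then have "u p = 0" using pc by (intro u_zero frontierI)
        then have "\<forall>\<^sub>F y in at p within S. u y < \<epsilon>" using up \<epsilon> by (intro order_tendstoD) auto
        moreover have "\<forall>\<^sub>F y in at p within S. y \<noteq> q" by (rule eventually_neq_at_within)
        ultimately show ?thesis using inS
        proof eventually_elim
          case (elim y)
          then show ?case using u_pos[OF Sq[of y]] by simp
        qed
      qed
    qed
  qed
  then show ?thesis by simp
qed

text \<open>Unique continuation is obtained from the strong minimum principle on each side of the hyperplane:
  this set is open and closed in the connected set \<open>\<Omega> - {0, 2 l e}\<close>, so it is empty or everything.\<close>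

definition symmetric_points :: "'a set" where
  "symmetric_points = {z \<in> \<Omega> - {0, (2 * l) *\<^sub>R e}. \<forall>\<^sub>F y in nhds z. reflect e l y \<in> \<Omega> \<and> u (reflect e l y) = u y}"

lemma open_symmetric_points: "open symmetric_points"
proof -
  have "\<forall>\<^sub>F z in nhds x. z \<in> symmetric_points" if x: "x \<in> symmetric_points" for x
  proof -
    have "open (\<Omega> - {0, (2 * l) *\<^sub>R e})" using open_Omega by (intro open_Diff) auto
    then have "\<forall>\<^sub>F z in nhds x. z \<in> \<Omega> - {0, (2 * l) *\<^sub>R e}"
      using x by (intro eventually_nhds_in_open) (auto simp: symmetric_points_def)
    moreover have "\<forall>\<^sub>F z in nhds x. \<forall>\<^sub>F y in nhds z. reflect e l y \<in> \<Omega> \<and> u (reflect e l y) = u y"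
      using x by (simp add: symmetric_points_def eventually_eventually)
    ultimately show ?thesis by eventually_elim (simp add: symmetric_points_def)
  qed
  then show ?thesis by (subst open_subopen) (fastforce simp: eventually_nhds)
qed

text \<open>Half of a small ball is convex, hence connected, which the cap need not be; there the
  strong minimum principle spreads a single equality.\<close>

lemma convex_cap_ball:
  assumes "ball z \<rho> \<subseteq> \<Omega> - {0, (2 * l) *\<^sub>R e}" and "\<And>y. y \<in> ball z \<rho> \<Longrightarrow> reflect e l y \<in> \<Omega>"
    and y: "y \<in> ball z \<rho>" "l < y \<bullet> e" "u (reflect e l y) = u y"
    and x: "x \<in> ball z \<rho>" "l < x \<bullet> e"
  shows "u (reflect e l x) = u x"
proof -
  define S where "S = ball z \<rho> \<inter> {x. l < x \<bullet> e}"
  have "u (reflect e l x) - u x = 0"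
  proof (rule strong_minimum_principle[where S = S])
    show "open S" unfolding S_def by (intro open_Int open_ball open_Collect_less continuous_intros)
    have "convex {x. l < x \<bullet> e}"
      using convex_halfspace_gt[of l e] by (simp add: inner_commute)
    then show "connected S" unfolding S_def by (intro convex_connected convex_Int convex_ball)
    show "y \<in> S" "u (reflect e l y) - u y = 0" "x \<in> S" using x y by (auto simp: S_def)
    fix p assume p: "p \<in> S"
    have 1: "p \<in> \<Omega> - {0}" "p \<noteq> (2 * l) *\<^sub>R e" "l < p \<bullet> e" using p assms(1) l by (auto simp: S_def)
    have 2: "reflect e l p \<in> \<Omega> - {0}" using p assms(2) 1 reflect_eq_zero by (auto simp: S_def)
    show "\<exists>L\<le>0. has_laplacian (\<lambda>x. u (reflect e l x) - u x) p L"
      using reflected_laplacian[OF 1(1) 2] by blast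
    show "0 \<le> u (reflect e l p) - u p" using u_le_reflected[of p] 1 by simp
  qed
  then show ?thesis by simp
qed

text \<open>At a limit point z the equality persists, and u z > 0 keeps the mirror image off the
  boundary, where u is 0. One equality in a small ball around z then spreads over the ball: directly
  on the side x . e > l, and through the mirror image on the other side.\<close>

lemma symmetric_points_closed:
  assumes z: "z \<in> \<Omega> - {0, (2 * l) *\<^sub>R e}" "z \<in> closure symmetric_points"
  shows "z \<in> symmetric_points"
proof -
  define q where "q = (2 * l) *\<^sub>R e"
  obtain a where a: "\<And>n. a n \<in> symmetric_points" "a \<longlonglongrightarrow> z"
    using z(2) unfolding closure_sequential by blast
  have a': "a n \<in> \<Omega> - {0, q}" "reflect e l (a n) \<in> \<Omega>" "u (reflect e l (a n)) = u (a n)" for n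
    using a(1)[of n] by (auto simp: symmetric_points_def q_def dest: eventually_nhds_x_imp_x)
  have ra: "(\<lambda>n. reflect e l (a n)) \<longlonglongrightarrow> reflect e l z"
    using continuous_reflect[OF e] a(2) by (rule isCont_tendsto_compose)
  have "reflect e l z \<in> closure \<Omega>" using ra a'(2) unfolding closure_sequential
    by (intro exI[of _ "\<lambda>n. reflect e l (a n)"]) simp
  then have rz: "reflect e l z \<in> closure \<Omega> - {0}" using z(1) reflect_eq_zero by auto
  have "(\<lambda>n. u (reflect e l (a n))) \<longlonglongrightarrow> u (reflect e l z)"
  proof (rule continuous_on_tendsto_compose[OF u_cont ra rz])
    show "\<forall>\<^sub>F n in sequentially. reflect e l (a n) \<in> closure \<Omega> - {0}"
      using a' reflect_eq_zero closure_subset[of \<Omega>] by (auto simp: q_def intro!: always_eventually)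
  qed
  moreover have "(\<lambda>n. u (a n)) \<longlonglongrightarrow> u z"
    using z(1) u_deriv[of z] has_derivative_continuous a(2) by (blast intro: isCont_tendsto_compose)
  ultimately have "u (reflect e l z) = u z" using a'(3) by (simp add: LIMSEQ_unique)
  then have "u (reflect e l z) \<noteq> 0" using u_pos[of z] z(1) by auto
  then have rzO: "reflect e l z \<in> \<Omega>" using rz frontierI u_zero by blast
  define A where "A = (\<Omega> - {0, q}) \<inter> reflect e l -` \<Omega>"
  have "open A" unfolding A_def
    using open_Omega continuous_reflect[OF e]
    by (intro open_Int open_Diff open_vimage) (auto intro: continuous_at_imp_continuous_on)
  moreover have "z \<in> A" using z(1) rzO by (simp add: A_def q_def)
  ultimately obtain \<rho>0 where \<rho>0: "\<rho>0 > 0" "ball z \<rho>0 \<subseteq> A" using open_contains_ball by blast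
  \<comment> \<open>The ball lies on one side of the plane unless z is on it; in that case the ball
    is invariant under the reflection.\<close>
  define \<rho> where "\<rho> = (if z \<bullet> e = l then \<rho>0 else min \<rho>0 \<bar>z \<bullet> e - l\<bar>)"
  have \<rho>: "\<rho> > 0" "ball z \<rho> \<subseteq> A" using \<rho>0 by (auto simp: \<rho>_def)
  have Aq: "y \<in> \<Omega> - {0, q}" "reflect e l y \<in> \<Omega> - {0, q}" if "y \<in> ball z \<rho>" for y
  proof -
    have y: "y \<in> \<Omega> - {0, q}" "reflect e l y \<in> \<Omega>" using subsetD[OF \<rho>(2) that] by (auto simp: A_def)
    show "y \<in> \<Omega> - {0, q}" by fact
    have "reflect e l y \<noteq> q" using y(1) reflect_reflect[OF e, of l y] reflect_eq_zero[of q] by (auto simp: q_def)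
    then show "reflect e l y \<in> \<Omega> - {0, q}" using y reflect_eq_zero by (auto simp: q_def)
  qed
  have right: "u (reflect e l x) = u x"
    if "y \<in> ball z \<rho>" "l < y \<bullet> e" "u (reflect e l y) = u y" "x \<in> ball z \<rho>" "l < x \<bullet> e" for x y
  proof (rule convex_cap_ball[of z \<rho> y x])
    show "ball z \<rho> \<subseteq> \<Omega> - {0, (2 * l) *\<^sub>R e}" using Aq(1) unfolding q_def by blast
  qed (use Aq that in auto)
  have refl_ball: "reflect e l y \<in> ball (reflect e l z) \<rho>" if "y \<in> ball z \<rho>" for y
    using that by (simp add: dist_reflect[OF e])
  have left: "u (reflect e l x) = u x"
    if "y \<in> ball z \<rho>" "y \<bullet> e < l" "u (reflect e l y) = u y" "x \<in> ball z \<rho>" "x \<bullet> e < l" for x y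
  proof -
    have in_ball: "reflect e l p \<in> ball z \<rho>" if "p \<in> ball (reflect e l z) \<rho>" for p
      using that dist_reflect[OF e, of l "reflect e l z" p] by (simp add: reflect_reflect[OF e])
    have "u (reflect e l (reflect e l x)) = u (reflect e l x)"
    proof (rule convex_cap_ball[of "reflect e l z" \<rho> "reflect e l y" "reflect e l x"])
      show "ball (reflect e l z) \<rho> \<subseteq> \<Omega> - {0, (2 * l) *\<^sub>R e}"
      proof
        fix p assume "p \<in> ball (reflect e l z) \<rho>"
        from Aq(2)[OF in_ball[OF this]] show "p \<in> \<Omega> - {0, (2 * l) *\<^sub>R e}"
          by (simp add: reflect_reflect[OF e] q_def)
      qed
      show "reflect e l p \<in> \<Omega>" if "p \<in> ball (reflect e l z) \<rho>" for p using Aq(1)[OF in_ball[OF that]] by simp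
    qed (use that refl_ball in \<open>auto simp: reflect_reflect[OF e] reflect_inner[OF e]\<close>)
    then show ?thesis by (simp add: reflect_reflect[OF e])
  qed
  obtain n where "a n \<in> ball z \<rho>"
    using a(2) \<rho>(1) unfolding lim_sequentially by (metis dist_commute mem_ball order_refl)
  then obtain y0 where y0: "y0 \<in> ball z \<rho>" "\<forall>\<^sub>F y in nhds y0. u (reflect e l y) = u y"
    using a(1)[of n] by (auto simp: symmetric_points_def elim!: eventually_mono intro: that)
  have zy: "\<bar>y \<bullet> e - z \<bullet> e\<bar> < \<rho>" if "y \<in> ball z \<rho>" for y
    using Cauchy_Schwarz_ineq2[of "y - z" e] that e by (simp add: inner_diff_left dist_norm norm_minus_commute)
  consider "l < z \<bullet> e" | "z \<bullet> e < l" | "z \<bullet> e = l" by linarith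
  then have "\<forall>y\<in>ball z \<rho>. u (reflect e l y) = u y"
  proof cases
    case 1
    then have "l < y \<bullet> e" if "y \<in> ball z \<rho>" for y using zy[OF that] by (auto simp: \<rho>_def)
    then show ?thesis using right[of y0] y0 by (blast dest: eventually_nhds_x_imp_x)
  next
    case 2
    then have "y \<bullet> e < l" if "y \<in> ball z \<rho>" for y using zy[OF that] by (auto simp: \<rho>_def)
    then show ?thesis using left[of y0] y0 by (blast dest: eventually_nhds_x_imp_x)
  next
    case 3
    have fix_z: "reflect e l z = z" by (rule reflect_fix[OF e 3])
    have rb: "reflect e l y \<in> ball z \<rho>" if "y \<in> ball z \<rho>" for y using refl_ball[OF that] by (simp only: fix_z)
    \<comment> \<open>On the plane the equality is trivial and carries no information. It holds in a
      neighbourhood of y0, so y0 can be shifted along e.\<close>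
    obtain y1 where y1: "y1 \<in> ball z \<rho>" "u (reflect e l y1) = u y1" "y1 \<bullet> e \<noteq> l"
    proof (cases "y0 \<bullet> e = l")
      case True
      have "((\<lambda>t. y0 + t *\<^sub>R e) \<longlongrightarrow> y0 + 0 *\<^sub>R e) (at_right 0)" by (intro tendsto_intros)
      then have lim: "filterlim (\<lambda>t. y0 + t *\<^sub>R e) (nhds y0) (at_right 0)" by simp
      have "\<forall>\<^sub>F y in nhds y0. y \<in> ball z \<rho> \<and> u (reflect e l y) = u y"
        using y0 by (intro eventually_conj eventually_nhds_in_open) auto
      then have "\<forall>\<^sub>F t in at_right 0. y0 + t *\<^sub>R e \<in> ball z \<rho> \<and> u (reflect e l (y0 + t *\<^sub>R e)) = u (y0 + t *\<^sub>R e)"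
        using lim by (auto simp: filterlim_iff)
      moreover have "\<forall>\<^sub>F t::real in at_right 0. 0 < t" by (simp add: eventually_at_filter)
      ultimately have "\<forall>\<^sub>F t in at_right 0. y0 + t *\<^sub>R e \<in> ball z \<rho> \<and> u (reflect e l (y0 + t *\<^sub>R e)) = u (y0 + t *\<^sub>R e) \<and> 0 < t"
        by eventually_elim blast
      from eventually_happens'[OF trivial_limit_at_right_real this]
      obtain t where "0 < t" "y0 + t *\<^sub>R e \<in> ball z \<rho>" "u (reflect e l (y0 + t *\<^sub>R e)) = u (y0 + t *\<^sub>R e)"
        by blast
      then show ?thesis using True by (intro that[of "y0 + t *\<^sub>R e"]) (auto simp: inner_add_left inner_unit_self[OF e])
    next
      case False
      then show ?thesis using y0 that by (blast dest: eventually_nhds_x_imp_x)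
    qed
    obtain y2 where y2: "y2 \<in> ball z \<rho>" "u (reflect e l y2) = u y2" "l < y2 \<bullet> e"
    proof (cases "l < y1 \<bullet> e")
      case False
      then show ?thesis
        using y1 rb[OF y1(1)]
        by (intro that[of "reflect e l y1"]) (simp_all add: reflect_reflect[OF e] reflect_inner[OF e])
    next
      case True
      then show ?thesis using y1(1,2) by (rule that[rotated 2])
    qed
    show ?thesis
    proof
      fix y assume y: "y \<in> ball z \<rho>"
      consider "l < y \<bullet> e" | "y \<bullet> e < l" | "y \<bullet> e = l" by linarith
      then show "u (reflect e l y) = u y"
      proof cases
        case 1
        then show ?thesis using right[of y2 y] y2 y by blast
      next
        case 2
        then have "u (reflect e l (reflect e l y)) = u (reflect e l y)"
          using right[of y2 "reflect e l y"] y2 rb[OF y] by (auto simp: reflect_inner[OF e])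
        then show ?thesis by (simp add: reflect_reflect[OF e])
      next
        case 3
        then show ?thesis by (simp add: reflect_fix[OF e])
      qed
    qed
  qed
  then have "\<forall>\<^sub>F y in nhds z. reflect e l y \<in> \<Omega> \<and> u (reflect e l y) = u y"
    using Aq(2) \<rho>(1) unfolding eventually_nhds by (intro exI[of _ "ball z \<rho>"]) auto
  then show ?thesis using z(1) by (simp add: symmetric_points_def)
qed

text \<open>Otherwise the set is all of \<Omega> without 0 and q = 2 l e. Then a punctured ball
  around q lies in \<Omega>, hence also q, and near 0 the function u is the mirror image of u near
  the regular point q. So u would extend to 0 with a continuous gradient, contrary to
  \<open>singular\<close>.\<close>

lemma symmetric_points_empty: "symmetric_points = {}"
proof (rule ccontr)
  define q where "q = (2 * l) *\<^sub>R e"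
  have q0: "q \<noteq> 0" using e l by (auto simp: q_def)
  assume ne: "symmetric_points \<noteq> {}"
  have "connected (\<Omega> - {0, q})"
    by (rule connected_open_diff_countable[OF dim open_Omega connected_Omega]) simp
  moreover have sub: "symmetric_points \<subseteq> \<Omega> - {0, q}" by (auto simp: symmetric_points_def q_def)
  moreover have "openin (top_of_set (\<Omega> - {0, q})) symmetric_points"
    using open_symmetric_points sub by (auto simp: openin_open)
  moreover have "closedin (top_of_set (\<Omega> - {0, q})) symmetric_points"
    using symmetric_points_closed sub closure_subset[of symmetric_points] unfolding closedin_closed q_def
    by (intro exI[of _ "closure symmetric_points"]) auto
  ultimately have "symmetric_points = \<Omega> - {0, q}" using ne by (auto simp: connected_clopen)
  then have sym: "\<forall>\<^sub>F y in nhds z. reflect e l y \<in> \<Omega> \<and> u (reflect e l y) = u y" if "z \<in> \<Omega> - {0, q}" for z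
    using that unfolding \<open>symmetric_points = \<Omega> - {0, q}\<close>[symmetric] by (simp add: symmetric_points_def)
  then have sym': "reflect e l z \<in> \<Omega>" "u (reflect e l z) = u z" if "z \<in> \<Omega> - {0, q}" for z
    using that by (auto dest: eventually_nhds_x_imp_x)
  have "open (\<Omega> - {q})" using open_Omega by (rule open_delete)
  then obtain \<rho> where \<rho>: "\<rho> > 0" "ball 0 \<rho> \<subseteq> \<Omega> - {q}" using q0 zero_in_Omega open_contains_ball by blast
  have rq: "reflect e l q = 0" "reflect e l 0 = q" using reflect_eq_zero[of q] reflect_zero by (auto simp: q_def)
  have ball_q: "y \<in> \<Omega>" if "y \<in> ball q \<rho>" "y \<noteq> q" for y
  proof -
    have "reflect e l y \<in> ball 0 \<rho>" using that dist_reflect[OF e, of l q y] by (simp add: rq)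
    moreover have "reflect e l y \<noteq> 0" using that reflect_eq_zero by (auto simp: q_def)
    ultimately have "reflect e l y \<in> \<Omega> - {0, q}" using \<rho>(2) by blast
    from sym'(1)[OF this] show ?thesis by (simp add: reflect_reflect[OF e])
  qed
  have "ball q \<rho> \<subseteq> closure \<Omega>"
  proof
    fix y assume y: "y \<in> ball q \<rho>"
    show "y \<in> closure \<Omega>"
    proof (cases "y = q")
      case True
      have "q islimpt (ball q \<rho>)" by (rule interior_limit_point) (use \<rho> in simp)
      then have "q islimpt (\<Omega>)" unfolding islimpt_approachable
        using \<rho>(1) ball_q by (metis (no_types, lifting) dist_commute mem_ball) 
      then show ?thesis using True by (simp add: closure_def)
    qed (use ball_q[OF y] closure_subset in auto)
  qed
  then have "ball q \<rho> \<subseteq> \<Omega>" by (intro open_subset_closure) auto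
  then have qO: "q \<in> \<Omega> - {0}" using \<rho>(1) q0 by auto
  \<comment> \<open>The value at 0 is taken from the mirror image q, and so is the reflected
    gradient below.\<close>
  define v where "v = (\<lambda>x. if x = 0 then u q else u x)"
  define g' where "g' = (\<lambda>x. if x = 0 then lreflect e (g q) else g x)"
  have vr: "v x = u (reflect e l x)" if "x \<in> ball 0 \<rho>" for x
    using sym'(2)[of x] subsetD[OF \<rho>(2) that] by (auto simp: v_def rq)
  have rd: "((\<lambda>x. u (reflect e l x)) has_derivative (\<lambda>h. lreflect e (g (reflect e l x)) \<bullet> h)) (at x)"
    if "x \<in> ball 0 \<rho>" for x
  proof -
    have "reflect e l x \<in> \<Omega> - {0}"
      using subsetD[OF \<rho>(2) that] sym'(1)[of x] qO rq reflect_eq_zero[of x] by (cases "x = 0") (auto simp: q_def)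
    from has_derivative_compose[OF reflect_has_derivative u_deriv[OF this]]
    show ?thesis by (simp add: lreflect_inner)
  qed
  have vd0: "(v has_derivative (\<lambda>h. lreflect e (g (reflect e l x)) \<bullet> h)) (at x)" if "x \<in> ball 0 \<rho>" for x
    by (rule has_derivative_transform_within_open[OF rd[OF that] open_ball that]) (simp add: vr)
  have vd1: "(v has_derivative (\<lambda>h. g x \<bullet> h)) (at x)" if "x \<in> \<Omega> - {0}" for x
    by (rule has_derivative_transform_within_open[OF u_deriv[OF that] open_punctured that]) (simp add: v_def)
  have g'r: "g' x = lreflect e (g (reflect e l x))" if x: "x \<in> ball 0 \<rho>" for x
  proof (cases "x = 0")
    case False
    then have "x \<in> \<Omega> - {0}" using subsetD[OF \<rho>(2) x] by simp
    from has_derivative_unique[OF vd1[OF this] vd0[OF x]]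
    have "g x \<bullet> h = lreflect e (g (reflect e l x)) \<bullet> h" for h by metis
    then have "g x = lreflect e (g (reflect e l x))" by (metis vector_eq_rdot)
    then show ?thesis using False by (simp add: g'_def)
  qed (simp add: g'_def rq)
  have gc: "isCont g x" if "x \<in> \<Omega> - {0}" for x
    using g_deriv[OF that] has_derivative_continuous by blast
  show False
  proof (rule singular[of v g'])
    fix x assume x: "x \<in> \<Omega>"
    show "(v has_derivative (\<lambda>h. g' x \<bullet> h)) (at x)"
      using vd0[of x] vd1[of x] g'r[of x] x \<rho>(1) by (cases "x = 0") (auto simp: g'_def)
  next
    have "isCont g' x" if x: "x \<in> \<Omega>" for x
    proof (cases "x = 0")
      case True
      have "isCont (\<lambda>x. g (reflect e l x)) 0"
        by (rule isCont_o2[OF continuous_reflect[OF e]]) (simp add: rq gc[OF qO])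
      then have "isCont (\<lambda>x. lreflect e (g (reflect e l x))) 0"
        by (rule bounded_linear.isCont[OF linear_conv_bounded_linear[THEN iffD1, OF linear_lreflect]])
      moreover have "\<forall>\<^sub>F x in nhds 0. lreflect e (g (reflect e l x)) = g' x"
        using \<rho>(1) g'r unfolding eventually_nhds by (intro exI[of _ "ball 0 \<rho>"] conjI ballI) simp_all
      ultimately show ?thesis unfolding True by (simp add: isCont_cong)
    next
      case False
      have "\<forall>\<^sub>F y in nhds x. g y = g' y"
        using False x open_punctured unfolding eventually_nhds
        by (intro exI[of _ "\<Omega> - {0}"]) (auto simp: g'_def)
      from isCont_cong[OF this] show ?thesis using gc[of x] False x by blast
    qed
    then show "continuous_on \<Omega> g'" by (simp add: continuous_at_imp_continuous_on)
  qed (simp add: v_def)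
qed

text \<open>Equality at one point would spread over a ball in the cap and make x a symmetric
  point.\<close>

lemma u_less_reflected:
  assumes x: "x \<in> \<Omega>" "l < x \<bullet> e" "x \<noteq> (2 * l) *\<^sub>R e"
  shows "u x < u (reflect e l x)"
proof (rule ccontr)
  assume "\<not> u x < u (reflect e l x)"
  then have eq: "u (reflect e l x) = u x" using u_le_reflected[OF x] by simp
  have "open ((\<Omega> \<inter> {x. l < x \<bullet> e}) - {(2 * l) *\<^sub>R e})" using open_cap by (rule open_delete)
  then obtain \<rho> where \<rho>: "\<rho> > 0" "ball x \<rho> \<subseteq> (\<Omega> \<inter> {x. l < x \<bullet> e}) - {(2 * l) *\<^sub>R e}"
    using x open_contains_ball by (metis (no_types, lifting) DiffI IntI empty_iff insert_iff mem_Collect_eq)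
  have b: "y \<in> \<Omega> - {0, (2 * l) *\<^sub>R e}" "l < y \<bullet> e" "reflect e l y \<in> \<Omega>" if "y \<in> ball x \<rho>" for y
    using that \<rho>(2) cap_nonzero[of y] reflect_cap[of y] by blast+
  have "u (reflect e l y) = u y" if "y \<in> ball x \<rho>" for y
  proof (rule convex_cap_ball[of x \<rho> x y])
    show "ball x \<rho> \<subseteq> \<Omega> - {0, (2 * l) *\<^sub>R e}" using b(1) by blast
  qed (use b eq that \<rho>(1) x in auto)
  then have "\<forall>\<^sub>F y in nhds x. reflect e l y \<in> \<Omega> \<and> u (reflect e l y) = u y"
    using b(3) \<rho>(1) unfolding eventually_nhds by (intro exI[of _ "ball x \<rho>"]) auto
  then have "x \<in> symmetric_points" using b(1)[of x] \<rho>(1) by (simp add: symmetric_points_def)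
  then show False by (simp add: symmetric_points_empty)
qed

end

end

section \<open>The moving plane argument\<close>

context overdetermined
begin

lemma eventually_pos_right: "\<forall>\<^sub>F t::real in at_right 0. 0 < t"
  by (simp add: eventually_at_filter)

text \<open>Shrinking the inner ball while it stays tangent at p lets it avoid the mirror image of 0
  and, off the plane, remain in the cap.\<close>

lemma small_touching_ball:
  assumes p: "p \<in> frontier \<Omega>" and r0: "0 < r0"
  shows "\<exists>r>0. r \<le> r0 \<and> ball (p - r *\<^sub>R \<nu> p) r \<subseteq> \<Omega> \<and> ball (p - r *\<^sub>R \<nu> p) r \<subseteq> ball p (2 * r0)"
proof -
  obtain r where r: "r > 0" "ball (p - r *\<^sub>R \<nu> p) r \<subseteq> \<Omega>" using touching_balls[OF p] by blast
  define s where "s = min r r0"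
  have s: "0 < s" "s \<le> r" "s \<le> r0" using r r0 by (auto simp: s_def)
  have "dist (p - r *\<^sub>R \<nu> p) (p - s *\<^sub>R \<nu> p) = r - s"
  proof -
    have "(p - r *\<^sub>R \<nu> p) - (p - s *\<^sub>R \<nu> p) = (s - r) *\<^sub>R \<nu> p" by (simp add: algebra_simps)
    then show ?thesis using s norm_nu[OF p] by (simp add: dist_norm)
  qed
  then have "ball (p - s *\<^sub>R \<nu> p) s \<subseteq> ball (p - r *\<^sub>R \<nu> p) r" by (subst ball_subset_ball_iff) (simp add: dist_commute)
  moreover have "ball (p - s *\<^sub>R \<nu> p) s \<subseteq> ball p (2 * r0)"
    using s norm_nu[OF p] by (subst ball_subset_ball_iff) (simp add: dist_norm)
  ultimately show ?thesis using s r(2) by blast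
qed

text \<open>The reflected cap lies in \<Omega> and touches its boundary, so the normals at p and at
  its mirror image correspond. Both normal derivatives equal \<alpha>, hence the difference of u and
  its reflection is o(t) along the normal, against the linear growth in the Hopf lemma.\<close>

lemma no_tangency:
  assumes e: "norm e = 1" and l: "0 < l" and cap: "cap_ok e l"
    and p: "p \<in> frontier \<Omega>" "l < p \<bullet> e" and rp: "reflect e l p \<in> frontier \<Omega>"
  shows False
proof -
  define p' where "p' = reflect e l p"
  define N where "N = \<nu> p"
  define M where "M = lreflect e (\<nu> p')"
  have p': "p' \<in> frontier \<Omega>" using rp by (simp add: p'_def)
  have NN: "N \<bullet> N = 1" using nu_nu[OF p(1)] by (simp add: N_def)
  have MM: "M \<bullet> M = 1" using nu_nu[OF p'] by (simp add: M_def lreflect_inner lreflect_lreflect[OF e])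
  have rl: "reflect e l (p + t *\<^sub>R d) = p' + t *\<^sub>R lreflect e d" for t d
    by (simp add: reflect_add p'_def linear_cmul[OF linear_lreflect])
  have incap: "\<forall>\<^sub>F t in at_right 0. l < (p + t *\<^sub>R d) \<bullet> e" for d
  proof -
    have "((\<lambda>t. (p + t *\<^sub>R d) \<bullet> e) \<longlongrightarrow> (p + 0 *\<^sub>R d) \<bullet> e) (at_right 0)" by (intro tendsto_intros)
    then show ?thesis by (rule order_tendstoD) (use p in simp)
  qed
  have "M = N"
  proof (rule ccontr)
    assume ne: "M \<noteq> N"
    have "0 < (M - N) \<bullet> (M - N)" using ne by simp
    then have MN: "M \<bullet> N < 1" using NN MM by (simp add: inner_diff_left inner_diff_right inner_commute)
    \<comment> \<open>If the normals did not correspond, this direction would point inwards at p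
      while its reflection points outwards at p'.\<close>
    define d where "d = M - N"
    have d: "d \<bullet> \<nu> p < 0" using MN NN by (simp add: d_def N_def[symmetric] inner_diff_left)
    have "d \<bullet> M > 0" using MN MM by (simp add: d_def inner_diff_left inner_commute[of N M])
    then have d': "0 < lreflect e d \<bullet> \<nu> p'" by (simp add: M_def lreflect_inner)
    have "\<forall>\<^sub>F t in at_right (0::real). False"
      using inward_ray[OF p(1) d] outward_ray[OF p' d'] incap[of d]
    proof eventually_elim
      case (elim t)
      then have "reflect e l (p + t *\<^sub>R d) \<in> \<Omega>" using cap by (simp add: cap_ok_def)
      then show ?case using elim closure_subset[of \<Omega>] by (auto simp: rl)
    qed
    then show False by simp
  qed
  then have N': "\<nu> p' = lreflect e N" by (metis M_def lreflect_lreflect[OF e])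
  define q where "q = (2 * l) *\<^sub>R e"
  have pq: "p \<noteq> q"
    using reflect_eq_zero[OF e l cap, of p] frontierD[OF p'] by (auto simp: q_def p'_def)
  \<comment> \<open>Keeps the tangent ball on the side x . e > l and away from q.\<close>
  define r0 where "r0 = min ((p \<bullet> e - l) / 2) (dist p q / 2)"
  have r0: "0 < r0" using p pq by (simp add: r0_def)
  obtain r where r: "r > 0" "ball (p - r *\<^sub>R N) r \<subseteq> \<Omega>" "ball (p - r *\<^sub>R N) r \<subseteq> ball p (2 * r0)"
    using small_touching_ball[OF p(1) r0] unfolding N_def by blast
  have inb: "x \<in> \<Omega>" "l < x \<bullet> e" "x \<noteq> q" if x: "x \<in> ball (p - r *\<^sub>R N) r" for x
  proof -
    show "x \<in> \<Omega>" using x r(2) by blast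
    have xp: "dist p x < 2 * r0" using subsetD[OF r(3) x] by simp
    then show "x \<noteq> q" by (auto simp: r0_def)
    have "\<bar>(p - x) \<bullet> e\<bar> \<le> norm (p - x)" using Cauchy_Schwarz_ineq2[of "p - x" e] e by simp
    moreover have "norm (p - x) < p \<bullet> e - l" using xp by (simp add: r0_def dist_norm min_def split: if_splits)
    ultimately show "l < x \<bullet> e" by (simp add: inner_diff_left)
  qed
  define w where "w = (\<lambda>x. u (reflect e l x) - u x)"
  have "\<exists>k>0. \<forall>x\<in>ball (p - r *\<^sub>R N) r. k * (r - norm (x - (p - r *\<^sub>R N))) \<le> w x"
  proof (rule hopf_lemma[OF r(1)])
    fix x assume x: "x \<in> ball (p - r *\<^sub>R N) r"
    show "0 < w x" using u_less_reflected[OF e l cap] inb[OF x] by (simp add: w_def q_def)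
    have "x \<in> \<Omega> - {0}" using inb[OF x] l by auto
    moreover have "reflect e l x \<in> \<Omega> - {0}"
      using inb[OF x] cap reflect_eq_zero[OF e l cap, of x] by (auto simp: cap_ok_def q_def)
    ultimately show "\<exists>L\<le>0. has_laplacian w x L"
      using reflected_laplacian[OF e l cap] unfolding w_def by blast
  qed
  then obtain k where k: "k > 0" "\<And>x. x \<in> ball (p - r *\<^sub>R N) r \<Longrightarrow> k * (r - norm (x - (p - r *\<^sub>R N))) \<le> w x"
    by blast
  have d: "(- N) \<bullet> \<nu> p < 0" using NN by (simp add: N_def)
  have d': "lreflect e (- N) \<bullet> \<nu> p' < 0"
    by (simp add: N' lreflect_inner lreflect_lreflect[OF e] NN)
  have "((\<lambda>t. u (p' + t *\<^sub>R lreflect e (- N)) / t - u (p + t *\<^sub>R (- N)) / t) \<longlongrightarrow>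
      g p' \<bullet> lreflect e (- N) - g p \<bullet> (- N)) (at_right 0)"
    by (intro tendsto_diff boundary_taylor_1 p p' d d')
  moreover have "g p' \<bullet> lreflect e (- N) - g p \<bullet> (- N) = 0"
    using g_boundary[OF p'] g_boundary[OF p(1)] NN
    by (simp add: N' lreflect_inner lreflect_lreflect[OF e] N_def[symmetric])
  moreover have "\<forall>\<^sub>F t in at_right 0. k \<le> u (p' + t *\<^sub>R lreflect e (- N)) / t - u (p + t *\<^sub>R (- N)) / t"
    unfolding eventually_at_right_field
  proof (intro exI[of _ r] conjI allI impI r)
    fix t assume t: "0 < t" "t < r"
    have "p + t *\<^sub>R (- N) - (p - r *\<^sub>R N) = (r - t) *\<^sub>R N" by (simp add: algebra_simps)
    then have n: "norm (p + t *\<^sub>R (- N) - (p - r *\<^sub>R N)) = r - t"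
      using t norm_nu[OF p(1)] by (simp add: N_def)
    then have "p + t *\<^sub>R (- N) \<in> ball (p - r *\<^sub>R N) r"
      unfolding mem_ball dist_norm norm_minus_commute[of "p - r *\<^sub>R N"] using t by linarith
    from k(2)[OF this] have "k * t \<le> w (p + t *\<^sub>R (- N))" unfolding n by simp
    then have "k * t / t \<le> w (p + t *\<^sub>R (- N)) / t" using t by (intro divide_right_mono) auto
    then show "k \<le> u (p' + t *\<^sub>R lreflect e (- N)) / t - u (p + t *\<^sub>R (- N)) / t"
      using t unfolding w_def rl diff_divide_distrib by simp
  qed
  ultimately have "k \<le> 0"
    using tendsto_lowerbound[OF _ _ trivial_limit_at_right_real] by (simp only:)
  then show False using k(1) by simp
qed

text \<open>At the corner the difference of \<open>u\<close> and its reflection is \<open>o(t\<^sup>2)\<close> along the diagonal direction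
  \<open>e - \<nu>\<close>, against the quadratic lower bound of the corner lemma.\<close>

lemma no_corner:
  assumes e: "norm e = 1" and l: "0 < l" and cap: "cap_ok e l"
    and p: "p \<in> frontier \<Omega>" "p \<bullet> e = l" and orth: "e \<bullet> \<nu> p = 0"
  shows False
proof -
  define N where "N = \<nu> p"
  have NN: "N \<bullet> N = 1" using nu_nu[OF p(1)] by (simp add: N_def)
  have eN: "e \<bullet> N = 0" "N \<bullet> e = 0" using orth by (auto simp: N_def inner_commute)
  have ee: "e \<bullet> e = 1" by (rule inner_unit_self[OF e])
  define q where "q = (2 * l) *\<^sub>R e"
  have "q \<bullet> e = 2 * l" by (simp add: q_def ee)
  then have pq: "p \<noteq> q" using p(2) l by auto
  define r0 where "r0 = dist p q / 2"
  have r0: "0 < r0" using pq by (simp add: r0_def)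
  obtain r where r: "r > 0" "ball (p - r *\<^sub>R N) r \<subseteq> \<Omega>" "ball (p - r *\<^sub>R N) r \<subseteq> ball p (2 * r0)"
    using small_touching_ball[OF p(1) r0] unfolding N_def by blast
  \<comment> \<open>N is orthogonal to e, so the centre lies on the plane, and the plane halves the
    tangent ball as \<open>corner_lemma\<close> requires.\<close>
  define c where "c = p - r *\<^sub>R N"
  have ce: "c \<bullet> e = l" by (simp add: c_def inner_diff_left eN p(2))
  have inb: "x \<in> \<Omega>" "l < x \<bullet> e" "x \<noteq> q" if x: "x \<in> ball c r" "0 < (x - c) \<bullet> e" for x
  proof -
    show "x \<in> \<Omega>" using x r(2) unfolding c_def by blast
    show "l < x \<bullet> e" using x(2) ce by (simp add: inner_diff_left)
    have "dist p x < 2 * r0" using x(1) subsetD[OF r(3), of x] by (simp add: c_def)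
    then show "x \<noteq> q" by (auto simp: r0_def)
  qed
  define w where "w = (\<lambda>x. u (reflect e l x) - u x)"
  have "\<exists>k>0. \<forall>x\<in>ball c r. norm (x - c) > r / 2 \<longrightarrow> 0 < (x - c) \<bullet> e \<longrightarrow>
     k * ((x - c) \<bullet> e) * (r - norm (x - c)) \<le> w x"
  proof (rule corner_lemma[OF r(1) e])
    fix x assume x: "x \<in> ball c r" "0 < (x - c) \<bullet> e"
    show "0 < w x" using u_less_reflected[OF e l cap] inb[OF x] by (simp add: w_def q_def)
    have "x \<in> \<Omega> - {0}" using inb[OF x] l by auto
    moreover have "reflect e l x \<in> \<Omega> - {0}"
      using inb[OF x] cap reflect_eq_zero[OF e l cap, of x] by (auto simp: cap_ok_def q_def)
    ultimately show "\<exists>L\<le>0. has_laplacian w x L"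
      using reflected_laplacian[OF e l cap] unfolding w_def by blast
  qed
  then obtain k where k: "k > 0" "\<And>x. x \<in> ball c r \<Longrightarrow> r / 2 < norm (x - c) \<Longrightarrow> 0 < (x - c) \<bullet> e \<Longrightarrow>
     k * ((x - c) \<bullet> e) * (r - norm (x - c)) \<le> w x" by blast
  define d where "d = e - N"
  define d' where "d' = - e - N"
  have dd': "lreflect e d = d'" by (simp add: d_def d'_def lreflect_def inner_diff_left ee eN scaleR_2)
  have d: "d \<bullet> \<nu> p < 0" "d' \<bullet> \<nu> p < 0"
    by (simp_all add: d_def d'_def N_def[symmetric] inner_diff_left eN NN)
  have rl: "reflect e l (p + t *\<^sub>R d) = p + t *\<^sub>R d'" for t
    by (simp add: reflect_add dd' linear_cmul[OF linear_lreflect] reflect_fix[OF e p(2)])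
  have gd: "g p \<bullet> d' = g p \<bullet> d"
    using g_boundary[OF p(1)] by (simp add: d_def d'_def inner_diff_right eN N_def[symmetric])
  \<comment> \<open>The two quadratic forms differ only in the sign of the mixed terms, which vanish
    by the overdetermined condition.\<close>
  have Gd: "G p d' \<bullet> d' = G p d \<bullet> d"
  proof -
    have 1: "G p e \<bullet> N = 0" "G p N \<bullet> e = 0"
      using mixed_second_derivative[OF p(1) e orth] G_symmetric_boundary[OF p(1), of N e]
      by (auto simp: N_def)
    have "d' = - (e + N)" by (simp add: d'_def)
    then have "G p d' \<bullet> d' = G p (e + N) \<bullet> (e + N)"
      by (simp only: linear_neg[OF G_linear] inner_minus_left inner_minus_right minus_minus)
    then show ?thesis
      unfolding d_def by (simp only: linear_add[OF G_linear] linear_diff[OF G_linear] inner_add_left inner_add_right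
          inner_diff_left inner_diff_right 1)
  qed
  have "((\<lambda>t. (u (p + t *\<^sub>R d') - (g p \<bullet> d') * t) / t\<^sup>2 - (u (p + t *\<^sub>R d) - (g p \<bullet> d) * t) / t\<^sup>2) \<longlongrightarrow>
      (G p d' \<bullet> d') / 2 - (G p d \<bullet> d) / 2) (at_right 0)"
    by (intro tendsto_diff boundary_taylor_2 p d)
  then have lim: "((\<lambda>t. w (p + t *\<^sub>R d) / t\<^sup>2) \<longlongrightarrow> 0) (at_right 0)"
    unfolding gd Gd w_def rl diff_self diff_divide_distrib[symmetric] by simp
  have "\<forall>\<^sub>F t in at_right 0. k / 2 \<le> w (p + t *\<^sub>R d) / t\<^sup>2"
    unfolding eventually_at_right_field
  proof (intro exI[of _ "r / 2"] conjI allI impI)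
    show "0 < r / 2" using r by simp
    fix t assume t: "0 < t" "t < r / 2"
    define x where "x = p + t *\<^sub>R d"
    have xc: "x - c = t *\<^sub>R e + (r - t) *\<^sub>R N" by (simp add: x_def c_def d_def algebra_simps)
    have xe: "(x - c) \<bullet> e = t" unfolding xc by (simp add: inner_add_left ee eN)
    have nsq: "(norm (x - c))\<^sup>2 = t\<^sup>2 + (r - t)\<^sup>2"
      unfolding xc power2_norm_eq_inner
      by (simp add: inner_add_left inner_add_right ee eN NN power2_eq_square)
    have "(r - t)\<^sup>2 < (norm (x - c))\<^sup>2" unfolding nsq using t by simp
    then have lo: "r / 2 < norm (x - c)" using t power2_less_imp_less[of "r - t" "norm (x - c)"] by simp
    \<comment> \<open>So the distance to the sphere is at least t / 2; the height above the plane is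
      t, and the corner bound becomes k t^2 / 2.\<close>
    have "(norm (x - c))\<^sup>2 \<le> (r - t / 2)\<^sup>2"
    proof -
      have "t * (7 / 4 * t) \<le> t * r" using t by (intro mult_left_mono) auto
      then have le: "7 / 4 * t\<^sup>2 \<le> r * t" by (simp add: power2_eq_square mult.commute)
      have "(r - t / 2)\<^sup>2 = r\<^sup>2 + t\<^sup>2 / 4 - r * t" "(r - t)\<^sup>2 = r\<^sup>2 + t\<^sup>2 - 2 * r * t"
        by (simp_all add: power2_diff power_divide)
      then show ?thesis unfolding nsq using le by linarith
    qed
    moreover have "0 \<le> r - t / 2" using t by simp
    ultimately have hi: "norm (x - c) \<le> r - t / 2" by (rule power2_le_imp_le)
    have xb: "x \<in> ball c r" unfolding mem_ball dist_norm norm_minus_commute[of c] using hi t by linarith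
    have "0 < (x - c) \<bullet> e" unfolding xe by (rule t)
    from k(2)[OF xb lo this] have "k * t * (r - norm (x - c)) \<le> w x" unfolding xe .
    moreover have "k * t * (t / 2) \<le> k * t * (r - norm (x - c))"
      using hi t k(1) by (intro mult_left_mono) auto
    ultimately have "k / 2 * t\<^sup>2 \<le> w x" by (simp add: power2_eq_square)
    then show "k / 2 \<le> w (p + t *\<^sub>R d) / t\<^sup>2" using t by (simp add: pos_le_divide_eq x_def)
  qed
  from tendsto_lowerbound[OF lim this trivial_limit_at_right_real] have "k / 2 \<le> 0" .
  then show False using k(1) by simp
qed

section \<open>Moving the plane\<close>

lemma reflect_tendsto:
  assumes "(m \<longlongrightarrow> l) F" "(x \<longlongrightarrow> z) F"
  shows "((\<lambda>n. reflect e (m n) (x n)) \<longlongrightarrow> reflect e l z) F"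
  unfolding reflect_def by (intro tendsto_intros assms)

text \<open>In the limit the reflected points only stay in the closure. But the reflected open cap
  is open, and an open subset of the closure lies in \<Omega>.\<close>

lemma cap_ok_limit:
  assumes e: "norm e = 1" and ok: "\<And>m. L < m \<Longrightarrow> cap_ok e m"
  shows "cap_ok e L"
proof -
  define S where "S = \<Omega> \<inter> {x. L < x \<bullet> e}"
  have "open S" unfolding S_def by (intro open_Int open_Omega open_Collect_less continuous_intros)
  moreover have im: "reflect e L ` S = reflect e L -` S" using reflect_image[OF e] by (simp add: vimage_def)
  ultimately have "open (reflect e L ` S)"
    unfolding im using continuous_reflect[OF e] by (intro open_vimage continuous_at_imp_continuous_on) auto
  moreover have "reflect e L ` S \<subseteq> closure \<Omega>"
  proof (rule image_subsetI)
    fix x assume x: "x \<in> S"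
    have "((\<lambda>m. reflect e m x) \<longlongrightarrow> reflect e L x) (at_right L)"
      by (intro reflect_tendsto tendsto_ident_at tendsto_const)
    moreover have "\<forall>\<^sub>F m in at_right L. reflect e m x \<in> closure \<Omega>"
      unfolding eventually_at_right_field using x ok closure_subset[of \<Omega>]
      by (intro exI[of _ "x \<bullet> e"]) (auto simp: S_def cap_ok_def)
    ultimately show "reflect e L x \<in> closure \<Omega>"
      by (intro Lim_in_closed_set[OF closed_closure]) auto
  qed
  ultimately show ?thesis using open_subset_closure unfolding cap_ok_def S_def by blast
qed

text \<open>Failures just below the infimum L accumulate at a point z of the closed cap whose
  reflection is outside \<Omega>. Off the plane this is internal tangency. On the plane, \<nu> z . e
  > 0 contradicts the local monotonicity along - e, \<nu> z . e < 0 contradicts the reflection at L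
  itself, and \<nu> z . e = 0 is the corner.\<close>

lemma cap_ok_all:
  assumes e: "norm e = 1" and l: "0 < l"
  shows "cap_ok e l"
proof (rule ccontr)
  assume not_ok: "\<not> cap_ok e l"
  \<comment> \<open>Demanding all larger positions as well makes A upward closed, so that its
    infimum is where the plane first stops.\<close>
  define A where "A = {l. 0 \<le> l \<and> (\<forall>m>l. cap_ok e m)}"
  define L where "L = Inf A"
  obtain M where M: "\<And>x. x \<in> \<Omega> \<Longrightarrow> norm x \<le> M" using bounded_Omega by (auto simp: bounded_iff)
  have far: "cap_ok e m" if "max M 0 < m" for m
  proof -
    have "\<not> m < x \<bullet> e" if "x \<in> \<Omega>" for x
      using norm_cauchy_schwarz[of x e] e M[OF that] \<open>max M 0 < m\<close> by auto
    then show ?thesis by (auto simp: cap_ok_def)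
  qed
  have "max M 0 \<in> A" unfolding A_def using far by (intro CollectI conjI allI impI) auto
  then have A: "A \<noteq> {}" "bdd_below A" by (blast, intro bdd_belowI[of _ 0]) (simp add: A_def)
  have ok: "cap_ok e m" if "L < m" for m
    using cInf_less_iff[OF A, of m] that by (auto simp: L_def A_def)
  have "l \<le> L" using ok[of l] not_ok by force
  then have L0: "0 < L" using l by simp
  have capL: "cap_ok e L" using cap_ok_limit[OF e ok] by blast
  have "\<exists>m x. L - L / real (n + 2) < m \<and> m < L \<and> x \<in> \<Omega> \<and> m < x \<bullet> e \<and> reflect e m x \<notin> \<Omega>" for n
  proof -
    \<comment> \<open>The value is nonnegative, so it fails to be in A because of a failing cap and
      not because of its sign.\<close>
    define a where "a = L - L / real (n + 2)"
    have "L * 1 \<le> L * real (n + 2)" using L0 by (intro mult_left_mono) auto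
    then have a: "0 \<le> a" "a < L" using L0 by (auto simp: a_def field_simps)
    have "a \<notin> A" using a(2) cInf_lower[OF _ A(2), of a] by (auto simp: L_def)
    then obtain m where m: "a < m" "\<not> cap_ok e m" using a(1) by (auto simp: A_def)
    have "m < L" using ok[of m] m(2) capL by (cases "m = L") force+
    then show ?thesis using m unfolding a_def cap_ok_def by blast
  qed
  then obtain m x where mx: "\<And>n. L - L / real (n + 2) < m n" "\<And>n. m n < L" "\<And>n. x n \<in> \<Omega>"
      "\<And>n. m n < x n \<bullet> e" "\<And>n. reflect e (m n) (x n) \<notin> \<Omega>" by metis
  have "m \<longlonglongrightarrow> L"
  proof (rule tendsto_sandwich)
    have "(\<lambda>n. L - L / real (n + 2)) \<longlonglongrightarrow> L - 0"
      using LIMSEQ_ignore_initial_segment[OF lim_const_over_n[of L], of 2]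
      by (intro tendsto_diff tendsto_const) simp
    then show "(\<lambda>n. L - L / real (n + 2)) \<longlonglongrightarrow> L" by simp
  qed (use mx(1,2) in \<open>auto intro!: always_eventually less_imp_le\<close>)
  have "compact (closure \<Omega>)" using bounded_Omega by (simp add: compact_closure)
  then obtain z \<sigma> where z: "z \<in> closure \<Omega>" "strict_mono \<sigma>" "(x \<circ> \<sigma>) \<longlonglongrightarrow> z"
    unfolding compact_eq_seq_compact_metric seq_compact_def
    using mx(3) closure_subset[of \<Omega>] by (metis subsetD)
  define x' where "x' = x \<circ> \<sigma>"
  define m' where "m' = m \<circ> \<sigma>"
  have mx': "m' n < L" "x' n \<in> \<Omega>" "m' n < x' n \<bullet> e" "reflect e (m' n) (x' n) \<notin> \<Omega>" for n
    using mx by (auto simp: x'_def m'_def)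
  have lim: "m' \<longlonglongrightarrow> L" "x' \<longlonglongrightarrow> z"
    using LIMSEQ_subseq_LIMSEQ[OF \<open>m \<longlonglongrightarrow> L\<close> z(2)] z(3) by (auto simp: x'_def m'_def)
  have limr: "(\<lambda>n. reflect e (m' n) (x' n)) \<longlonglongrightarrow> reflect e L z" by (rule reflect_tendsto[OF lim])
  have rz: "reflect e L z \<notin> \<Omega>"
    using Lim_in_closed_set[OF _ _ _ limr, of "- \<Omega>"] open_Omega mx'(4) by (auto simp: closed_def)
  have limxe: "(\<lambda>n. x' n \<bullet> e) \<longlonglongrightarrow> z \<bullet> e" by (intro tendsto_intros lim)
  have "L \<le> z \<bullet> e"
    using mx'(3) by (intro LIMSEQ_le[OF lim(1) limxe]) (auto intro: less_imp_le)
  then consider "L < z \<bullet> e" | "z \<bullet> e = L" by linarith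
  then show False
  proof cases
    case 1
    have "z \<notin> \<Omega>" using 1 rz capL by (auto simp: cap_ok_def)
    then have "z \<in> frontier \<Omega>" using z(1) frontierI by blast
    moreover have "\<forall>\<^sub>F n in sequentially. L < x' n \<bullet> e" by (rule order_tendstoD(1)[OF limxe 1])
    then have "\<forall>\<^sub>F n in sequentially. reflect e L (x' n) \<in> closure \<Omega>"
      by eventually_elim (use capL mx'(2) closure_subset[of \<Omega>] in \<open>auto simp: cap_ok_def\<close>)
    from Lim_in_closed_set[OF closed_closure this sequentially_bot reflect_tendsto[OF tendsto_const lim(2)]]
    have "reflect e L z \<in> closure \<Omega>" .
    then have "reflect e L z \<in> frontier \<Omega>" using rz frontierI by blast
    ultimately show False using no_tangency[OF e L0 capL] 1 by blast
  next
    case 2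
    have fixz: "reflect e L z = z" by (rule reflect_fix[OF e 2])
    then have fr: "z \<in> frontier \<Omega>" using z(1) rz frontierI by simp
    have "\<not> 0 < \<nu> z \<bullet> e"
    proof
      assume "0 < \<nu> z \<bullet> e"
      \<comment> \<open>A failing point and its reflection both tend to z and differ by a positive
        multiple of e, so the reflection is reached by moving along - e near z.\<close>
      from transversal[OF fr this] obtain r where r: "r > 0"
        "\<And>x s. x \<in> \<Omega> \<Longrightarrow> x \<in> ball z r \<Longrightarrow> 0 \<le> s \<Longrightarrow> x - s *\<^sub>R e \<in> ball z r \<Longrightarrow> x - s *\<^sub>R e \<in> \<Omega>"
        by blast
      have "\<forall>\<^sub>F n in sequentially. x' n \<in> ball z r"
        using lim(2) by (rule topological_tendstoD) (use r in auto)
      moreover have "\<forall>\<^sub>F n in sequentially. reflect e (m' n) (x' n) \<in> ball z r"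
        using limr unfolding fixz by (rule topological_tendstoD) (use r in auto)
      ultimately have "\<forall>\<^sub>F n in sequentially. False"
      proof eventually_elim
        case (elim n)
        then show ?case
          using r(2)[of "x' n" "2 * (x' n \<bullet> e - m' n)"] mx'[of n] by (simp add: reflect_def)
      qed
      then show False by simp
    qed
    moreover have "\<not> \<nu> z \<bullet> e < 0"
    proof
      assume "\<nu> z \<bullet> e < 0"
      \<comment> \<open>The inward ray along e would be reflected at L to the outward ray along -
        e.\<close>
      then have 1: "e \<bullet> \<nu> z < 0" "0 < (- e) \<bullet> \<nu> z" by (auto simp: inner_commute)
      have "\<forall>\<^sub>F t in at_right (0::real). False"
        using inward_ray[OF fr 1(1)] outward_ray[OF fr 1(2)] eventually_pos_right
      proof eventually_elim
        case (elim t)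
        have "(z + t *\<^sub>R e) \<bullet> e = L + t" using 2 by (simp add: inner_add_left inner_unit_self[OF e])
        moreover have "reflect e L (z + t *\<^sub>R e) = z + t *\<^sub>R - e"
          using calculation by (simp add: reflect_def algebra_simps flip: scaleR_2)
        ultimately have "z + t *\<^sub>R - e \<in> \<Omega>" using capL elim by (auto simp: cap_ok_def)
        then show ?case using elim closure_subset[of \<Omega>] by blast
      qed
      then show False by simp
    qed
    ultimately have "e \<bullet> \<nu> z = 0" by (simp add: inner_commute)
    then show False using no_corner[OF e L0 capL fr 2] by blast
  qed
qed

section \<open>Planes through the origin and rotational symmetry\<close>

lemma reflection_at_zero:
  assumes e: "norm e = 1" and x: "x \<in> \<Omega>" "0 < x \<bullet> e"
  shows "reflect e 0 x \<in> \<Omega>" "u x \<le> u (reflect e 0 x)"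
proof -
  have "cap_ok e 0" using cap_ok_limit[OF e cap_ok_all[OF e]] by blast
  then show rx: "reflect e 0 x \<in> \<Omega>" using x by (simp add: cap_ok_def)
  have "reflect e 0 x \<noteq> 0" using x(2) reflect_inner[OF e, of 0 x] by auto
  then have "isCont u (reflect e 0 x)"
    using rx u_deriv has_derivative_continuous by blast
  moreover have "((\<lambda>l. reflect e l x) \<longlongrightarrow> reflect e 0 x) (at_right 0)"
    by (intro reflect_tendsto tendsto_ident_at tendsto_const)
  ultimately have "((\<lambda>l. u (reflect e l x)) \<longlongrightarrow> u (reflect e 0 x)) (at_right 0)"
    by (rule isCont_tendsto_compose)
  moreover have "\<forall>\<^sub>F l in at_right 0. u x \<le> u (reflect e l x)"
    unfolding eventually_at_right_field
  proof (intro exI[of _ "x \<bullet> e / 2"] conjI allI impI)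
    fix l assume l: "0 < l" "l < x \<bullet> e / 2"
    \<comment> \<open>The pole 2 l e has component 2 l along e, which is smaller than x . e.\<close>
    then have "x \<noteq> (2 * l) *\<^sub>R e" using inner_unit_self[OF e] by auto
    then show "u x \<le> u (reflect e l x)"
      using u_le_reflected[OF e l(1) cap_ok_all[OF e l(1)] x(1)] l by simp
  qed (use x in simp)
  ultimately show "u x \<le> u (reflect e 0 x)" by (intro tendsto_lowerbound) auto
qed

text \<open>Points of equal norm are exchanged by the reflection in the plane through 0 orthogonal
  to x - y, and x is on its positive side. Exchanging the roles of x and y gives equality.\<close>

lemma rotation_le:
  assumes x: "x \<in> \<Omega>" and n: "norm y = norm x"
  shows "y \<in> \<Omega> \<and> u x \<le> u y"
proof (cases "x = y")
  case False
  define e where "e = (1 / norm (x - y)) *\<^sub>R (x - y)"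
  have e: "norm e = 1" using False by (simp add: e_def)
  have yy: "y \<bullet> y = x \<bullet> x" using n by (simp add: norm_eq)
  then have "(norm (x - y))\<^sup>2 = 2 * (x \<bullet> (x - y))"
    by (simp add: power2_norm_eq_inner inner_diff_left inner_diff_right inner_commute)
  then have xe: "2 * (x \<bullet> e) = norm (x - y)"
    using False by (simp add: e_def power2_eq_square nonzero_divide_eq_eq)
  have "reflect e 0 x = y"
    unfolding reflect_def diff_zero xe using False by (simp add: e_def)
  moreover have "0 < norm (x - y)" using False by simp
  then have "0 < x \<bullet> e" unfolding xe[symmetric] by simp
  ultimately show ?thesis using reflection_at_zero[OF e x] by simp
qed (use x in simp)

lemma u_radial:
  assumes "x \<in> \<Omega>" "norm y = norm x"
  shows "u y = u x"
  using rotation_le[OF assms] rotation_le[of y x] assms by (intro antisym) simp_all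

text \<open>The norms of points of \<Omega> form an interval containing 0, because \<Omega> is
  connected; the supremum is not attained, because \<Omega> is open; and every sphere around 0 that
  meets \<Omega> lies in it.\<close>

theorem Omega_ball: "\<exists>R>0. \<Omega> = ball 0 R"
proof -
  define R where "R = Sup (norm ` \<Omega>)"
  have bdd: "bdd_above (norm ` \<Omega>)" using bounded_Omega by (auto simp: bounded_iff bdd_above_def)
  have ne: "norm ` \<Omega> \<noteq> {}" using zero_in_Omega by auto
  have lt: "norm x < R" if x: "x \<in> \<Omega>" for x
  proof -
    obtain \<rho> where \<rho>: "\<rho> > 0" "ball x \<rho> \<subseteq> \<Omega>" using open_Omega x open_contains_ball by blast
    obtain b :: 'a where b: "norm b = 1" using vector_choose_size[of 1] by auto
    define s where "s = (if x = 0 then b else sgn x)"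
    have s: "norm s = 1" using b by (simp add: s_def norm_sgn)
    have xs: "norm x *\<^sub>R s = x" by (cases "x = 0") (simp_all add: s_def sgn_div_norm)
    have "(norm x + \<rho> / 2) *\<^sub>R s = x + (\<rho> / 2) *\<^sub>R s" unfolding scaleR_add_left xs ..
    then have "norm (x + (\<rho> / 2) *\<^sub>R s) = \<bar>norm x + \<rho> / 2\<bar> * norm s" by (metis norm_scaleR)
    also have "\<dots> = norm x + \<rho> / 2" using s \<rho>(1) by simp
    finally have "norm (x + (\<rho> / 2) *\<^sub>R s) = norm x + \<rho> / 2" .
    moreover have "x + (\<rho> / 2) *\<^sub>R s \<in> ball x \<rho>" using s \<rho>(1) by (simp add: dist_norm)
    then have "x + (\<rho> / 2) *\<^sub>R s \<in> \<Omega>" using \<rho>(2) by blast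
    then have "norm (x + (\<rho> / 2) *\<^sub>R s) \<le> R" unfolding R_def using bdd by (intro cSup_upper) auto
    ultimately show ?thesis using \<rho>(1) by simp
  qed
  have "x \<in> \<Omega>" if x: "norm x < R" for x
  proof -
    obtain z where z: "z \<in> \<Omega>" "norm x < norm z"
      using x unfolding R_def less_cSup_iff[OF ne bdd] by blast
    have "connected (norm ` \<Omega>)"
      by (intro connected_continuous_image continuous_intros connected_Omega)
    then have "norm x \<in> norm ` \<Omega>"
      by (rule connectedD_interval[of _ 0 "norm z"]) (use z zero_in_Omega in \<open>auto intro!: image_eqI[of 0 norm 0]\<close>)
    then obtain y where "y \<in> \<Omega>" "norm x = norm y" by blast
    then show ?thesis using rotation_le by blast
  qed
  then have "\<Omega> = ball 0 R" using lt by (intro equalityI subsetI) simp_all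
  moreover have "R > 0" using lt[OF zero_in_Omega] by simp
  ultimately show ?thesis by blast
qed

end

section \<open>Weak derivatives and touching balls\<close>

text \<open>By translation invariance of Lebesgue measure all difference quotients have integral
  zero; dominated convergence carries this over to the derivative.\<close>

lemma integral_directional_derivative_zero:
  fixes W :: "'a::euclidean_space \<Rightarrow> real"
  assumes D: "\<And>x. (W has_derivative D x) (at x)" and cont: "continuous_on UNIV (\<lambda>x. D x b)"
    and K: "compact K" and zero: "\<And>x. x \<notin> K \<Longrightarrow> W x = 0"
  shows "(\<integral>x. D x b \<partial>lborel) = 0"
proof -
  have Wc: "continuous_on UNIV W"
    using D has_derivative_continuous by (blast intro: continuous_at_imp_continuous_on)
  have D0: "D x b = 0" if "x \<notin> K" for x
  proof -
    have "(W has_derivative (\<lambda>_. 0)) (at x)"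
      by (rule has_derivative_transform_within_open[of "\<lambda>_. 0", where s = "- K"])
         (use K zero that in \<open>auto simp: compact_imp_closed open_Compl\<close>)
    from has_derivative_unique[OF D this] show ?thesis by metis
  qed
  obtain \<rho> where \<rho>: "\<And>x. x \<in> K \<Longrightarrow> norm x \<le> \<rho>" using compact_imp_bounded[OF K] by (auto simp: bounded_iff)
  have "bounded ((\<lambda>x. D x b) ` K)"
    using K cont by (intro compact_imp_bounded compact_continuous_image continuous_on_subset[OF cont]) auto
  then obtain M0 where M0: "\<And>x. x \<in> K \<Longrightarrow> \<bar>D x b\<bar> \<le> M0" by (auto simp: bounded_iff)
  define M where "M = max M0 0"
  have M: "\<bar>D x b\<bar> \<le> M" for x using M0[of x] D0[of x] by (cases "x \<in> K") (auto simp: M_def)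
  \<comment> \<open>Contains the supports of all difference quotients, whose steps are at most
    1.\<close>
  define C where "C = cball (0::'a) (\<rho> + norm b)"
  define h where "h = (\<lambda>n. 1 / real (Suc n))"
  have h: "0 < h n" "h n \<le> 1" for n by (auto simp: h_def)
  have h0: "h \<longlonglongrightarrow> 0" unfolding h_def using LIMSEQ_inverse_real_of_nat by (simp add: inverse_eq_divide)
  define s where "s = (\<lambda>n x. (W (h n *\<^sub>R b + x) - W x) / h n)"
  have line: "((\<lambda>t. W (t *\<^sub>R b + x)) has_real_derivative D (t *\<^sub>R b + x) b) (at t)" for t x
  proof -
    have "((\<lambda>t. t *\<^sub>R b + x) has_derivative (\<lambda>t. t *\<^sub>R b)) (at t)" by (auto intro!: derivative_eq_intros)
    from has_derivative_compose[OF this D] show ?thesis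
      unfolding has_field_derivative_def
      by (rule has_derivative_eq_rhs) (simp add: fun_eq_iff linear_cmul[OF has_derivative_linear[OF D]])
  qed
  have intW: "integrable lborel W"
  proof -
    have "integrable lborel (\<lambda>x. indicator K x *\<^sub>R W x)"
      using K continuous_on_subset[OF Wc] by (intro borel_integrable_compact) auto
    moreover have "(\<lambda>x. indicator K x *\<^sub>R W x) = W" using zero by (auto simp: fun_eq_iff indicator_def)
    ultimately show ?thesis by simp
  qed
  have Wm: "W \<in> borel_measurable borel" using Wc by (rule borel_measurable_continuous_onI)
  have shift: "integrable lborel (\<lambda>x. W (c + x))" "(\<integral>x. W (c + x) \<partial>lborel) = integral\<^sup>L lborel W" for c
  proof -
    have m: "(+) c \<in> measurable lborel borel" by simp
    show "integrable lborel (\<lambda>x. W (c + x))"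
      using integrable_distr_eq[OF m Wm] intW by (simp add: lborel_distr_plus)
    show "(\<integral>x. W (c + x) \<partial>lborel) = integral\<^sup>L lborel W"
      using integral_distr[OF m Wm] by (simp add: lborel_distr_plus)
  qed
  have int_s: "integral\<^sup>L lborel (s n) = 0" for n
    unfolding s_def using shift[of "h n *\<^sub>R b"] intW by simp
  have "(\<lambda>n. integral\<^sup>L lborel (s n)) \<longlonglongrightarrow> integral\<^sup>L lborel (\<lambda>x. D x b)"
  proof (rule integral_dominated_convergence[where w = "\<lambda>x. indicator C x *\<^sub>R M"])
    show "(\<lambda>x. D x b) \<in> borel_measurable lborel" using borel_measurable_continuous_onI[OF cont] by simp
    show "s n \<in> borel_measurable lborel" for n
      unfolding s_def using Wm shift(1)[of "h n *\<^sub>R b"] borel_measurable_integrable by auto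
    show "integrable lborel (\<lambda>x. indicator C x *\<^sub>R M)"
      by (rule borel_integrable_compact) (auto simp: C_def)
    show "AE x in lborel. (\<lambda>n. s n x) \<longlonglongrightarrow> D x b"
    proof (rule AE_I2)
      fix x
      have "((\<lambda>t. (W (t *\<^sub>R b + x) - W x) / t) \<longlongrightarrow> D x b) (at 0)"
        using line[of x 0] by (simp add: has_field_derivative_iff)
      moreover have "filterlim h (at 0) sequentially"
        using h0 h(1) by (auto simp: filterlim_at less_imp_neq[symmetric] intro!: always_eventually)
      ultimately show "(\<lambda>n. s n x) \<longlonglongrightarrow> D x b"
        unfolding s_def by (rule filterlim_compose)
    qed
    show "AE x in lborel. norm (s n x) \<le> indicator C x *\<^sub>R M" for n
    proof (rule AE_I2)
      fix x
      show "norm (s n x) \<le> indicator C x *\<^sub>R M"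
      proof (cases "x \<in> C")
        case True
        obtain z where "W (h n *\<^sub>R b + x) - W (0 *\<^sub>R b + x) = (h n - 0) * D (z *\<^sub>R b + x) b"
          using MVT2[OF h(1) line] by blast
        then have "s n x = D (z *\<^sub>R b + x) b" using h(1)[of n] by (simp add: s_def)
        then show ?thesis using M True by simp
      next
        case False
        have "x \<notin> K" using \<rho>[of x] False norm_ge_zero[of b] unfolding C_def mem_cball_0 by linarith
        moreover have "h n *\<^sub>R b + x \<notin> K"
        proof
          assume "h n *\<^sub>R b + x \<in> K"
          then have "norm (h n *\<^sub>R b + x) \<le> \<rho>" by (rule \<rho>)
          moreover have "norm x \<le> norm (h n *\<^sub>R b + x) + norm (h n *\<^sub>R b)"
            using norm_triangle_ineq4[of "h n *\<^sub>R b + x" "h n *\<^sub>R b"] by simp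
          moreover have "norm (h n *\<^sub>R b) \<le> norm b" using h[of n] by (simp add: mult_left_le_one_le)
          ultimately show False using False by (simp add: C_def)
        qed
        ultimately show ?thesis using zero False by (simp add: s_def)
      qed
    qed
  qed
  then have "(\<lambda>n. 0::real) \<longlonglongrightarrow> integral\<^sup>L lborel (\<lambda>x. D x b)" unfolding int_s .
  then show ?thesis by (simp add: LIMSEQ_const_iff)
qed

text \<open>S and the complement of K are open and cover the space, and the extension by zero is
  continuous on each of them.\<close>

lemma indicator_extension:
  fixes f :: "'a::euclidean_space \<Rightarrow> real"
  assumes S: "open S" and K: "compact K" "K \<subseteq> S" and f: "continuous_on S f"
    and zero: "\<And>x. x \<in> S \<Longrightarrow> x \<notin> K \<Longrightarrow> f x = 0"
  shows "continuous_on UNIV (\<lambda>x. indicator S x *\<^sub>R f x)" "integrable lborel (\<lambda>x. indicator S x *\<^sub>R f x)"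
proof -
  let ?F = "\<lambda>x. indicator S x *\<^sub>R f x"
  have "continuous_on S ?F" using f by (rule continuous_on_eq) simp
  moreover have "continuous_on (- K) ?F"
  proof (rule continuous_on_eq[of _ "\<lambda>_. 0"])
    show "0 = ?F x" if "x \<in> - K" for x using that zero[of x] by (cases "x \<in> S") auto
  qed simp
  ultimately have "continuous_on (S \<union> - K) ?F"
    using S K by (intro continuous_on_open_Un) (auto simp: compact_imp_closed open_Compl)
  moreover have "S \<union> - K = UNIV" using K(2) by auto
  ultimately show c: "continuous_on UNIV ?F" by simp
  have "integrable lborel (\<lambda>x. indicator K x *\<^sub>R ?F x)"
    using K(1) continuous_on_subset[OF c] by (intro borel_integrable_compact) auto
  moreover have "(\<lambda>x. indicator K x *\<^sub>R ?F x) = ?F"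
    using zero K(2) by (auto simp: fun_eq_iff indicator_def)
  ultimately show "integrable lborel ?F" by simp
qed

lemma L2_on_bounded:
  fixes f :: "real^'n::finite \<Rightarrow> real"
  assumes S: "open S" "bounded S" and f: "continuous_on S f" "\<And>x. x \<in> S \<Longrightarrow> \<bar>f x\<bar> \<le> B"
  shows "L2_on S f"
proof -
  have m: "(\<lambda>x. indicator S x *\<^sub>R f x) \<in> borel_measurable borel"
    using S f by (intro borel_measurable_continuous_on_indicator) auto
  have m2: "(\<lambda>x. indicator S x *\<^sub>R (f x)\<^sup>2) \<in> borel_measurable borel"
    using S f by (intro borel_measurable_continuous_on_indicator continuous_intros) auto
  have "integrable lborel (\<lambda>x. indicator S x *\<^sub>R (f x)\<^sup>2)"
  proof (rule integrableI_bounded_set[where A = S and B = "B\<^sup>2"])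
    show "emeasure lborel S < \<infinity>" using emeasure_bounded_finite[OF S(2)] by simp
    have "(f x)\<^sup>2 \<le> B\<^sup>2" if "x \<in> S" for x using f(2)[OF that] by (metis abs_ge_zero power2_abs power_mono)
    then show "AE x in lborel. x \<in> S \<longrightarrow> norm (indicator S x *\<^sub>R (f x)\<^sup>2) \<le> B\<^sup>2" by simp
  qed (use S m2 in auto)
  then have "integrable lebesgue (\<lambda>x. indicator S x *\<^sub>R (f x)\<^sup>2)"
    using m2 by (subst integrable_completion) auto
  then show ?thesis
    unfolding L2_on_def set_borel_measurable_def set_integrable_def
    using m by (auto intro: measurable_completion)
qed

text \<open>The classical derivatives are the weak ones: the product with a test function, extended
  by zero, is continuously differentiable with compact support, so its derivative has integral zero.
  The bound B makes v and g square integrable on the bounded set.\<close>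

lemma H1_on_C1:
  fixes v :: "real^'n::finite \<Rightarrow> real"
  assumes S: "open S" "bounded S"
    and v: "\<And>x. x \<in> S \<Longrightarrow> (v has_derivative (\<lambda>h. g x \<bullet> h)) (at x)" and g: "continuous_on S g"
    and B: "\<And>x. x \<in> S \<Longrightarrow> \<bar>v x\<bar> \<le> B" "\<And>x. x \<in> S \<Longrightarrow> norm (g x) \<le> B"
  shows "H1_on S v"
  unfolding H1_on_def
proof (intro conjI allI exI impI)
  have vc: "continuous_on S v"
    using v has_derivative_continuous by (blast intro: continuous_at_imp_continuous_on)
  show "L2_on S v" using S vc B(1) by (rule L2_on_bounded)
  fix i
  have gc: "continuous_on S (\<lambda>x. g x $ i)" by (intro continuous_intros g)
  show "L2_on S (\<lambda>x. g x $ i)"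
    using S gc by (rule L2_on_bounded) (use B(2) component_le_norm_cart order_trans in blast)
  fix \<phi> assume \<phi>: "test_function S \<phi>"
  define K where "K = closure {x. \<phi> x \<noteq> 0}"
  have K: "compact K" "K \<subseteq> S" using \<phi> by (auto simp: test_function_def K_def)
  have "Ck_on (Suc 0) UNIV \<phi>" using \<phi> by (simp add: test_function_def)
  then have \<phi>d: "\<phi> differentiable at x" and \<phi>p: "continuous_on UNIV (partial i \<phi>)" for x by auto
  have \<phi>0: "\<phi> x = 0" if "x \<notin> K" for x using that closure_subset[of "{x. \<phi> x \<noteq> 0}"] by (auto simp: K_def)
  have \<phi>D: "(\<phi> has_derivative frechet_derivative \<phi> (at x)) (at x)" for x
    using \<phi>d by (simp add: frechet_derivative_works)
  have oK: "open (- K)" using K(1) by (simp add: compact_imp_closed open_Compl)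
  have p0: "partial i \<phi> x = 0" if "x \<notin> K" for x
  proof -
    have "(\<phi> has_derivative (\<lambda>_. 0)) (at x)"
      by (rule has_derivative_transform_within_open[of "\<lambda>_. 0", where s = "- K"]) (use oK \<phi>0 that in auto)
    from has_derivative_unique[OF \<phi>D this] show ?thesis by (simp add: partial_def)
  qed
  have \<phi>c: "continuous_on UNIV \<phi>"
    using \<phi>d by (intro differentiable_imp_continuous_on) (simp add: differentiable_on_def)
  have c1: "continuous_on S (\<lambda>x. v x * partial i \<phi> x)" and c2: "continuous_on S (\<lambda>x. g x $ i * \<phi> x)"
    by (intro continuous_intros vc gc continuous_on_subset[OF \<phi>p] continuous_on_subset[OF \<phi>c]; simp)+
  note e1 = indicator_extension[OF S(1) K c1] and e2 = indicator_extension[OF S(1) K c2]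
  define W where "W = (\<lambda>x. indicator S x * (v x * \<phi> x))"
  define D where "D = (\<lambda>x h. indicator S x * (v x * frechet_derivative \<phi> (at x) h + (g x \<bullet> h) * \<phi> x))"
  have "(\<integral>x. D x (axis i 1) \<partial>lborel) = 0"
  proof (rule integral_directional_derivative_zero[of W D])
    show "(W has_derivative D x) (at x)" for x
    proof (cases "x \<in> S")
      case True
      have "((\<lambda>x. v x * \<phi> x) has_derivative D x) (at x)"
        using has_derivative_mult[OF v[OF True] \<phi>D[of x]] True by (simp add: D_def mult.commute add.commute)
      then show ?thesis
        by (rule has_derivative_transform_within_open[OF _ S(1) True]) (simp add: W_def)
    next
      case False
      then have "x \<in> - K" using K by auto
      moreover have "D x = (\<lambda>_. 0)" using False by (simp add: D_def)
      ultimately show ?thesis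
        by (simp only:) (rule has_derivative_transform_within_open[of "\<lambda>_. 0", OF _ oK], auto simp: W_def \<phi>0)
    qed
    have "continuous_on UNIV (\<lambda>x. indicator S x *\<^sub>R (v x * partial i \<phi> x) + indicator S x *\<^sub>R (g x $ i * \<phi> x))"
      using p0 \<phi>0 by (intro continuous_on_add e1 e2) auto
    then show "continuous_on UNIV (\<lambda>x. D x (axis i 1))"
      by (simp add: D_def partial_def inner_axis distrib_left)
    show "compact K" by (rule K)
    show "W x = 0" if "x \<notin> K" for x using \<phi>0[OF that] by (simp add: W_def)
  qed
  moreover have "(\<lambda>x. D x (axis i 1)) = (\<lambda>x. indicator S x *\<^sub>R (v x * partial i \<phi> x) + indicator S x *\<^sub>R (g x $ i * \<phi> x))"
    by (simp add: D_def partial_def inner_axis distrib_left fun_eq_iff)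
  moreover have "integrable lborel (\<lambda>x. indicator S x *\<^sub>R (v x * partial i \<phi> x))"
      "integrable lborel (\<lambda>x. indicator S x *\<^sub>R (g x $ i * \<phi> x))"
    using e1(2) e2(2) p0 \<phi>0 by auto
  ultimately have "(\<integral>x. indicator S x *\<^sub>R (v x * partial i \<phi> x) \<partial>lborel) + (\<integral>x. indicator S x *\<^sub>R (g x $ i * \<phi> x) \<partial>lborel) = 0"
    by simp
  moreover have "integral\<^sup>L lebesgue f = integral\<^sup>L lborel f" if "continuous_on UNIV f" for f :: "real^'n \<Rightarrow> real"
    using borel_measurable_continuous_onI[OF that] by (intro integral_completion) simp
  moreover have "continuous_on UNIV (\<lambda>x. indicator S x *\<^sub>R (v x * partial i \<phi> x))"
      "continuous_on UNIV (\<lambda>x. indicator S x *\<^sub>R (g x $ i * \<phi> x))"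
    using e1(1) e2(1) p0 \<phi>0 by auto
  ultimately show "(LINT x:S|lebesgue. v x * partial i \<phi> x) = - (LINT x:S|lebesgue. g x $ i * \<phi> x)"
    unfolding set_lebesgue_integral_def by simp
qed

text \<open>The error is controlled for two arbitrary points near p. This two-point form gives the
  monotonicity along a direction; the special case y = p gives the tangent balls.\<close>

lemma has_hessian_strict:
  fixes f :: "'a::euclidean_space \<Rightarrow> real"
  assumes h: "has_hessian f g H p"
  shows "\<exists>K>0. \<exists>r>0. \<forall>x\<in>ball p r. \<forall>y\<in>ball p r.
     \<bar>f x - f y - g p \<bullet> (x - y)\<bar> \<le> K * (norm (x - p) + norm (y - p)) * norm (x - y)"
proof -
  have gd: "(g has_derivative H) (at p)" using h by (simp add: has_hessian_def)
  then have bl: "bounded_linear H" by (rule has_derivative_bounded_linear)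
  obtain B where B: "B > 0" "\<And>v. norm (H v) \<le> norm v * B" using bounded_linear.pos_bounded[OF bl] by blast
  obtain d1 where d1: "d1 > 0" "\<And>y. norm (y - p) < d1 \<Longrightarrow> norm (g y - g p - H (y - p)) \<le> 1 * norm (y - p)"
    using gd unfolding has_derivative_at_alt by (meson zero_less_one)
  obtain d2 where d2: "d2 > 0" "\<And>y. dist y p < d2 \<Longrightarrow> (f has_derivative (\<lambda>h. g y \<bullet> h)) (at y)"
    using h by (auto simp: has_hessian_def eventually_nhds_metric)
  define K where "K = B + 1"
  define r where "r = min d1 d2"
  have gb: "norm (g y - g p) \<le> K * norm (y - p)" if "norm (y - p) < r" for y
  proof -
    have "norm (g y - g p) \<le> norm (g y - g p - H (y - p)) + norm (H (y - p))"
      using norm_triangle_ineq[of "g y - g p - H (y - p)" "H (y - p)"] by simp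
    also have "\<dots> \<le> 1 * norm (y - p) + norm (y - p) * B"
      using that by (intro add_mono d1 B) (simp add: r_def)
    finally show ?thesis by (simp add: K_def algebra_simps)
  qed
  have "\<bar>f x - f y - g p \<bullet> (x - y)\<bar> \<le> K * (norm (x - p) + norm (y - p)) * norm (x - y)"
    if x: "x \<in> ball p r" and y: "y \<in> ball p r" for x y
  proof -
    have seg: "norm (y + t *\<^sub>R (x - y) - p) \<le> t * norm (x - p) + (1 - t) * norm (y - p)" if "0 \<le> t" "t \<le> 1" for t
    proof -
      have "y + t *\<^sub>R (x - y) - p = t *\<^sub>R (x - p) + (1 - t) *\<^sub>R (y - p)" by (simp add: algebra_simps)
      then show ?thesis
        using norm_triangle_ineq[of "t *\<^sub>R (x - p)" "(1 - t) *\<^sub>R (y - p)"] that by simp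
    qed
    have xy: "norm (x - p) < r" "norm (y - p) < r" using x y by (auto simp: dist_norm norm_minus_commute)
    have seg_r: "norm (y + t *\<^sub>R (x - y) - p) < r" if t: "0 \<le> t" "t \<le> 1" for t
    proof -
      have "t * norm (x - p) + (1 - t) * norm (y - p) < r"
        using convex_bound_lt[OF xy, of t "1 - t"] t by simp
      then show ?thesis using seg[OF t] by simp
    qed
    have D: "((\<lambda>t. f (y + t *\<^sub>R (x - y))) has_real_derivative g (y + t *\<^sub>R (x - y)) \<bullet> (x - y)) (at t)"
      if t: "0 \<le> t" "t \<le> 1" for t
    proof -
      have line: "((\<lambda>t. y + t *\<^sub>R (x - y)) has_derivative (\<lambda>t. t *\<^sub>R (x - y))) (at t)"
        by (auto intro!: derivative_eq_intros)
      have "dist (y + t *\<^sub>R (x - y)) p < d2" using seg_r[OF t] by (simp add: r_def dist_norm)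
      from has_derivative_compose[OF line d2(2)[OF this]] show ?thesis
        unfolding has_field_derivative_def by (rule has_derivative_eq_rhs) (simp add: fun_eq_iff)
    qed
    have "\<exists>z>0. z < 1 \<and> f (y + 1 *\<^sub>R (x - y)) - f (y + 0 *\<^sub>R (x - y)) = (1 - 0) * (g (y + z *\<^sub>R (x - y)) \<bullet> (x - y))"
      by (intro MVT2 D) auto
    then obtain z where z: "0 < z" "z < 1" "f x - f y = g (y + z *\<^sub>R (x - y)) \<bullet> (x - y)" by auto
    have "\<bar>f x - f y - g p \<bullet> (x - y)\<bar> = \<bar>(g (y + z *\<^sub>R (x - y)) - g p) \<bullet> (x - y)\<bar>"
      unfolding z(3) by (simp only: inner_diff_left)
    also have "\<dots> \<le> norm (g (y + z *\<^sub>R (x - y)) - g p) * norm (x - y)" by (rule Cauchy_Schwarz_ineq2)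
    also have "\<dots> \<le> (K * (norm (x - p) + norm (y - p))) * norm (x - y)"
    proof (intro mult_right_mono)
      have "norm (g (y + z *\<^sub>R (x - y)) - g p) \<le> K * norm (y + z *\<^sub>R (x - y) - p)"
        using z by (intro gb seg_r) auto
      also have "\<dots> \<le> K * (norm (x - p) + norm (y - p))"
      proof (rule mult_left_mono)
        have "z * norm (x - p) \<le> 1 * norm (x - p)" "(1 - z) * norm (y - p) \<le> 1 * norm (y - p)"
          using z by (intro mult_right_mono; simp)+
        then show "norm (y + z *\<^sub>R (x - y) - p) \<le> norm (x - p) + norm (y - p)"
          using seg[of z] z by simp
      qed (use B in \<open>simp add: K_def\<close>)
      finally show "norm (g (y + z *\<^sub>R (x - y)) - g p) \<le> K * (norm (x - p) + norm (y - p))" .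
    qed simp
    finally show ?thesis .
  qed
  moreover have "K > 0" "r > 0" using B d1 d2 by (auto simp: K_def r_def)
  ultimately show ?thesis by blast
qed

text \<open>Bridges partial and total derivatives: \<open>Ck_on\<close> requires each partial
  derivative to be differentiable, so the gradient is differentiable componentwise.\<close>

lemma Ck2_has_hessian:
  fixes f :: "real^'n::finite \<Rightarrow> real"
  assumes S: "open S" "x \<in> S" and f: "Ck_on 2 S f"
  shows "has_hessian f (grad f) (\<lambda>h. \<chi> j. grad (partial j f) x \<bullet> h) x"
proof -
  have fd: "f differentiable at y" if "y \<in> S" for y using f that by (simp add: numeral_2_eq_2)
  have pd: "partial j f differentiable at x" for j using f S by (simp add: numeral_2_eq_2)
  have D: "(f' has_derivative (\<lambda>h. grad f' y \<bullet> h)) (at y)" if "f' differentiable at y" for f' :: "real^'n \<Rightarrow> real" and y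
    using that grad_inner[OF that] by (simp add: frechet_derivative_works)
  show ?thesis
    unfolding has_hessian_def
  proof
    show "\<forall>\<^sub>F y in nhds x. (f has_derivative (\<lambda>h. grad f y \<bullet> h)) (at y)"
      unfolding eventually_nhds using S fd D by blast
    have "(\<lambda>y. grad f y \<bullet> axis j 1) = partial j f" for j
      by (simp add: fun_eq_iff inner_axis grad_def)
    then have "((\<lambda>y. grad f y \<bullet> axis j 1) has_derivative (\<lambda>h. (\<chi> j. grad (partial j f) x \<bullet> h) \<bullet> axis j 1)) (at x)" for j
      using D[OF pd[of j]] by (simp add: inner_axis)
    then show "(grad f has_derivative (\<lambda>h. \<chi> j. grad (partial j f) x \<bullet> h)) (at x)"
      by (subst has_derivative_componentwise_within) (auto simp: Basis_vec_def)
  qed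
qed

lemma tr_vec: "tr H = (\<Sum>i\<in>UNIV. H (axis i 1) $ i)" for H :: "real^'n::finite \<Rightarrow> real^'n"
  by (simp add: tr_def Basis_vec_def UNION_singleton_eq_range sum.reindex axis_eq_axis inj_on_def inner_axis)

lemma tr_hessian_matrix: "tr (\<lambda>h. \<chi> j. grad (partial j f) x \<bullet> h) = laplacian f x"
  by (simp add: tr_vec laplacian_def grad_def inner_axis)

lemma Ck2_has_laplacian:
  fixes f :: "real^'n::finite \<Rightarrow> real"
  assumes "open S" "x \<in> S" "Ck_on 2 S f"
  shows "has_laplacian f x (laplacian f x)"
  using Ck2_has_hessian[OF assms] tr_hessian_matrix[of f x] unfolding has_laplacian_def by metis

section \<open>Local geometry of domains of class C^2\<close>

lemma graph_fun_has_hessian: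
  fixes \<gamma> :: "real^'n::finite \<Rightarrow> real"
  assumes "Ck_on 2 UNIV \<gamma>"
  shows "\<exists>g H. has_hessian (graph_fun e \<gamma>) g H p"
proof -
  define P where "P = (\<lambda>x::real^'n. x - (x \<bullet> e) *\<^sub>R e)"
  have PD: "(P has_derivative P) (at x)" for x
    unfolding P_def by (auto intro!: derivative_eq_intros)
  have Padj: "P a \<bullet> b = a \<bullet> P b" for a b
    by (simp add: P_def inner_diff_left inner_diff_right inner_commute)
  have \<gamma>: "has_hessian \<gamma> (grad \<gamma>) (\<lambda>h. \<chi> j. grad (partial j \<gamma>) x \<bullet> h) x" for x
    using Ck2_has_hessian[of UNIV x \<gamma>] assms by simp
  have F: "graph_fun e \<gamma> = (\<lambda>x. e \<bullet> x - \<gamma> (P x))"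
    by (simp add: fun_eq_iff graph_fun_def P_def inner_commute)
  have "(graph_fun e \<gamma> has_derivative (\<lambda>h. (e - P (grad \<gamma> (P x))) \<bullet> h)) (at x)" for x
  proof -
    note d = has_derivative_compose[OF PD has_hessian_derivative[OF \<gamma>]]
    show ?thesis unfolding F
      by (rule derivative_eq_intros d refl)+ (simp add: fun_eq_iff inner_diff_left Padj)
  qed
  moreover have "((\<lambda>x. e - P (grad \<gamma> (P x))) has_derivative
      (\<lambda>h. 0 - P (\<chi> j. grad (partial j \<gamma>) (P p) \<bullet> P h))) (at p)"
    using \<gamma>[of "P p"] unfolding has_hessian_def
    by (intro has_derivative_diff has_derivative_const has_derivative_compose[OF _ PD] has_derivative_compose[OF PD]) auto
  ultimately show ?thesis unfolding has_hessian_def by (intro exI conjI always_eventually allI)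
qed

lemma grad_eqI:
  assumes "(f has_derivative (\<lambda>h. v \<bullet> h)) (at x)"
  shows "grad f x = v"
proof -
  have "grad f x \<bullet> h = v \<bullet> h" for h
    using assms grad_inner[of f x h] frechet_derivative_at[OF assms] by (metis differentiableI)
  then show ?thesis by (metis vector_eq_rdot)
qed

lemma graph_fun_strict:
  fixes \<gamma> :: "real^'n::finite \<Rightarrow> real"
  assumes "Ck_on 2 UNIV \<gamma>"
  shows "\<exists>K>0. \<exists>r>0. \<forall>x\<in>ball p r. \<forall>y\<in>ball p r.
     \<bar>graph_fun e \<gamma> x - graph_fun e \<gamma> y - grad (graph_fun e \<gamma>) p \<bullet> (x - y)\<bar>
       \<le> K * (norm (x - p) + norm (y - p)) * norm (x - y)"
proof -
  obtain g H where h: "has_hessian (graph_fun e \<gamma>) g H p" using graph_fun_has_hessian[OF assms] by blast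
  have "grad (graph_fun e \<gamma>) p = g p" by (rule grad_eqI[OF has_hessian_derivative[OF h]])
  then show ?thesis using has_hessian_strict[OF h] by simp
qed

text \<open>A defining function with gradient c \<nu> at p and quadratic error; tangent balls and
  transversality are read off this expansion.\<close>

lemma outward_unit_normal_local:
  fixes \<Omega> :: "(real^'n::finite) set"
  assumes \<Omega>: "open \<Omega>" and p: "p \<in> frontier \<Omega>" and n: "outward_unit_normal \<Omega> p \<nu>"
  shows "\<exists>F c K r. 0 < c \<and> 0 < K \<and> 0 < r \<and> F p = 0 \<and> (\<forall>x\<in>ball p r. x \<in> \<Omega> \<longleftrightarrow> F x < 0) \<and>
    (\<forall>x\<in>ball p r. \<forall>y\<in>ball p r. \<bar>F x - F y - c * (\<nu> \<bullet> (x - y))\<bar>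
       \<le> K * (norm (x - p) + norm (y - p)) * norm (x - y))"
proof -
  obtain r e \<gamma> where gr: "C2_graph_near \<Omega> p r e \<gamma>" and \<nu>: "\<nu> = sgn (grad (graph_fun e \<gamma>) p)"
    using n unfolding outward_unit_normal_def by blast
  define F where "F = graph_fun e \<gamma>"
  define N where "N = grad F p"
  have r: "r > 0" and \<gamma>: "Ck_on 2 UNIV \<gamma>" and in\<Omega>: "\<Omega> \<inter> ball p r = {x \<in> ball p r. F x < 0}"
    using gr by (auto simp: C2_graph_near_def F_def)
  have "norm \<nu> = 1" using norm_outward_unit_normal[OF n] .
  then have N0: "N \<noteq> 0" using \<nu> by (auto simp: N_def F_def)
  have N: "N = norm N *\<^sub>R \<nu>" using N0 by (simp add: \<nu> N_def F_def sgn_div_norm)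
  have Nv: "N \<bullet> v = norm N * (\<nu> \<bullet> v)" for v by (metis N inner_scaleR_left)
  obtain K r' where K: "K > 0" "r' > 0" "\<And>x y. x \<in> ball p r' \<Longrightarrow> y \<in> ball p r' \<Longrightarrow>
     \<bar>F x - F y - N \<bullet> (x - y)\<bar> \<le> K * (norm (x - p) + norm (y - p)) * norm (x - y)"
    using graph_fun_strict[OF \<gamma>, of p e] unfolding F_def N_def by blast
  obtain g H where "has_hessian F g H p" using graph_fun_has_hessian[OF \<gamma>] unfolding F_def by blast
  then have cF: "isCont F p" using has_hessian_derivative has_derivative_continuous by blast
  have mem: "x \<in> \<Omega> \<longleftrightarrow> F x < 0" if "x \<in> ball p r" for x using in\<Omega> that by blast
  have p': "p \<notin> \<Omega>" "p \<in> closure \<Omega>" using p \<Omega> by (auto simp: frontier_def interior_open)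
  \<comment> \<open>The graph description only says where F is negative, so the value at p comes
    from p being outside \<Omega> but a limit of points in it.\<close>
  have "F p = 0"
  proof (rule antisym)
    show "0 \<le> F p" using mem[of p] r p'(1) by simp
    have "at p within \<Omega> \<noteq> bot" using p' by (simp add: trivial_limit_within islimpt_in_closure)
    moreover have "(F \<longlongrightarrow> F p) (at p within \<Omega>)"
      using cF by (auto simp: isCont_def intro: tendsto_within_subset)
    moreover have "\<forall>\<^sub>F x in at p within \<Omega>. F x \<le> 0"
      unfolding eventually_at using r mem by (intro exI[of _ r]) (auto simp: dist_commute less_imp_le)
    ultimately show "F p \<le> 0" by (intro tendsto_upperbound)
  qed
  moreover have "\<bar>F x - F y - norm N * (\<nu> \<bullet> (x - y))\<bar> \<le> K * (norm (x - p) + norm (y - p)) * norm (x - y)"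
    if "x \<in> ball p (min r r')" "y \<in> ball p (min r r')" for x y
    using K(3)[of x y] that Nv by simp
  ultimately show ?thesis
    using K r N0 mem by (intro exI[of _ F] exI[of _ "norm N"] exI[of _ K] exI[of _ "min r r'"]) auto
qed

text \<open>In the ball of radius s around p - s \<sigma> one has |x - p|^2 < - 2 s \<sigma> . (x -
  p). If 2 K s <= c, the linear part of F thus outweighs the quadratic error; \<sigma> = \<nu> and
  \<sigma> = - \<nu> give the two balls.\<close>

lemma outward_unit_normal_touching_balls:
  fixes \<Omega> :: "(real^'n::finite) set"
  assumes \<Omega>: "open \<Omega>" and p: "p \<in> frontier \<Omega>" and n: "outward_unit_normal \<Omega> p \<nu>"
  shows "\<exists>r>0. ball (p - r *\<^sub>R \<nu>) r \<subseteq> \<Omega> \<and> ball (p + r *\<^sub>R \<nu>) r \<inter> \<Omega> = {}"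
proof -
  obtain F c K r where F: "0 < c" "0 < K" "0 < r" "F p = 0" "\<And>x. x \<in> ball p r \<Longrightarrow> x \<in> \<Omega> \<longleftrightarrow> F x < 0"
    "\<And>x y. x \<in> ball p r \<Longrightarrow> y \<in> ball p r \<Longrightarrow> \<bar>F x - F y - c * (\<nu> \<bullet> (x - y))\<bar>
       \<le> K * (norm (x - p) + norm (y - p)) * norm (x - y)"
    using outward_unit_normal_local[OF assms] by metis
  have \<nu>: "norm \<nu> = 1" by (rule norm_outward_unit_normal[OF n])
  define s where "s = min (r / 2) (c / (2 * K))"
  have s: "0 < s" "2 * s \<le> r" "2 * K * s \<le> c" using F by (auto simp: s_def min_def field_simps)
  have in_r: "x \<in> ball p r" if "x \<in> ball (p - s *\<^sub>R \<sigma>) s" "norm \<sigma> = 1" for x \<sigma>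
  proof -
    have "dist p x \<le> dist p (p - s *\<^sub>R \<sigma>) + dist (p - s *\<^sub>R \<sigma>) x" by (rule dist_triangle)
    then show ?thesis using that s by (simp add: dist_norm[of p])
  qed
  have Fb: "\<bar>F x - c * (\<nu> \<bullet> (x - p))\<bar> \<le> K * (norm (x - p))\<^sup>2" if "x \<in> ball p r" for x
    using F(6)[of x p] F(3,4) that by (simp add: power2_eq_square)
  have sq: "c * (norm (x - p))\<^sup>2 < - 2 * s * (c * (\<sigma> \<bullet> (x - p)))" if x: "x \<in> ball (p - s *\<^sub>R \<sigma>) s" "norm \<sigma> = 1" for x \<sigma>
  proof -
    have "dist (p - s *\<^sub>R \<sigma>) x = norm ((x - p) + s *\<^sub>R \<sigma>)"
      unfolding dist_norm norm_minus_commute[of _ x] by (simp add: algebra_simps)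
    then have "(norm ((x - p) + s *\<^sub>R \<sigma>))\<^sup>2 < s\<^sup>2" using x(1) s(1) by (intro power_strict_mono) auto
    moreover have "(norm ((x - p) + s *\<^sub>R \<sigma>))\<^sup>2 = (norm (x - p))\<^sup>2 + 2 * s * (\<sigma> \<bullet> (x - p)) + s\<^sup>2 * (norm \<sigma>)\<^sup>2"
      unfolding power2_norm_eq_inner inner_add_left inner_add_right
      by (simp add: inner_commute power2_eq_square)
    ultimately have "(norm (x - p))\<^sup>2 < - 2 * s * (\<sigma> \<bullet> (x - p))" using x(2) by simp
    then have "c * (norm (x - p))\<^sup>2 < c * (- 2 * s * (\<sigma> \<bullet> (x - p)))" using F(1) by (rule mult_strict_left_mono)
    then show ?thesis by (simp add: mult_ac)
  qed
  have main: "K * (norm (x - p))\<^sup>2 < - (c * (\<sigma> \<bullet> (x - p)))" if x: "x \<in> ball (p - s *\<^sub>R \<sigma>) s" "norm \<sigma> = 1" for x \<sigma>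
  proof -
    have "2 * K * s * (norm (x - p))\<^sup>2 \<le> c * (norm (x - p))\<^sup>2" by (rule mult_right_mono[OF s(3)]) simp
    also have "\<dots> < - 2 * s * (c * (\<sigma> \<bullet> (x - p)))" by (rule sq[OF x])
    finally have "(2 * s) * (K * (norm (x - p))\<^sup>2) < (2 * s) * - (c * (\<sigma> \<bullet> (x - p)))"
      by (simp only: mult_ac mult_minus_left mult_minus_right)
    then show ?thesis using s(1) by (subst (asm) mult_less_cancel_left_pos) simp_all
  qed
  have "x \<in> \<Omega>" if x: "x \<in> ball (p - s *\<^sub>R \<nu>) s" for x
  proof -
    have "x \<in> ball p r" using in_r[OF x \<nu>] .
    then show ?thesis using Fb[of x] main[OF x \<nu>] F(5)[of x] by simp
  qed
  moreover have "x \<notin> \<Omega>" if x: "x \<in> ball (p + s *\<^sub>R \<nu>) s" for x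
  proof -
    have x': "x \<in> ball (p - s *\<^sub>R (- \<nu>)) s" "norm (- \<nu>) = 1" using x \<nu> by auto
    have "x \<in> ball p r" using in_r[OF x'] .
    then show ?thesis using Fb[of x] main[OF x'] F(5)[of x] by simp
  qed
  ultimately show ?thesis using s(1) by blast
qed

text \<open>A shift by - s e lowers the linear part of F by s c (\<nu> . e), whereas on a ball of
  radius \<rho> the error is at most 2 K \<rho> s |e|; a small \<rho> makes F decrease.\<close>

lemma outward_unit_normal_transversal:
  fixes \<Omega> :: "(real^'n::finite) set"
  assumes \<Omega>: "open \<Omega>" and p: "p \<in> frontier \<Omega>" and n: "outward_unit_normal \<Omega> p \<nu>" and e: "0 < \<nu> \<bullet> e"
  shows "\<exists>r>0. \<forall>x\<in>\<Omega> \<inter> ball p r. \<forall>s\<ge>0. x - s *\<^sub>R e \<in> ball p r \<longrightarrow> x - s *\<^sub>R e \<in> \<Omega>"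
proof -
  obtain F c K r where F: "0 < c" "0 < K" "0 < r" "F p = 0" "\<And>x. x \<in> ball p r \<Longrightarrow> x \<in> \<Omega> \<longleftrightarrow> F x < 0"
    "\<And>x y. x \<in> ball p r \<Longrightarrow> y \<in> ball p r \<Longrightarrow> \<bar>F x - F y - c * (\<nu> \<bullet> (x - y))\<bar>
       \<le> K * (norm (x - p) + norm (y - p)) * norm (x - y)"
    using outward_unit_normal_local[OF assms(1-3)] by metis
  define \<rho> where "\<rho> = min r (c * (\<nu> \<bullet> e) / (2 * K * norm e))"
  have e0: "norm e > 0" using e by auto
  have \<rho>: "0 < \<rho>" "\<rho> \<le> r" "K * (\<rho> + \<rho>) * norm e \<le> c * (\<nu> \<bullet> e)"
  proof -
    show "0 < \<rho>" "\<rho> \<le> r" using F e e0 by (auto simp: \<rho>_def)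
    have "\<rho> * (2 * K * norm e) \<le> (c * (\<nu> \<bullet> e) / (2 * K * norm e)) * (2 * K * norm e)"
      using F e0 by (intro mult_right_mono) (auto simp: \<rho>_def)
    also have "\<dots> = c * (\<nu> \<bullet> e)" using F e0 by simp
    finally show "K * (\<rho> + \<rho>) * norm e \<le> c * (\<nu> \<bullet> e)" by (simp add: mult_ac)
  qed
  have "x - s *\<^sub>R e \<in> \<Omega>" if x: "x \<in> \<Omega>" "x \<in> ball p \<rho>" and s: "0 \<le> s" "x - s *\<^sub>R e \<in> ball p \<rho>" for x s
  proof -
    define y where "y = x - s *\<^sub>R e"
    have n: "norm (x - p) \<le> \<rho>" "norm (y - p) \<le> \<rho>" using x s by (auto simp: y_def dist_norm norm_minus_commute)
    have b: "x \<in> ball p r" "y \<in> ball p r" using x(2) s(2) \<rho>(2) by (auto simp: y_def)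
    have "\<bar>F y - F x - c * (\<nu> \<bullet> (y - x))\<bar> \<le> K * (norm (y - p) + norm (x - p)) * norm (y - x)"
      by (rule F(6)[OF b(2,1)])
    also have "\<dots> \<le> K * (\<rho> + \<rho>) * norm (y - x)"
      using n F(2) by (intro mult_right_mono mult_left_mono add_mono) auto
    also have "\<dots> = s * (K * (\<rho> + \<rho>) * norm e)" using s(1) by (simp add: y_def mult_ac)
    also have "\<dots> \<le> s * (c * (\<nu> \<bullet> e))" using \<rho>(3) s(1) by (intro mult_left_mono)
    finally have "\<bar>F y - F x - c * (\<nu> \<bullet> (y - x))\<bar> \<le> s * (c * (\<nu> \<bullet> e))" .
    moreover have "c * (\<nu> \<bullet> (y - x)) = - (s * (c * (\<nu> \<bullet> e)))" by (simp add: y_def)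
    ultimately have "F y \<le> F x" by simp
    then show ?thesis using F(5)[OF b(1)] F(5)[OF b(2)] x(1) by (simp add: y_def)
  qed
  then show ?thesis using \<rho>(1) by blast
qed

text \<open>Links the assumption \<open>singular\<close> to the notion in H^1. A C^1 extension and
  its gradient are bounded: near 0 by their own continuity, elsewhere by the continuous extensions
  to the closure.\<close>

lemma removable_H1:
  fixes \<Omega> :: "(real^'n::finite) set"
  assumes \<Omega>: "open \<Omega>" "bounded \<Omega>" "0 \<in> \<Omega>"
    and u: "continuous_on (closure \<Omega> - {0}) u" and g: "continuous_on (closure \<Omega> - {0}) g"
    and ud: "\<And>x. x \<in> \<Omega> - {0} \<Longrightarrow> (u has_derivative (\<lambda>h. g x \<bullet> h)) (at x)"
    and v: "\<And>x. x \<in> \<Omega> \<Longrightarrow> (v has_derivative (\<lambda>h. g' x \<bullet> h)) (at x)" and g': "continuous_on \<Omega> g'"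
    and vu: "\<And>x. x \<in> \<Omega> - {0} \<Longrightarrow> v x = u x"
  shows "H1_on \<Omega> v \<and> (AE x\<in>\<Omega> in lebesgue. u x = v x)"
proof
  have oP: "open (\<Omega> - {0})" using \<Omega>(1) by (rule open_delete)
  have gg': "g' x = g x" if x: "x \<in> \<Omega> - {0}" for x
  proof -
    have "(v has_derivative (\<lambda>h. g x \<bullet> h)) (at x)"
      by (rule has_derivative_transform_within_open[OF ud[OF x] oP x]) (simp add: vu)
    from has_derivative_unique[OF v this] x have "g' x \<bullet> h = g x \<bullet> h" for h by (metis DiffD1)
    then show ?thesis by (metis vector_eq_rdot)
  qed
  obtain \<epsilon> where \<epsilon>: "\<epsilon> > 0" "cball 0 \<epsilon> \<subseteq> \<Omega>" using \<Omega> open_contains_cball by blast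
  have bdd: "\<exists>B. \<forall>x\<in>\<Omega>. norm (f x) \<le> B"
    if f: "continuous_on \<Omega> f" and h: "continuous_on (closure \<Omega> - {0}) h" and fh: "\<And>x. x \<in> \<Omega> - {0} \<Longrightarrow> f x = h x"
    for f h :: "real^'n \<Rightarrow> 'b::real_normed_vector"
  proof -
    have "compact (f ` cball 0 \<epsilon>)"
      using \<epsilon>(2) f by (intro compact_continuous_image continuous_on_subset[OF f]) auto
    then obtain B1 where B1: "\<And>x. x \<in> cball 0 \<epsilon> \<Longrightarrow> norm (f x) \<le> B1"
      using compact_imp_bounded by (force simp: bounded_iff)
    have "compact (closure \<Omega> - ball 0 \<epsilon>)" using \<Omega>(2) by (intro compact_diff) (auto simp: compact_closure)
    then have "compact (h ` (closure \<Omega> - ball 0 \<epsilon>))"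
      using \<epsilon>(1) by (intro compact_continuous_image continuous_on_subset[OF h]) auto
    then obtain B2 where B2: "\<And>x. x \<in> closure \<Omega> - ball 0 \<epsilon> \<Longrightarrow> norm (h x) \<le> B2"
      using compact_imp_bounded by (force simp: bounded_iff)
    have "norm (f x) \<le> max B1 B2" if x: "x \<in> \<Omega>" for x
    proof (cases "x \<in> cball 0 \<epsilon>")
      case True
      then show ?thesis using B1 by (simp add: le_max_iff_disj)
    next
      case False
      have "x \<noteq> 0" using False \<epsilon>(1) by auto
      then have "f x = h x" using fh x by simp
      then show ?thesis using B2[of x] False x closure_subset[of \<Omega>] by (auto simp: le_max_iff_disj)
    qed
    then show ?thesis by blast
  qed
  have vc: "continuous_on \<Omega> v" using v has_derivative_continuous by (blast intro: continuous_at_imp_continuous_on)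
  obtain B1 where B1: "\<And>x. x \<in> \<Omega> \<Longrightarrow> norm (v x) \<le> B1" using bdd[OF vc u vu] by blast
  obtain B2 where B2: "\<And>x. x \<in> \<Omega> \<Longrightarrow> norm (g' x) \<le> B2" using bdd[OF g' g gg'] by blast
  show "H1_on \<Omega> v"
    by (rule H1_on_C1[OF \<Omega>(1,2) v g', of "max B1 B2"])
       (use B1 B2 in \<open>auto simp: le_max_iff_disj\<close>)
  have "AE x in lebesgue. x \<notin> {0::real^'n}"
    using negligible_sing negligible_iff_null_sets by (intro AE_not_in) blast
  then show "AE x\<in>\<Omega> in lebesgue. u x = v x" by eventually_elim (use vu in auto)
qed

section \<open>The radial solution\<close>

lemma overdetermined_exists:
  fixes \<Omega> :: "(real^'n::finite) set"
  assumes n: "CARD('n) \<ge> 2" and dom: "C2_bounded_domain \<Omega>" and zero: "0 \<in> \<Omega>" and \<alpha>: "\<alpha> < 0"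
    and C2: "C2_upto (\<Omega> - {0}) (closure \<Omega> - {0}) u"
    and lap: "\<forall>x\<in>\<Omega> - {0}. - laplacian u x = 1"
    and pos: "\<forall>x\<in>\<Omega> - {0}. u x > 0"
    and bdry: "\<forall>x\<in>frontier \<Omega>. u x = 0"
    and nu: "\<forall>x\<in>frontier \<Omega>. outward_unit_normal \<Omega> x (\<nu> x)"
    and nd: "\<forall>x\<in>frontier \<Omega>. has_normal_derivative \<Omega> u (\<nu> x) x \<alpha>"
    and sing: "nonremovable_singularity_at_0 \<Omega> u"
  shows "\<exists>g G. overdetermined \<Omega> u g G \<alpha> \<nu>"
proof -
  have \<Omega>: "open \<Omega>" "connected \<Omega>" "bounded \<Omega>" using dom by (auto simp: C2_bounded_domain_def)
  have oP: "open (\<Omega> - {0})" using \<Omega>(1) by (rule open_delete)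
  have Ck: "Ck_on 2 (\<Omega> - {0}) u" and uc: "continuous_on (closure \<Omega> - {0}) u"
    using C2 by (auto simp: C2_upto_def)
  have "\<forall>i. \<exists>h. continuous_on (closure \<Omega> - {0}) h \<and> (\<forall>x\<in>\<Omega> - {0}. h x = partial i u x)"
    using C2 by (simp add: C2_upto_def extends_continuously_def)
  then obtain g1 where g1: "\<And>i. continuous_on (closure \<Omega> - {0}) (g1 i)"
      "\<And>i x. x \<in> \<Omega> - {0} \<Longrightarrow> g1 i x = partial i u x" by metis
  have "\<forall>i j. \<exists>h. continuous_on (closure \<Omega> - {0}) h \<and> (\<forall>x\<in>\<Omega> - {0}. h x = partial j (partial i u) x)"
    using C2 by (simp add: C2_upto_def extends_continuously_def)
  then obtain g2 where g2: "\<And>i j. continuous_on (closure \<Omega> - {0}) (g2 i j)"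
      "\<And>i j x. x \<in> \<Omega> - {0} \<Longrightarrow> g2 i j x = partial j (partial i u) x" by metis
  define g where "g = (\<lambda>x. \<chi> i. g1 i x)"
  define G where "G = (\<lambda>x h. \<chi> i. \<Sum>j\<in>UNIV. h $ j * g2 i j x)"
  have gg: "g x = grad u x" if "x \<in> \<Omega> - {0}" for x
    using g1(2)[OF that] by (simp add: g_def grad_def)
  have GG: "G x = (\<lambda>h. \<chi> j. grad (partial j u) x \<bullet> h)" if "x \<in> \<Omega> - {0}" for x
    using g2(2)[OF that] by (simp add: G_def grad_def inner_vec_def mult.commute fun_eq_iff)
  note hess = Ck2_has_hessian[OF oP _ Ck]
  have ud: "(u has_derivative (\<lambda>h. g x \<bullet> h)) (at x)" if x: "x \<in> \<Omega> - {0}" for x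
    using has_hessian_derivative[OF hess[OF x]] gg[OF x] by simp
  have gc: "continuous_on (closure \<Omega> - {0}) g" unfolding g_def by (intro continuous_intros g1)
  have "overdetermined \<Omega> u g G \<alpha> \<nu>"
  proof (rule overdetermined.intro)
    show "2 \<le> DIM(real^'n)" using n by simp
    show "open \<Omega>" "connected \<Omega>" "bounded \<Omega>" "0 \<in> \<Omega>" "\<alpha> < 0" by fact+
    show "continuous_on (closure \<Omega> - {0}) u" "continuous_on (closure \<Omega> - {0}) g" by fact+
    show "continuous_on (closure \<Omega> - {0}) (\<lambda>x. G x h)" for h
      unfolding G_def by (intro continuous_intros g2)
    show "linear (G x)" for x
      by (rule linearI) (simp_all add: G_def vec_eq_iff algebra_simps sum.distrib sum_distrib_left)
    show "(u has_derivative (\<lambda>h. g x \<bullet> h)) (at x)" if "x \<in> \<Omega> - {0}" for x using ud[OF that] .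
    show "(g has_derivative G x) (at x)" if x: "x \<in> \<Omega> - {0}" for x
    proof -
      have "(grad u has_derivative G x) (at x)" using hess[OF x] GG[OF x] by (simp add: has_hessian_def)
      then show ?thesis by (rule has_derivative_transform_within_open[OF _ oP x]) (simp add: gg)
    qed
    show "tr (G x) = - 1" if x: "x \<in> \<Omega> - {0}" for x
      using lap x unfolding GG[OF x] tr_hessian_matrix by (metis minus_equation_iff)
    show "0 < u x" if "x \<in> \<Omega> - {0}" for x using pos that by blast
    fix p
    assume p: "p \<in> frontier \<Omega>"
    have np: "outward_unit_normal \<Omega> p (\<nu> p)" using nu p by blast
    show "u p = 0" using bdry p by blast
    show "norm (\<nu> p) = 1" by (rule norm_outward_unit_normal[OF np])
    show "\<exists>r>0. ball (p - r *\<^sub>R \<nu> p) r \<subseteq> \<Omega> \<and> ball (p + r *\<^sub>R \<nu> p) r \<inter> \<Omega> = {}"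
      by (rule outward_unit_normal_touching_balls[OF \<Omega>(1) p np])
    show "\<exists>r>0. \<forall>x\<in>\<Omega> \<inter> ball p r. \<forall>s\<ge>0. x - s *\<^sub>R e \<in> ball p r \<longrightarrow> x - s *\<^sub>R e \<in> \<Omega>"
      if "0 < \<nu> p \<bullet> e" for e
      by (rule outward_unit_normal_transversal[OF \<Omega>(1) p np that])
    \<comment> \<open>Two limits of the same function at p, one from the continuity of g and one
      from the prescribed normal derivative; they agree because p is a limit point of the punctured
      domain.\<close>
    show "g p \<bullet> \<nu> p = \<alpha>"
    proof -
      have pc: "p \<in> closure \<Omega>" "p \<notin> \<Omega>" using p \<Omega>(1) by (auto simp: frontier_def interior_open)
      then have p0: "p \<noteq> 0" using zero by auto
      have nb: "at p within (\<Omega> - {0}) \<noteq> bot"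
      proof -
        have "p islimpt \<Omega>" using pc by (simp add: islimpt_in_closure)
        then have "p islimpt (insert 0 (\<Omega> - {0}))" using zero by (simp add: insert_absorb)
        then have "p islimpt (\<Omega> - {0})" by (subst (asm) islimpt_insert)
        then show ?thesis by (simp only: trivial_limit_within not_not)
      qed
      have "(g \<longlongrightarrow> g p) (at p within closure \<Omega> - {0})"
        using gc pc p0 by (auto simp: continuous_on)
      then have "(g \<longlongrightarrow> g p) (at p within \<Omega> - {0})"
        by (rule tendsto_within_subset) (use closure_subset[of \<Omega>] in auto)
      then have "((\<lambda>y. g y \<bullet> \<nu> p) \<longlongrightarrow> g p \<bullet> \<nu> p) (at p within \<Omega> - {0})" by (intro tendsto_intros)
      moreover have "((\<lambda>y. g y \<bullet> \<nu> p) \<longlongrightarrow> \<alpha>) (at p within \<Omega> - {0})"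
      proof (rule Lim_transform_eventually)
        have "((\<lambda>y. grad u y \<bullet> \<nu> p) \<longlongrightarrow> \<alpha>) (at p within \<Omega>)"
          using nd p by (simp add: has_normal_derivative_def)
        then show "((\<lambda>y. grad u y \<bullet> \<nu> p) \<longlongrightarrow> \<alpha>) (at p within \<Omega> - {0})"
          by (rule tendsto_within_subset) auto
        show "\<forall>\<^sub>F y in at p within \<Omega> - {0}. grad u y \<bullet> \<nu> p = g y \<bullet> \<nu> p"
          by (auto simp: eventually_at_filter gg)
      qed
      ultimately show ?thesis by (rule tendsto_unique[OF nb])
    qed
  next
    fix v g'
    assume "\<And>x. x \<in> \<Omega> \<Longrightarrow> (v has_derivative (\<lambda>h. g' x \<bullet> h)) (at x)" "continuous_on \<Omega> g'"
      "\<And>x. x \<in> \<Omega> - {0} \<Longrightarrow> v x = u x"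
    then have "H1_on \<Omega> v \<and> (AE x\<in>\<Omega> in lebesgue. u x = v x)"
      by (intro removable_H1[OF \<Omega>(1,3) zero uc gc ud]) auto
    then show False using sing by (auto simp: nonremovable_singularity_at_0_def)
  qed
  then show ?thesis by blast
qed

lemma harmonic_eq_zero:
  fixes f :: "'a::euclidean_space \<Rightarrow> real"
  assumes S: "open S" "bounded S" and h: "\<And>x. x \<in> S \<Longrightarrow> has_laplacian f x 0"
    and c: "continuous_on (closure S) f" and z: "\<And>x. x \<in> frontier S \<Longrightarrow> f x = 0"
    and x: "x \<in> S"
  shows "f x = 0"
proof -
  have *: "0 \<le> s * f x" for s
  proof (rule weak_minimum_principle[OF S _ _ x])
    show "\<exists>L\<le>0. has_laplacian (\<lambda>x. s * f x) y L" if "y \<in> S" for y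
      using has_laplacian_cmult[OF h[OF that], of s] by auto
    fix p \<epsilon> :: real and q assume q: "q \<in> frontier S" and \<epsilon>: "0 < \<epsilon>"
    have "(f \<longlongrightarrow> f q) (at q within closure S)"
      using c q by (auto simp: continuous_on frontier_def)
    then have "(f \<longlongrightarrow> f q) (at q within S)" by (rule tendsto_within_subset) (rule closure_subset)
    then have "((\<lambda>x. s * f x) \<longlongrightarrow> s * f q) (at q within S)" by (intro tendsto_intros)
    then show "\<forall>\<^sub>F x in at q within S. - \<epsilon> < s * f x"
      by (rule order_tendstoD) (use z[OF q] \<epsilon> in simp)
  qed
  from *[of 1] *[of "- 1"] show ?thesis by simp
qed

section \<open>The explicit solutions\<close>

lemma u_R_laplacian: "has_laplacian (u_R R :: real^'n::finite \<Rightarrow> real) x (- 1)"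
proof -
  have "has_laplacian (\<lambda>y::real^'n. (1 / (2 * real CARD('n))) * (R\<^sup>2 - y \<bullet> y)) x
      ((1 / (2 * real CARD('n))) * (0 - 2 * real DIM(real^'n)))"
    by (intro has_laplacian_cmult has_laplacian_diff has_laplacian_const has_laplacian_inner)
  moreover have "(\<lambda>y::real^'n. (1 / (2 * real CARD('n))) * (R\<^sup>2 - y \<bullet> y)) = u_R R"
    by (simp add: fun_eq_iff u_R_def power2_norm_eq_inner)
  ultimately show ?thesis by simp
qed

lemma u_R_has_derivative:
  "(u_R R has_derivative (\<lambda>h. ((- 1 / real CARD('n)) *\<^sub>R x) \<bullet> h)) (at (x::real^'n::finite))"
proof -
  have "u_R R = (\<lambda>y::real^'n. (1 / (2 * real CARD('n))) * (R\<^sup>2 - y \<bullet> y))"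
    by (simp add: fun_eq_iff u_R_def power2_norm_eq_inner)
  moreover have "((\<lambda>y::real^'n. (1 / (2 * real CARD('n))) * (R\<^sup>2 - y \<bullet> y)) has_derivative
     (\<lambda>h. (1 / (2 * real CARD('n))) * (0 - (x \<bullet> h + h \<bullet> x)))) (at x)"
    by (intro has_derivative_mult_right has_derivative_diff has_derivative_const has_derivative_inner has_derivative_ident)
  moreover have "(\<lambda>h. (1 / (2 * real CARD('n))) * (0 - (x \<bullet> h + h \<bullet> x))) = (\<lambda>h. ((- 1 / real CARD('n)) *\<^sub>R x) \<bullet> h)"
    by (simp add: fun_eq_iff inner_commute)
  ultimately show ?thesis by simp
qed

lemma u_R_isCont: "isCont (u_R R) (x::real^'n::finite)"
  using u_R_has_derivative has_derivative_continuous by blast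

lemma u_F_laplacian:
  fixes x :: "real^'n::finite"
  assumes n: "CARD('n) \<ge> 2" and x: "x \<noteq> 0"
  shows "has_laplacian (u_F 1 R) x 0"
proof (cases "CARD('n) \<ge> 3")
  case True
  let ?a = "1 - real DIM(real^'n) / 2"
  have "has_laplacian (\<lambda>y. ((y - 0) \<bullet> (y - 0)) powr ?a - 1 / R ^ (CARD('n) - 2)) x
     (2 * ?a * (2 * ?a - 2 + DIM(real^'n)) * ((x - 0) \<bullet> (x - 0)) powr (?a - 1) - 0)"
    by (intro has_laplacian_diff has_laplacian_radial_powr has_laplacian_const x)
  moreover have "((y - 0) \<bullet> (y - 0)) powr ?a = 1 / norm y ^ (CARD('n) - 2)" for y :: "real^'n"
  \<comment> \<open>At y = 0 both sides are 0 by the conventions for \<open>powr\<close> and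
    division, since n - 2 is positive.\<close>
  proof (cases "y = 0")
    case False
    have "((y - 0) \<bullet> (y - 0)) powr ?a = (norm y powr 2) powr ?a"
      using False by (simp add: power2_norm_eq_inner[symmetric])
    also have "\<dots> = norm y powr (2 * ?a)" by (rule powr_powr)
    also have "2 * ?a = - real (CARD('n) - 2)" using True by (simp add: of_nat_diff)
    also have "norm y powr \<dots> = 1 / norm y ^ (CARD('n) - 2)"
      using False by (simp add: powr_minus powr_realpow divide_inverse)
    finally show ?thesis .
  qed (use True in simp)
  ultimately show ?thesis using True by (simp add: u_F_def[abs_def])
next
  case False
  then have 2: "CARD('n) = 2" using n by simp
  have "has_laplacian (\<lambda>y. ln R + (- 1 / 2) * ln ((y - 0) \<bullet> (y - 0))) x
     (0 + (- 1 / 2) * ((2 * real DIM(real^'n) - 4) / ((x - 0) \<bullet> (x - 0))))"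
    by (intro has_laplacian_add has_laplacian_const has_laplacian_cmult has_laplacian_radial_ln x)
  moreover have "(\<lambda>y::real^'n. ln R + (- 1 / 2) * ln ((y - 0) \<bullet> (y - 0))) = u_F 1 R"
  proof
    fix y :: "real^'n"
    show "ln R + (- 1 / 2) * ln ((y - 0) \<bullet> (y - 0)) = u_F 1 R y"
    \<comment> \<open>At y = 0 the equality rests on \<open>ln 0 = 0\<close>.\<close>
    proof (cases "y = 0")
      case False
      then have "ln (y \<bullet> y) = 2 * ln (norm y)"
        by (simp add: power2_norm_eq_inner[symmetric] ln_realpow)
      then show ?thesis using 2 by (simp add: u_F_def)
    qed (use 2 in \<open>simp add: u_F_def\<close>)
  qed
  ultimately show ?thesis using 2 by simp
qed

lemma u_F_cmult: "u_F C R x = C * u_F 1 R (x::real^'n::finite)"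
  by (simp add: u_F_def right_diff_distrib)

lemma u_F_radial: "norm x = norm y \<Longrightarrow> u_F C R x = u_F C R y" for x y :: "real^'n::finite"
  by (simp add: u_F_def)

lemma u_F_boundary: "norm x = R \<Longrightarrow> u_F C R (x::real^'n::finite) = 0"
  by (simp add: u_F_def)

lemma u_F_pos:
  fixes x :: "real^'n::finite"
  assumes x: "0 < norm x" "norm x < R"
  shows "0 < u_F 1 R x"
proof (cases "CARD('n) \<ge> 3")
  case True
  have "norm x ^ (CARD('n) - 2) < R ^ (CARD('n) - 2)"
    using x True by (intro power_strict_mono) auto
  then have "1 / R ^ (CARD('n) - 2) < 1 / norm x ^ (CARD('n) - 2)"
  proof (rule divide_strict_left_mono)
    have "0 < norm x ^ (CARD('n) - 2)" "0 < R ^ (CARD('n) - 2)"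
      using x less_trans[OF x] by (blast intro: zero_less_power)+
    then show "0 < R ^ (CARD('n) - 2) * norm x ^ (CARD('n) - 2)" by simp
  qed simp
  then show ?thesis using True by (simp add: u_F_def)
next
  case False
  moreover have "ln (norm x) < ln R" using x by (subst ln_less_cancel_iff) linarith+
  ultimately show ?thesis by (simp add: u_F_def)
qed

text \<open>Solves \<open>- \<alpha> = R / n + C (n - 2) R\<^sup>1\<^sup>-\<^sup>n\<close> for \<open>C\<close>, with \<open>n - 2\<close> replaced by \<open>1\<close> if \<open>n = 2\<close>.\<close>

definition u_F_const :: "'n::finite itself \<Rightarrow> real \<Rightarrow> real \<Rightarrow> real" where
  "u_F_const _ \<alpha> R = (- \<alpha> - R / real CARD('n)) * R ^ (CARD('n) - 1)
     / (if CARD('n) \<ge> 3 then real (CARD('n) - 2) else 1)"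

lemma overdetermined_formula:
  fixes \<Omega> :: "(real^'n::finite) set"
  assumes od: "overdetermined \<Omega> u g G \<alpha> \<nu>" and \<Omega>: "\<Omega> = ball 0 R" and R: "R > 0"
  shows "u_F_const TYPE('n) \<alpha> R > 0 \<and>
    (\<forall>x\<in>cball 0 R - {0}. u x = u_R R x + u_F (u_F_const TYPE('n) \<alpha> R) R x)"
proof -
  interpret overdetermined \<Omega> u g G \<alpha> \<nu> by (rule od)
  have n: "CARD('n) \<ge> 2" using dim by simp
  define \<Phi> :: "real^'n \<Rightarrow> real" where "\<Phi> = u_F 1 R"
  have cl: "closure \<Omega> = cball 0 R" and fr: "frontier \<Omega> = sphere 0 R"
    using R by (simp_all add: \<Omega> frontier_ball)
  have \<Phi>L: "has_laplacian \<Phi> x 0" if "x \<noteq> 0" for x using u_F_laplacian[OF n that] by (simp add: \<Phi>_def)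
  define f where "f = (\<lambda>b x. u x - u_R R x - b * \<Phi> x)"
  have fL: "has_laplacian (f b) x 0" if "x \<in> \<Omega> - {0}" for b x
    using has_laplacian_diff[OF has_laplacian_diff[OF u_laplacian[OF that] u_R_laplacian[of R x]]
        has_laplacian_cmult[OF \<Phi>L[of x], of b]] that by (simp add: f_def)
  have fc: "continuous_on (cball 0 R - {0}) (f b)" for b
  proof -
    have "continuous_on (cball 0 R - {0}) \<Phi>"
      using \<Phi>L has_laplacian_isCont by (intro continuous_at_imp_continuous_on) blast
    moreover have "continuous_on (cball 0 R - {0}) (u_R R :: real^'n \<Rightarrow> real)"
      using u_R_isCont by (intro continuous_at_imp_continuous_on) blast
    ultimately show ?thesis using u_cont unfolding f_def cl by (intro continuous_intros)
  qed
  have fR: "f b x = 0" if "norm x = R" for b x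
    using that u_zero[of x] by (simp add: f_def fr u_R_def \<Phi>_def u_F_boundary)
  have annulus: "\<exists>b. \<forall>x. \<rho> \<le> norm x \<longrightarrow> norm x \<le> R \<longrightarrow> f b x = 0" if \<rho>: "0 < \<rho>" "\<rho> < R" for \<rho>
  proof -
    obtain p :: "real^'n" where p: "norm p = \<rho>" using vector_choose_size[of \<rho>] \<rho> by auto
    have p\<Omega>: "p \<in> \<Omega> - {0}" using p \<rho> by (auto simp: \<Omega>)
    \<comment> \<open>Matches the values at p and hence, all functions being radial, on the inner
      sphere; on the outer sphere all of them vanish.\<close>
    define b where "b = (u p - u_R R p) / \<Phi> p"
    have "0 < \<Phi> p" unfolding \<Phi>_def using p \<rho> by (intro u_F_pos) linarith+
    then have fp: "f b p = 0" by (simp add: f_def b_def)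
    have f\<rho>: "f b x = 0" if x: "norm x = \<rho>" for x
    proof -
      have "u x = u p" using u_radial[of p x] p\<Omega> p x by simp
      moreover have "u_R R x = u_R R p" "\<Phi> x = \<Phi> p"
        using u_F_radial[of x p] p x by (simp_all add: u_R_def \<Phi>_def)
      ultimately show ?thesis using fp by (simp add: f_def)
    qed
    define S where "S = ball (0::real^'n) R - cball 0 \<rho>"
    have oS: "open S" by (auto simp: S_def)
    have cS: "closure S \<subseteq> cball 0 R - ball 0 \<rho>"
      by (rule closure_minimal) (auto simp: S_def intro!: closed_Diff)
    have fS: "f b x = 0" if x: "x \<in> S" for x
    proof (rule harmonic_eq_zero[OF oS _ _ _ _ x])
      show "bounded S" by (rule bounded_subset[OF bounded_ball]) (auto simp: S_def)
      show "has_laplacian (f b) y 0" if "y \<in> S" for y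
        using that \<rho> by (intro fL) (auto simp: S_def \<Omega>)
      show "continuous_on (closure S) (f b)"
        by (rule continuous_on_subset[OF fc]) (use cS \<rho> in auto)
      show "f b y = 0" if y: "y \<in> frontier S" for y
      proof -
        have "y \<in> closure S" "y \<notin> S" using y oS by (auto simp: frontier_def interior_open)
        then have "norm y = R \<or> norm y = \<rho>" using cS by (auto simp: S_def)
        then show ?thesis using fR f\<rho> by blast
      qed
    qed
    have "f b x = 0" if "\<rho> \<le> norm x" "norm x \<le> R" for x
    proof (cases "norm x = \<rho> \<or> norm x = R")
      case False
      then show ?thesis using that by (intro fS) (auto simp: S_def)
    qed (use fR f\<rho> in blast)
    then show ?thesis by blast
  qed
  obtain p :: "real^'n" where p: "norm p = R / 2" using vector_choose_size[of "R / 2"] R by auto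
  have \<Phi>p: "0 < \<Phi> p" unfolding \<Phi>_def using p R by (intro u_F_pos) linarith+
  define b where "b = (u p - u_R R p) / \<Phi> p"
  have fb: "f b x = 0" if x: "0 < norm x" "norm x \<le> R" for x
  proof -
    \<comment> \<open>Every annulus is chosen to contain the sphere of radius R / 2 through p, which
      makes the factor independent of x.\<close>
    have "0 < min (norm x) (R / 2)" "min (norm x) (R / 2) < R" using x R by (simp_all only: min_less_iff_disj) auto
    from annulus[OF this]
    obtain b' where b': "\<And>y. min (norm x) (R / 2) \<le> norm y \<Longrightarrow> norm y \<le> R \<Longrightarrow> f b' y = 0"
      by blast
    have "f b' p = 0" using b'[of p] p R by simp
    then have "b' = b" using \<Phi>p by (simp add: f_def b_def)
    then show ?thesis using b'[of x] x by simp
  qed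
  have formula: "u x = u_R R x + b * \<Phi> x" if "x \<in> cball 0 R - {0}" for x
    using fb[of x] that by (simp add: f_def)
  have b0: "0 \<le> b"
  proof -
    \<comment> \<open>b \<Phi> is harmonic off 0, vanishes on the boundary and is bounded below near
      0, because u > 0 and u_R is bounded above.\<close>
    have "0 \<le> b * \<Phi> p"
    proof (rule weak_minimum_principle_punctured[OF dim open_Omega bounded_Omega,
          where q = 0 and m = "- (R\<^sup>2 / (2 * real CARD('n)))"])
      show "p \<in> \<Omega>" "p \<noteq> 0" using p R by (auto simp: \<Omega>)
      show "\<exists>L\<le>0. has_laplacian (\<lambda>x. b * \<Phi> x) x L" if "x \<noteq> 0" for x
        using has_laplacian_cmult[OF \<Phi>L[OF that], of b] by auto
      show "\<forall>\<^sub>F x in at q within \<Omega>. - \<epsilon> < b * \<Phi> x" if q: "q \<in> frontier \<Omega>" and \<epsilon>: "0 < \<epsilon>" for q \<epsilon>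
      proof (rule eventually_within_gt)
        show "isCont (\<lambda>x. b * \<Phi> x) q"
          using \<Phi>L[of q] has_laplacian_isCont frontierD[OF q] by (intro continuous_intros) blast
        have "\<Phi> q = 0" using q by (simp add: \<Phi>_def fr u_F_boundary)
        then show "- \<epsilon> < b * \<Phi> q" using \<epsilon> by simp
      qed
      have "\<forall>\<^sub>F x in at 0. x \<in> \<Omega> - {0}"
        using open_Omega zero_in_Omega by (auto simp: eventually_at_topological)
      then show "\<forall>\<^sub>F x in at 0. - (R\<^sup>2 / (2 * real CARD('n))) \<le> b * \<Phi> x"
      proof eventually_elim
        case (elim x)
        have "b * \<Phi> x = u x - u_R R x" using formula[of x] elim by (simp add: \<Omega>)
        moreover have "u_R R x \<le> R\<^sup>2 / (2 * real CARD('n))"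
          by (simp add: u_R_def divide_right_mono)
        ultimately show ?case using u_pos[OF elim] by simp
      qed
    qed
    then show ?thesis using \<Phi>p by (simp add: zero_le_mult_iff)
  qed
  have "b \<noteq> 0"
  proof
    assume b: "b = 0"
    show False
    proof (rule singular[of "u_R R" "\<lambda>x. (- 1 / real CARD('n)) *\<^sub>R x"])
      show "(u_R R has_derivative (\<lambda>h. ((- 1 / real CARD('n)) *\<^sub>R x) \<bullet> h)) (at x)" for x :: "real^'n"
        by (rule u_R_has_derivative)
      show "u_R R x = u x" if "x \<in> \<Omega> - {0}" for x using formula[of x] that b by (simp add: \<Omega>)
    qed (intro continuous_intros)
  qed
  then have bpos: "0 < b" using b0 by simp
  have "b = u_F_const TYPE('n) \<alpha> R"
  proof -
    obtain z :: "real^'n" where z: "norm z = R" using vector_choose_size[of R] R by auto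
    have zf: "z \<in> frontier \<Omega>" using z by (simp add: fr)
    define m where "m = (1 / R) *\<^sub>R z"
    have "norm m = 1" and zm: "z = R *\<^sub>R m" using z R by (simp_all add: m_def)
    then have mm: "m \<bullet> m = 1" by (simp add: norm_eq_1)
    \<comment> \<open>If the normal were not radial, m - \<nu> z would point into the ball although
      the norm grows along it.\<close>
    have \<nu>m: "\<nu> z = m"
    proof (rule ccontr)
      assume ne: "\<nu> z \<noteq> m"
      have "0 < (m - \<nu> z) \<bullet> (m - \<nu> z)" using ne by simp
      then have lt: "m \<bullet> \<nu> z < 1"
        using mm nu_nu[OF zf] by (simp add: inner_diff_left inner_diff_right inner_commute)
      define d where "d = m - \<nu> z"
      have d: "d \<bullet> \<nu> z < 0" using lt nu_nu[OF zf] by (simp add: d_def inner_diff_left)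
      have "d \<bullet> m = 1 - m \<bullet> \<nu> z" by (simp add: d_def inner_diff_left mm inner_commute[of "\<nu> z"])
      then have dz: "0 < d \<bullet> z" using lt R by (simp add: zm)
      have "\<forall>\<^sub>F t in at_right (0::real). False"
        using inward_ray[OF zf d] eventually_pos_right
      proof eventually_elim
        case (elim t)
        have "(norm (z + t *\<^sub>R d))\<^sup>2 = R\<^sup>2 + 2 * t * (d \<bullet> z) + t\<^sup>2 * (d \<bullet> d)"
          unfolding z[symmetric] power2_norm_eq_inner
          by (simp add: inner_add_left inner_add_right inner_commute power2_eq_square)
        moreover have "(norm (z + t *\<^sub>R d))\<^sup>2 < R\<^sup>2"
          using elim R by (intro power_strict_mono) (auto simp: \<Omega>)
        moreover have "0 < t * (d \<bullet> z)" "0 \<le> t\<^sup>2 * (d \<bullet> d)" using elim dz by auto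
        ultimately show ?case by linarith
      qed
      then show False by simp
    qed
    define \<kappa> where "\<kappa> = (if CARD('n) \<ge> 3 then real (CARD('n) - 2) else 1)"
    define \<phi> where "\<phi> = (\<lambda>s. if CARD('n) \<ge> 3 then 1 / s ^ (CARD('n) - 2) - 1 / R ^ (CARD('n) - 2) else - (ln s - ln R))"
    have \<phi>: "(\<phi> has_real_derivative - \<kappa> / R ^ (CARD('n) - 1)) (at R)"
    proof (cases "CARD('n) \<ge> 3")
      case True
      \<comment> \<open>Writing n = k + 3 removes the truncated subtractions: n - 2 = k + 1 and n -
        1 = k + 2.\<close>
      then obtain k where k: "CARD('n) = k + 3" using le_Suc_ex by (metis add.commute)
      have "((\<lambda>s. s ^ Suc k) has_real_derivative real (Suc k) * R ^ k) (at R)"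
        using DERIV_pow[of "Suc k" R] by simp
      from DERIV_diff[OF DERIV_divide[OF DERIV_const this] DERIV_const, of 1 "1 / R ^ Suc k"]
      have "((\<lambda>s. 1 / s ^ Suc k - 1 / R ^ Suc k) has_real_derivative
          - (real (Suc k) * R ^ k) / (R ^ Suc k * R ^ Suc k)) (at R)"
        using R by simp
      moreover have "- (real (Suc k) * R ^ k) / (R ^ Suc k * R ^ Suc k) = - \<kappa> / R ^ (CARD('n) - 1)"
        using R by (simp add: \<kappa>_def k field_simps)
      ultimately show ?thesis by (simp add: \<phi>_def k)
    next
      case False
      then have "CARD('n) = 2" using n by simp
      then show ?thesis using R by (auto simp: \<phi>_def \<kappa>_def intro!: derivative_eq_intros)
    qed
    \<comment> \<open>The formula for u along a radius; its slope at R, taken inwards, must equal -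
      \<alpha>.\<close>
    define U where "U = (\<lambda>s. (R\<^sup>2 - s\<^sup>2) / (2 * real CARD('n)) + b * \<phi> s)"
    have U0: "U R = 0" by (simp add: U_def \<phi>_def)
    have UD: "(U has_real_derivative - R / real CARD('n) + b * (- \<kappa> / R ^ (CARD('n) - 1))) (at R)"
      unfolding U_def by (auto intro!: derivative_eq_intros \<phi>)
    have "((\<lambda>t. U (R - t)) has_real_derivative (- R / real CARD('n) + b * (- \<kappa> / R ^ (CARD('n) - 1))) * (- 1)) (at 0)"
      by (rule DERIV_chain2[of U]) (use UD in \<open>auto intro!: derivative_eq_intros\<close>)
    then have "((\<lambda>t. U (R - t) / t) \<longlongrightarrow> (- R / real CARD('n) + b * (- \<kappa> / R ^ (CARD('n) - 1))) * (- 1)) (at 0)"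
      by (simp add: has_field_derivative_iff U0)
    then have 1: "((\<lambda>t. U (R - t) / t) \<longlongrightarrow> (- R / real CARD('n) + b * (- \<kappa> / R ^ (CARD('n) - 1))) * (- 1)) (at_right 0)"
      by (rule tendsto_within_subset) simp
    have "((\<lambda>t. u (z + t *\<^sub>R (- m)) / t) \<longlongrightarrow> g z \<bullet> (- m)) (at_right 0)"
      by (rule boundary_taylor_1[OF zf]) (simp add: \<nu>m mm)
    moreover have "g z \<bullet> (- m) = - \<alpha>" using normal_deriv[OF zf] by (simp add: \<nu>m)
    moreover have "\<forall>\<^sub>F t in at_right 0. u (z + t *\<^sub>R (- m)) / t = U (R - t) / t"
      unfolding eventually_at_right_field
    proof (intro exI[of _ R] conjI allI impI R)
      fix t assume t: "0 < t" "t < R"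
      define x where "x = z + t *\<^sub>R (- m)"
      have "x = (R - t) *\<^sub>R m" by (simp add: x_def zm algebra_simps)
      then have nx: "norm x = R - t" using t mm by (simp add: norm_eq_1[symmetric])
      then have "u x = u_R R x + b * \<Phi> x" using t by (intro formula) auto
      also have "\<dots> = U (R - t)" by (simp add: U_def \<phi>_def u_R_def \<Phi>_def u_F_def nx)
      finally show "u (z + t *\<^sub>R (- m)) / t = U (R - t) / t" by (simp add: x_def)
    qed
    ultimately have 2: "((\<lambda>t. U (R - t) / t) \<longlongrightarrow> - \<alpha>) (at_right 0)"
      using Lim_transform_eventually by force
    have "- \<alpha> = (- R / real CARD('n) + b * (- \<kappa> / R ^ (CARD('n) - 1))) * (- 1)"
      by (rule tendsto_unique[OF trivial_limit_at_right_real 2 1])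
    then have "b * \<kappa> / R ^ (CARD('n) - 1) = - \<alpha> - R / real CARD('n)" by simp
    moreover have "\<kappa> \<noteq> 0" by (auto simp: \<kappa>_def)
    ultimately show ?thesis
      using R unfolding u_F_const_def \<kappa>_def[symmetric] by (simp add: field_simps)
  qed
  then show ?thesis using bpos formula by (simp add: u_F_cmult[of "u_F_const TYPE('n) \<alpha> R"] \<Phi>_def)
qed

section \<open>The torsion problem on a ball and the conclusion\<close>

lemma partial_linear: "partial j (\<lambda>x. c * (x $ i)) = (\<lambda>x::real^'n::finite. c * (axis j 1 $ i))"
proof
  fix x :: "real^'n"
  have "((\<lambda>x::real^'n. c * (x $ i)) has_derivative (\<lambda>h. c * (h $ i))) (at x)"
    by (intro has_derivative_mult_right bounded_linear_imp_has_derivative bounded_linear_vec_nth)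
  from frechet_derivative_at[OF this] show "partial j (\<lambda>x. c * (x $ i)) x = c * (axis j 1 $ i)"
    by (simp add: partial_def)
qed

text \<open>For uniqueness, the difference of two solutions is harmonic in the ball and vanishes on
  the sphere.\<close>

lemma u_R_torsion:
  assumes R: "0 < R"
  shows "unique_radial_torsion_solution (ball 0 R) (u_R R :: real^'n::finite \<Rightarrow> real)"
proof -
  let ?v = "u_R R :: real^'n \<Rightarrow> real"
  have p1: "partial i ?v = (\<lambda>x. (- 1 / real CARD('n)) * (x $ i))" for i
  proof
    fix x :: "real^'n"
    from frechet_derivative_at[OF u_R_has_derivative[of R x]]
    show "partial i ?v x = (- 1 / real CARD('n)) * (x $ i)"
      unfolding partial_def by (metis inner_axis inner_scaleR_left real_inner_1_right)
  qed
  have "torsion_solution (ball 0 R) ?v"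
    unfolding torsion_solution_def
  proof (intro conjI ballI)
    show "Ck_on 2 (ball 0 R) ?v"
    proof -
      have "?v differentiable (at x)" for x using u_R_has_derivative differentiableI by blast
      moreover have "(\<lambda>x::real^'n. (- 1 / real CARD('n)) * (x $ i)) differentiable (at x)" for i x
        by (rule differentiableI[OF has_derivative_mult_right[OF
              bounded_linear_imp_has_derivative[OF bounded_linear_vec_nth]]])
      ultimately show ?thesis by (simp only: numeral_2_eq_2 Ck_on.simps p1 partial_linear) simp
    qed
    show "continuous_on (closure (ball 0 R)) ?v"
      using u_R_isCont by (intro continuous_at_imp_continuous_on) blast
    show "- laplacian ?v x = 1" for x
      unfolding laplacian_def p1 partial_linear by simp
    show "?v x = 0" if "x \<in> frontier (ball 0 R)" for x
      using that R by (simp add: frontier_ball u_R_def)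
  qed
  moreover have "radial_on (closure (ball 0 R)) ?v" by (simp add: radial_on_def u_R_def)
  moreover have "w x = ?v x" if w: "torsion_solution (ball 0 R) w" and x: "x \<in> closure (ball 0 R)" for w x
  proof (cases "x \<in> ball 0 R")
    case True
    have "w x - ?v x = 0"
    proof (rule harmonic_eq_zero[where S = "ball 0 R" and f = "\<lambda>x. w x - ?v x"])
      show "has_laplacian (\<lambda>x. w x - ?v x) y 0" if y: "y \<in> ball 0 R" for y
      proof -
        have "has_laplacian w y (laplacian w y)"
          using w by (intro Ck2_has_laplacian[OF open_ball y]) (simp add: torsion_solution_def)
        moreover have "laplacian w y = - 1" using w y by (simp add: torsion_solution_def minus_equation_iff[of _ 1])
        ultimately show ?thesis using has_laplacian_diff[OF _ u_R_laplacian[of R y]] by force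
      qed
      show "continuous_on (closure (ball 0 R)) (\<lambda>x. w x - ?v x)"
        using w u_R_isCont unfolding torsion_solution_def
        by (intro continuous_on_diff continuous_at_imp_continuous_on[of _ ?v]) auto
      show "w y - ?v y = 0" if "y \<in> frontier (ball 0 R)" for y
        using w that R by (simp add: torsion_solution_def frontier_ball u_R_def)
    qed (use True in auto)
    then show ?thesis by simp
  next
    case False
    then have "x \<in> frontier (ball 0 R)" using x by (simp add: frontier_def)
    moreover from this have "?v x = 0" using R by (simp add: frontier_ball u_R_def)
    ultimately show ?thesis using w by (simp add: torsion_solution_def)
  qed
  ultimately show ?thesis unfolding unique_radial_torsion_solution_def by blast
qed

text \<open>\<open>Chat\<close> is quantified before the domain and the solution: for each dimension
  the constant is a fixed function of \<alpha> and R, which expresses its dependence on the boundary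
  data.\<close>

theorem corollary1p2:
  assumes n: "CARD('n::finite) \<ge> 2"
  shows "\<exists>Chat :: real \<Rightarrow> real \<Rightarrow> real.
    \<forall>(\<Omega> :: (real^'n) set) (\<alpha> :: real) (u :: real^'n \<Rightarrow> real) (\<nu> :: real^'n \<Rightarrow> real^'n).
      C2_bounded_domain \<Omega> \<and> 0 \<in> \<Omega> \<and> \<alpha> < 0 \<and>
      C2_upto (\<Omega> - {0}) (closure \<Omega> - {0}) u \<and>
      (\<forall>x\<in>\<Omega> - {0}. - laplacian u x = 1) \<and>
      (\<forall>x\<in>\<Omega> - {0}. u x > 0) \<and>
      (\<forall>x\<in>frontier \<Omega>. u x = 0) \<and>
      (\<forall>x\<in>frontier \<Omega>. outward_unit_normal \<Omega> x (\<nu> x)) \<and>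
      (\<forall>x\<in>frontier \<Omega>. has_normal_derivative \<Omega> u (\<nu> x) x \<alpha>) \<and>
      nonremovable_singularity_at_0 \<Omega> u
      \<longrightarrow>
      (\<exists>R>0. \<Omega> = ball 0 R \<and>
         unique_radial_torsion_solution \<Omega> (u_R R) \<and>
         Chat \<alpha> R > 0 \<and>
         (\<forall>x\<in>cball 0 R - {0}. u x = u_R R x + u_F (Chat \<alpha> R) R x))"
proof (intro exI[of _ "u_F_const TYPE('n)"] allI impI, elim conjE)
  fix \<Omega> :: "(real^'n) set" and \<alpha> :: real and u :: "real^'n \<Rightarrow> real" and \<nu> :: "real^'n \<Rightarrow> real^'n"
  assume "C2_bounded_domain \<Omega>" "0 \<in> \<Omega>" "\<alpha> < 0" "C2_upto (\<Omega> - {0}) (closure \<Omega> - {0}) u"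
    "\<forall>x\<in>\<Omega> - {0}. - laplacian u x = 1" "\<forall>x\<in>\<Omega> - {0}. u x > 0" "\<forall>x\<in>frontier \<Omega>. u x = 0"
    "\<forall>x\<in>frontier \<Omega>. outward_unit_normal \<Omega> x (\<nu> x)"
    "\<forall>x\<in>frontier \<Omega>. has_normal_derivative \<Omega> u (\<nu> x) x \<alpha>"
    "nonremovable_singularity_at_0 \<Omega> u"
  from overdetermined_exists[OF n this] obtain g G where od: "overdetermined \<Omega> u g G \<alpha> \<nu>" by blast
  obtain R where R: "R > 0" "\<Omega> = ball 0 R" using overdetermined.Omega_ball[OF od] by blast
  show "\<exists>R>0. \<Omega> = ball 0 R \<and>
         unique_radial_torsion_solution \<Omega> (u_R R) \<and>
         u_F_const TYPE('n) \<alpha> R > 0 \<and>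
         (\<forall>x\<in>cball 0 R - {0}. u x = u_R R x + u_F (u_F_const TYPE('n) \<alpha> R) R x)"
    using R(1) R(2) u_R_torsion[OF R(1)] overdetermined_formula[OF od R(2,1)] by (intro exI[of _ R]) simp
qed

end
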